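(* There exists a connected compact set $E\subseteq\mathbb{C}$ with connected complement such that $\gamma(E)=\gamma_c(E)$ but the Ahlfors function for $E$ is not the Cauchy transform of any complex Borel measure supported on $E$; that is, if $f$ denotes the Ahlfors function for $E$, there is no finite complex Borel measure $\mu$ supported on $E$ with $f=\mathcal{C}_\mu$ on $\mathbb{C}_\infty\setminus E$.
   Context: $\mathbb{C}_\infty$ is the Riemann sphere. Analytic capacity: for $E\subseteq\mathbb{C}$ compact, let $\Omega$ be the component of $\mathbb{C}_\infty\setminus E$ containing $\infty$, and let $H^\infty(\Omega)$ be the class of bounded holomorphic functions on $\Omega$. Then $\gamma(E):=\sup\{|f'(\infty)| : f\in H^\infty(\Omega),\ |f|\le 1\}$, where $f'(\infty):=\lim_{z\to\infty} z(f(z)-f(\infty))$. Ahlfors function: if $\gamma(E)>0$, the Ahlfors function for $E$ is the unique $f\in H^\infty(\Omega)$ with $|f|\le 1$ and $f'(\infty)=\gamma(E)$; by convention it is extended to be identically zero on each bounded component of $\mathbb{C}_\infty\setminus E$. The assertion implicitly includes that $\gamma(E)>0$, so that the Ahlfors function is defined. Cauchy transform: for a finite complex Borel measure $\mu$ supported on $E$, $\mathcal{C}_\mu(z):=\int \frac{1}{\xi-z}\,d\mu(\xi)$ for $z\in\mathbb{C}_\infty\setminus E$ (with $\mathcal{C}_\mu(\infty)=0$). Cauchy capacity: $\gamma_c(E):=\sup\{|\mu(E)|\}$, the supremum being over all finite complex Borel measures $\mu$ supported on $E$ such that $|\mathcal{C}_\mu|\le 1$ on $\mathbb{C}_\infty\setminus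 E$. *)

theory Defs
  imports "HOL-Analysis.Analysis"
begin

section \<open>The Riemann sphere\<close>

text \<open>
  The sphere is the one-point compactification of the plane: \<^term>\<open>Some z\<close> is the finite
  point \<open>z\<close>, and \<^term>\<open>None\<close> is the point at infinity.
\<close>

definition riemann_sphere :: "complex option topology" where
  "riemann_sphere = Alexandroff_compactification euclidean"

definition sphere_compl :: "complex set \<Rightarrow> complex option set" where
  "sphere_compl E = topspace riemann_sphere - Some ` E"

definition outer_component :: "complex set \<Rightarrow> complex option set" where
  "outer_component E =
     connected_component_of_set (subtopology riemann_sphere (sphere_compl E)) None"

definition chart_inf :: "complex \<Rightarrow> complex option" where
  "chart_inf w = (if w = 0 then None else Some (1 / w))"

text \<open>
  Intended for open subsets \<open>W\<close> of the sphere; holomorphy is tested in the two standard charts.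
\<close>

definition sphere_holomorphic_on ::
    "(complex option \<Rightarrow> complex) \<Rightarrow> complex option set \<Rightarrow> bool" where
  "sphere_holomorphic_on f W \<longleftrightarrow>
     (\<lambda>z. f (Some z)) holomorphic_on (Some -` W) \<and>
     (\<lambda>w. f (chart_inf w)) holomorphic_on (chart_inf -` W)"

definition H_inf :: "complex option set \<Rightarrow> (complex option \<Rightarrow> complex) set" where
  "H_inf W = {f. sphere_holomorphic_on f W \<and> bounded (f ` W)}"

definition deriv_inf :: "(complex option \<Rightarrow> complex) \<Rightarrow> complex" where
  "deriv_inf f = Lim at_infinity (\<lambda>z. z * (f (Some z) - f None))"


section \<open>Analytic capacity and the Ahlfors function\<close>

definition analytic_capacity :: "complex set \<Rightarrow> real" where
  "analytic_capacity E =
     Sup {cmod (deriv_inf f) | f.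
            f \<in> H_inf (outer_component E) \<and> (\<forall>p\<in>outer_component E. cmod (f p) \<le> 1)}"

definition ahlfors_extremal :: "complex set \<Rightarrow> (complex option \<Rightarrow> complex) \<Rightarrow> bool" where
  "ahlfors_extremal E f \<longleftrightarrow>
     f \<in> H_inf (outer_component E) \<and>
     (\<forall>p\<in>outer_component E. cmod (f p) \<le> 1) \<and>
     deriv_inf f = complex_of_real (analytic_capacity E)"

text \<open>
  Functions on the complement of \<open>E\<close> are total functions here whose values on \<open>E\<close> are
  irrelevant, so the Ahlfors function is a predicate determining \<open>f\<close> on the complement only.
  The second clause is uniqueness of the extremal function on the outer component.
\<close>

definition is_ahlfors_function :: "complex set \<Rightarrow> (complex option \<Rightarrow> complex) \<Rightarrow> bool" where
  "is_ahlfors_function E f \<longleftrightarrow>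
     ahlfors_extremal E f \<and>
     (\<forall>g. ahlfors_extremal E g \<longrightarrow> (\<forall>p\<in>outer_component E. g p = f p)) \<and>
     (\<forall>p\<in>sphere_compl E - outer_component E. f p = 0)"


section \<open>Complex Borel measures\<close>

text \<open>
  A complex Borel measure is a countably additive complex-valued function on the Borel sets;
  it is automatically finite, and \<open>\<mu> {} = 0\<close> follows from summability. Values of \<open>\<mu>\<close> outside
  the Borel sets are irrelevant.
\<close>

definition complex_borel_measure :: "('a::topological_space set \<Rightarrow> complex) \<Rightarrow> bool" where
  "complex_borel_measure \<mu> \<longleftrightarrow>
     (\<forall>A :: nat \<Rightarrow> 'a set. range A \<subseteq> sets borel \<longrightarrow> disjoint_family A \<longrightarrow>
        (\<lambda>n. \<mu> (A n)) sums \<mu> (\<Union>n. A n))"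

text \<open>For closed \<open>E\<close> this says that the support of \<open>\<mu>\<close> is contained in \<open>E\<close>.\<close>

definition supported_on :: "('a::topological_space set \<Rightarrow> complex) \<Rightarrow> 'a set \<Rightarrow> bool" where
  "supported_on \<mu> E \<longleftrightarrow> (\<forall>A\<in>sets borel. A \<inter> E = {} \<longrightarrow> \<mu> A = 0)"

text \<open>
  The upper variation of a real-valued countably additive set function; the upper variations of
  \<open>\<nu>\<close> and \<open>-\<nu>\<close> are the two parts of the Jordan decomposition of \<open>\<nu>\<close>. Negative values are
  truncated to 0 by \<^const>\<open>ennreal\<close>, which does not affect the supremum because \<open>\<nu> {} = 0\<close>.
\<close>

definition upper_variation :: "('a::topological_space set \<Rightarrow> real) \<Rightarrow> 'a measure" where
  "upper_variation \<nu> =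
     measure_of UNIV (sets borel) (\<lambda>A. SUP B\<in>{B\<in>sets borel. B \<subseteq> A}. ennreal (\<nu> B))"

text \<open>The value of \<^const>\<open>measure_of\<close> is not the default zero measure:\<close>

lemma emeasure_upper_variation:
  fixes \<nu> :: "'a::topological_space set \<Rightarrow> real"
  assumes ca: "\<And>A :: nat \<Rightarrow> 'a set. range A \<subseteq> sets borel \<Longrightarrow> disjoint_family A \<Longrightarrow>
                 (\<lambda>n. \<nu> (A n)) sums \<nu> (\<Union>n. A n)"
    and A: "A \<in> sets borel"
  shows "emeasure (upper_variation \<nu>) A = (SUP B\<in>{B\<in>sets borel. B \<subseteq> A}. ennreal (\<nu> B))"
proof -
  define m where "m = (\<lambda>A. SUP B\<in>{B\<in>sets (borel :: 'a measure). B \<subseteq> A}. ennreal (\<nu> B))"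
  have e: "\<nu> {} = 0"
  proof -
    have "(\<lambda>n::nat. \<nu> {}) sums \<nu> (\<Union>n::nat. {})"
      by (rule ca) (auto simp: disjoint_family_on_def)
    then show ?thesis
      using sums_summable summable_const_iff by blast
  qed
  have add: "\<nu> (B \<union> C) = \<nu> B + \<nu> C"
    if "B \<in> sets borel" "C \<in> sets borel" "B \<inter> C = {}" for B C
  proof -
    have r: "range (binaryset B C) \<subseteq> sets borel" "disjoint_family (binaryset B C)"
      using that by (auto simp: binaryset_def disjoint_family_on_def)
    have "(\<lambda>n. \<nu> (binaryset B C n)) sums \<nu> (\<Union>n. binaryset B C n)"
      by (rule ca[OF r])
    moreover have "(\<lambda>n. \<nu> (binaryset B C n)) sums (\<nu> B + \<nu> C)"
      by (rule binaryset_sums[of \<nu>, OF e])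
    ultimately show ?thesis
      unfolding UN_binaryset_eq by (rule sums_unique2)
  qed
  have mono: "m B \<le> m C" if "B \<subseteq> C" for B C
    unfolding m_def using that by (intro SUP_subset_mono) auto
  have m0: "m {} = 0"
  proof -
    have "{B \<in> sets (borel :: 'a measure). B \<subseteq> {}} = {{}}" by auto
    then show ?thesis by (simp add: m_def e)
  qed
  have super: "m B + m C \<le> m (B \<union> C)" if "B \<inter> C = {}" for B C
  proof -
    have ne: "{X \<in> sets (borel :: 'a measure). X \<subseteq> D} \<noteq> {}" for D
      by blast
    have *: "ennreal (\<nu> X) + ennreal (\<nu> Y) \<le> m (B \<union> C)"
      if X: "X \<in> sets borel" "X \<subseteq> B" and Y: "Y \<in> sets borel" "Y \<subseteq> C" for X Y
    proof -
      have up: "ennreal (\<nu> Z) \<le> m (B \<union> C)" if "Z \<in> sets borel" "Z \<subseteq> B \<union> C" for Z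
        unfolding m_def using that by (intro SUP_upper) auto
      consider "\<nu> X \<le> 0" | "\<nu> Y \<le> 0" | "0 < \<nu> X" "0 < \<nu> Y" by linarith
      then show ?thesis
      proof cases
        case 1
        then show ?thesis using up[of Y] Y by (auto simp: ennreal_neg)
      next
        case 2
        then show ?thesis using up[of X] X by (auto simp: ennreal_neg)
      next
        case 3
        have "\<nu> (X \<union> Y) = \<nu> X + \<nu> Y"
          using X Y \<open>B \<inter> C = {}\<close> by (intro add) auto
        then show ?thesis
          using up[of "X \<union> Y"] X Y 3 by (auto simp: ennreal_plus)
      qed
    qed
    have "m B + m C = (SUP X\<in>{X\<in>sets borel. X \<subseteq> B}. ennreal (\<nu> X) + m C)"
      unfolding m_def by (subst ennreal_SUP_add_left[OF ne]) simp
    also have "\<dots> \<le> m (B \<union> C)"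
    proof (rule SUP_least)
      fix X assume X: "X \<in> {X\<in>sets borel. X \<subseteq> B}"
      have "ennreal (\<nu> X) + m C = (SUP Y\<in>{Y\<in>sets borel. Y \<subseteq> C}. ennreal (\<nu> X) + ennreal (\<nu> Y))"
        unfolding m_def by (subst ennreal_SUP_add_right[OF ne]) simp
      also have "\<dots> \<le> m (B \<union> C)"
        using X by (intro SUP_least *) auto
      finally show "ennreal (\<nu> X) + m C \<le> m (B \<union> C)" .
    qed
    finally show ?thesis .
  qed
  have caM: "countably_additive (sets borel) m"
  proof (rule countably_additiveI)
    fix A :: "nat \<Rightarrow> 'a set"
    assume A: "range A \<subseteq> sets borel" "disjoint_family A"
    show "(\<Sum>n. m (A n)) = m (\<Union>n. A n)"
    proof (rule antisym)
      have "(\<Sum>n<N. m (A n)) \<le> m (\<Union>n<N. A n)" for N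
      proof (induction N)
        case (Suc N)
        have "A n \<inter> A N = {}" if "n < N" for n
          using that by (intro disjoint_family_onD[OF A(2)]) auto
        then have "(\<Union>n<N. A n) \<inter> A N = {}"
          by blast
        then have le: "m (\<Union>n<N. A n) + m (A N) \<le> m ((\<Union>n<N. A n) \<union> A N)"
          by (rule super)
        have "(\<Sum>n<Suc N. m (A n)) \<le> m (\<Union>n<N. A n) + m (A N)"
          unfolding sum.lessThan_Suc by (rule add_right_mono[OF Suc])
        also note le
        also have "(\<Union>n<N. A n) \<union> A N = (\<Union>n<Suc N. A n)"
          by (auto simp: less_Suc_eq)
        finally show ?case .
      qed (simp add: m0)
      moreover have "m (\<Union>n<N. A n) \<le> m (\<Union>n. A n)" for N
        by (rule mono) auto
      ultimately have "(\<Sum>n<N. m (A n)) \<le> m (\<Union>n. A n)" for N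
        by (rule order_trans)
      then show "(\<Sum>n. m (A n)) \<le> m (\<Union>n. A n)"
        by (rule suminf_le_const[OF summableI])
    next
      have mU: "m (\<Union>n. A n) = (SUP B\<in>{B\<in>sets borel. B \<subseteq> (\<Union>n. A n)}. ennreal (\<nu> B))"
        by (simp add: m_def)
      show "m (\<Union>n. A n) \<le> (\<Sum>n. m (A n))"
        unfolding mU
      proof (rule SUP_least)
        fix B assume "B \<in> {B\<in>sets borel. B \<subseteq> (\<Union>n. A n)}"
        then have B: "B \<in> sets borel" "(\<Union>n. B \<inter> A n) = B" by auto
        have r: "range (\<lambda>n. B \<inter> A n) \<subseteq> sets borel" "disjoint_family (\<lambda>n. B \<inter> A n)"
          using A B(1) by (auto simp: disjoint_family_on_def)
        have s: "(\<lambda>n. \<nu> (B \<inter> A n)) sums \<nu> B"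
          using ca[OF r] unfolding B(2) .
        have le: "ennreal (\<nu> (B \<inter> A n)) \<le> m (A n)" for n
          unfolding m_def using A B(1) by (intro SUP_upper) auto
        have "ennreal (\<Sum>n<N. \<nu> (B \<inter> A n)) \<le> (\<Sum>n. m (A n))" for N
        proof -
          have "ennreal (\<Sum>n<N. \<nu> (B \<inter> A n)) \<le> ennreal (\<Sum>n<N. max 0 (\<nu> (B \<inter> A n)))"
            by (intro ennreal_leI sum_mono) simp
          also have "\<dots> = (\<Sum>n<N. ennreal (\<nu> (B \<inter> A n)))"
            by (subst sum_ennreal[symmetric]) (simp_all add: ennreal_max_0)
          also have "\<dots> \<le> (\<Sum>n<N. m (A n))"
            by (intro sum_mono le)
          also have "\<dots> \<le> (\<Sum>n. m (A n))"
            by (intro sum_le_suminf summableI) auto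
          finally show ?thesis .
        qed
        moreover have "(\<lambda>N. ennreal (\<Sum>n<N. \<nu> (B \<inter> A n))) \<longlonglongrightarrow> ennreal (\<nu> B)"
          using s unfolding sums_def by (rule tendsto_ennrealI)
        ultimately show "ennreal (\<nu> B) \<le> (\<Sum>n. m (A n))"
          by (intro LIMSEQ_le_const2) auto
      qed
    qed
  qed
  have "emeasure (measure_of UNIV (sets (borel :: 'a measure)) m) A = m A"
  proof (rule emeasure_measure_of_sigma)
    show "sigma_algebra UNIV (sets (borel :: 'a measure))"
      using sets.sigma_algebra_axioms[of "borel :: 'a measure"] by simp
  qed (use caM A m0 in \<open>auto simp: positive_def\<close>)
  then show ?thesis
    by (simp add: upper_variation_def m_def)
qed

definition cm_integral :: "('a::topological_space set \<Rightarrow> complex) \<Rightarrow> ('a \<Rightarrow> complex) \<Rightarrow> complex" where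
  "cm_integral \<mu> h =
     (integral\<^sup>L (upper_variation (\<lambda>A. Re (\<mu> A))) h - integral\<^sup>L (upper_variation (\<lambda>A. - Re (\<mu> A))) h) +
     \<i> * (integral\<^sup>L (upper_variation (\<lambda>A. Im (\<mu> A))) h - integral\<^sup>L (upper_variation (\<lambda>A. - Im (\<mu> A))) h)"


section \<open>Cauchy transform and Cauchy capacity\<close>

definition cauchy_transform :: "(complex set \<Rightarrow> complex) \<Rightarrow> complex option \<Rightarrow> complex" where
  "cauchy_transform \<mu> p =
     (case p of None \<Rightarrow> 0 | Some z \<Rightarrow> cm_integral \<mu> (\<lambda>\<xi>. 1 / (\<xi> - z)))"

definition cauchy_capacity :: "complex set \<Rightarrow> real" where
  "cauchy_capacity E =
     Sup {cmod (\<mu> E) | \<mu>.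
            complex_borel_measure \<mu> \<and> supported_on \<mu> E \<and>
            (\<forall>p\<in>sphere_compl E. cmod (cauchy_transform \<mu> p) \<le> 1)}"

end

theory Submission
  imports Defs "HOL-Complex_Analysis.Complex_Analysis"
begin

text \<open>
  The set is the wave, the graph of \<open>x ^ 7 * sin (pi / x ^ 8)\<close> over \<open>{-1..1}\<close>: an arc symmetric about 0
  that has infinite length near 0. Its Ahlfors function is \<open>F z = k (1 / z)\<close>, where \<open>k\<close> is the normalized
  Riemann map of the inverted complement, and \<open>F\<close> is odd.

  Comparing \<open>k\<close> with fourth roots of Moebius functions gives \<open>1 - |F| = O(d powr (1/4))\<close>, \<open>d\<close> being the
  distance to the wave, and then, by the Schwarz-Pick lemma, \<open>|F'| = O(d powr (-3/4))\<close>. It follows that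
  near 0 the function \<open>F\<close> is close to a unimodular constant \<open>c\<close> in the valleys of the wave and, being
  odd, close to \<open>- c\<close> under its peaks. Suppose that \<open>F\<close> is the Cauchy transform of a measure. Integrate
  \<open>F\<close> around a rectangle that encloses one tooth of the wave of height \<open>Y\<close>, against a quartic
  polynomial with double zeros where the wave crosses the rectangle: the measure has mass at least a
  constant times \<open>Y\<close> in the rectangle. The sum of the heights diverges.

  The Cauchy capacity never exceeds the analytic capacity, as the derivative of the Cauchy transform
  of \<open>\<mu>\<close> at infinity is minus the total charge. Conversely, let \<open>s ^ 4 = z / (z - 1)\<close>. The function
  \<open>F * (s / (s + \<delta>)) ^ 8\<close> is bounded by 1 and decays at 0 so fast that its jump across the wave is
  integrable with respect to arc length; hence it is the Cauchy transform of its jump, and the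
  total charge tends to the analytic capacity as \<open>\<delta>\<close> tends to 0.
\<close>

section \<open>Complex Borel measures\<close>

text \<open>The exponents 7, 8 and 1/4 are tied together. Near \<open>x\<close> the wave has height
  about \<open>|x|^7\<close> and, the phase being \<open>pi / x^8\<close>, width about
  \<open>|x|^9\<close>. Going down a valley changes \<open>F\<close> by at most a multiple of
  \<open>|x|^7 * (|x|^9)^(-3/4) = |x|^(1/4)\<close>, which tends to 0; the m-th tooth sits near
  \<open>(2m)^(-1/8)\<close>, so its height is of order \<open>m^(-7/8)\<close>, which is not
  summable; the arc length element is \<open>O(t^(-2))\<close> in the parameter \<open>t\<close>,
  which an eighth power of a fourth root, of order \<open>t^2\<close>, offsets. Fourth roots suffice
  because a graph cannot spiral: the argument of \<open>(z - p) / (z - p')\<close> stays within 2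
  pi, so a quarter of it stays within pi / 2. The rectangle around a tooth has \<open>F\<close> near
  \<open>- c\<close> on its left side, under a peak, and near \<open>c\<close> on its right side, in
  a valley; the two sides are traversed in opposite directions, so their contributions add up. The
  obstacle is the top and the bottom, where the wave crosses: the Cauchy integral need not converge
  there. The double zeros of the quartic make the kernel bounded, so that Fubini applies to an
  arbitrary measure.\<close>

definition real_charge :: "('a::topological_space set \<Rightarrow> real) \<Rightarrow> bool" where
  "real_charge \<nu> \<longleftrightarrow>
     (\<forall>A :: nat \<Rightarrow> 'a set. range A \<subseteq> sets borel \<longrightarrow> disjoint_family A \<longrightarrow>
        (\<lambda>n. \<nu> (A n)) sums \<nu> (\<Union>n. A n))"

lemma real_chargeD:
  "real_charge \<nu> \<Longrightarrow> range A \<subseteq> sets borel \<Longrightarrow> disjoint_family A \<Longrightarrow>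
     (\<lambda>n. \<nu> (A n)) sums \<nu> (\<Union>n. A n)"
  unfolding real_charge_def by blast

lemma real_charge_uminus: "real_charge \<nu> \<Longrightarrow> real_charge (\<lambda>A. - \<nu> A)"
  unfolding real_charge_def by (metis sums_minus)

lemma real_charge_empty:
  assumes "real_charge \<nu>" shows "\<nu> {} = 0"
proof -
  have "(\<lambda>n::nat. \<nu> {}) sums \<nu> (\<Union>n::nat. {})"
    by (rule real_chargeD[OF assms]) (auto simp: disjoint_family_on_def)
  then show ?thesis
    using sums_summable summable_const_iff by blast
qed

lemma real_charge_Un:
  assumes \<nu>: "real_charge \<nu>" and "B \<in> sets borel" "C \<in> sets borel" "B \<inter> C = {}"
  shows "\<nu> (B \<union> C) = \<nu> B + \<nu> C"
proof -
  have r: "range (binaryset B C) \<subseteq> sets borel" "disjoint_family (binaryset B C)"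
    using assms by (auto simp: binaryset_def disjoint_family_on_def)
  have "(\<lambda>n. \<nu> (binaryset B C n)) sums \<nu> (\<Union>n. binaryset B C n)"
    by (rule real_chargeD[OF \<nu> r])
  moreover have "(\<lambda>n. \<nu> (binaryset B C n)) sums (\<nu> B + \<nu> C)"
    by (rule binaryset_sums[of \<nu>, OF real_charge_empty[OF \<nu>]])
  ultimately show ?thesis
    unfolding UN_binaryset_eq by (rule sums_unique2)
qed

lemma real_charge_Diff:
  assumes \<nu>: "real_charge \<nu>" and "A \<in> sets borel" "B \<in> sets borel" "B \<subseteq> A"
  shows "\<nu> (A - B) = \<nu> A - \<nu> B"
  using real_charge_Un[OF \<nu>, of B "A - B"] assms by (simp add: Un_absorb1)

text \<open>If \<open>\<nu>\<close> were unbounded on the subsets of \<open>A\<close>, one could keep splitting off pieces of charge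
  larger than 1, whose disjoint union contradicts countable additivity.\<close>

lemma real_charge_bounded:
  fixes \<nu> :: "'a::topological_space set \<Rightarrow> real"
  assumes \<nu>: "real_charge \<nu>"
  obtains K where "\<And>B. B \<in> sets borel \<Longrightarrow> \<bar>\<nu> B\<bar> \<le> K"
proof -
  define bad where "bad = (\<lambda>A :: 'a set. A \<in> sets borel \<and> (\<forall>K. \<exists>B\<in>sets borel. B \<subseteq> A \<and> \<bar>\<nu> B\<bar> > K))"
  have step: "\<exists>A'. bad A' \<and> A' \<subseteq> A \<and> \<bar>\<nu> (A - A')\<bar> > 1" if A: "bad A" for A
  proof -
    obtain B where B: "B \<in> sets borel" "B \<subseteq> A" "\<bar>\<nu> B\<bar> > \<bar>\<nu> A\<bar> + 1"
      using A unfolding bad_def by meson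
    have Ab: "A \<in> sets borel" using A by (simp add: bad_def)
    have d: "\<nu> (A - B) = \<nu> A - \<nu> B"
      using real_charge_Diff[OF \<nu> Ab B(1,2)] .
    show ?thesis
    proof (cases "bad B")
      case True
      then show ?thesis using B d by (intro exI[of _ B]) auto
    next
      case False
      then obtain K1 where K1: "\<And>C. C \<in> sets borel \<Longrightarrow> C \<subseteq> B \<Longrightarrow> \<bar>\<nu> C\<bar> \<le> K1"
        using B unfolding bad_def by (meson not_le)
      have "bad (A - B)"
        unfolding bad_def
      proof (intro conjI allI)
        show "A - B \<in> sets borel" using Ab B by auto
        fix K
        obtain C where C: "C \<in> sets borel" "C \<subseteq> A" "\<bar>\<nu> C\<bar> > K + K1"
          using A unfolding bad_def by meson
        have "\<nu> ((C \<inter> B) \<union> (C - B)) = \<nu> (C \<inter> B) + \<nu> (C - B)"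
          by (rule real_charge_Un[OF \<nu>]) (use B C in auto)
        moreover have "(C \<inter> B) \<union> (C - B) = C" by auto
        moreover have "\<bar>\<nu> (C \<inter> B)\<bar> \<le> K1" using K1[of "C \<inter> B"] B C by auto
        ultimately have "\<bar>\<nu> (C - B)\<bar> > K" using C by auto
        then show "\<exists>D\<in>sets borel. D \<subseteq> A - B \<and> \<bar>\<nu> D\<bar> > K"
          using B C by (intro bexI[of _ "C - B"]) auto
      qed
      moreover have "A - (A - B) = B" using B by auto
      ultimately show ?thesis using B by (intro exI[of _ "A - B"]) auto
    qed
  qed
  have "\<not> bad UNIV"
  proof
    assume "bad UNIV"
    then obtain A where A: "\<And>n. bad (A n)" and A': "\<And>n. A (Suc n) \<subseteq> A n \<and> \<bar>\<nu> (A n - A (Suc n))\<bar> > 1"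
      using dependent_nat_choice[of "\<lambda>_. bad" "\<lambda>_ A A'. A' \<subseteq> A \<and> \<bar>\<nu> (A - A')\<bar> > 1"] step
      by metis
    define D where "D n = A n - A (Suc n)" for n
    have dec: "A n \<subseteq> A m" if "m \<le> n" for m n
      using that A' by (metis lift_Suc_antimono_le)
    have D1: "D m \<inter> D n = {}" if "m < n" for m n
      using dec[of "Suc m" n] that unfolding D_def by auto
    have "disjoint_family D"
      unfolding disjoint_family_on_def using D1 by (metis inf_commute linorder_neqE_nat)
    moreover have "range D \<subseteq> sets borel"
      using A unfolding D_def bad_def by auto
    ultimately have "(\<lambda>n. \<nu> (D n)) sums \<nu> (\<Union>n. D n)"
      by (intro real_chargeD[OF \<nu>])
    then have "(\<lambda>n. \<nu> (D n)) \<longlonglongrightarrow> 0"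
      using sums_summable summable_LIMSEQ_zero by blast
    then obtain n where "\<bar>\<nu> (D n)\<bar> < 1"
      using LIMSEQ_D[of "\<lambda>n. \<nu> (D n)" 0 1] by auto
    then show False using A'[of n] unfolding D_def by simp
  qed
  then have "\<exists>K. \<forall>B\<in>sets borel. \<bar>\<nu> B\<bar> \<le> K"
    unfolding bad_def by (simp add: not_less)
  then show thesis using that by metis
qed

section \<open>Upper variations and the Jordan decomposition\<close>

lemma sets_upper_variation [simp]: "sets (upper_variation \<nu>) = sets borel"
  unfolding upper_variation_def using sets.sigma_sets_eq[of borel]
  by (simp add: sets_measure_of_conv)

lemma space_upper_variation [simp]: "space (upper_variation \<nu>) = UNIV"
  unfolding upper_variation_def by (simp add: space_measure_of_conv)

lemma emeasure_upper_variation_charge: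
  "real_charge \<nu> \<Longrightarrow> A \<in> sets borel \<Longrightarrow>
     emeasure (upper_variation \<nu>) A = (SUP B\<in>{B\<in>sets borel. B \<subseteq> A}. ennreal (\<nu> B))"
  by (rule emeasure_upper_variation) (auto simp: real_charge_def)

lemma finite_measure_upper_variation:
  assumes "real_charge \<nu>" shows "finite_measure (upper_variation \<nu>)"
proof
  obtain K where K: "\<And>B. B \<in> sets borel \<Longrightarrow> \<bar>\<nu> B\<bar> \<le> K"
    using real_charge_bounded[OF assms] by metis
  have "emeasure (upper_variation \<nu>) UNIV \<le> ennreal K"
    unfolding emeasure_upper_variation_charge[OF assms borel_open[OF open_UNIV]]
    by (rule SUP_least) (use K in \<open>force intro: ennreal_leI\<close>)
  then show "emeasure (upper_variation \<nu>) (space (upper_variation \<nu>)) \<noteq> \<infinity>"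
    by (auto simp: top_unique)
qed

lemma measure_upper_variation_ge:
  assumes "real_charge \<nu>" "A \<in> sets borel" "B \<in> sets borel" "B \<subseteq> A"
  shows "\<nu> B \<le> measure (upper_variation \<nu>) A"
proof -
  interpret finite_measure "upper_variation \<nu>" by (rule finite_measure_upper_variation) fact
  have "ennreal (\<nu> B) \<le> emeasure (upper_variation \<nu>) A"
    unfolding emeasure_upper_variation_charge[OF assms(1,2)]
    using assms by (intro SUP_upper) auto
  then show ?thesis
    by (simp add: emeasure_eq_measure ennreal_le_iff)
qed

lemma measure_upper_variation_le:
  assumes "real_charge \<nu>" "A \<in> sets borel" "\<And>B. B \<in> sets borel \<Longrightarrow> B \<subseteq> A \<Longrightarrow> \<nu> B \<le> c" "0 \<le> c"
  shows "measure (upper_variation \<nu>) A \<le> c"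
proof -
  interpret finite_measure "upper_variation \<nu>" by (rule finite_measure_upper_variation) fact
  have "emeasure (upper_variation \<nu>) A \<le> ennreal c"
    unfolding emeasure_upper_variation_charge[OF assms(1,2)]
    using assms by (intro SUP_least) (auto intro: ennreal_leI)
  then show ?thesis
    using assms(4) by (simp add: emeasure_eq_measure ennreal_le_iff)
qed

text \<open>For \<open>B\<close> inside \<open>A\<close> one has
  \<open>\<kappa> B = \<kappa> A - \<kappa> (A - B)\<close>, and \<open>- \<kappa> (A - B)\<close>
  is at most the upper variation of \<open>- \<kappa>\<close> on \<open>A\<close>. The supremum over
  \<open>B\<close> gives one inequality, and the same argument for \<open>- \<nu>\<close> the
  other.\<close>

lemma charge_eq_upper_variations:
  assumes \<nu>: "real_charge \<nu>" and A: "A \<in> sets borel"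
  shows "\<nu> A = measure (upper_variation \<nu>) A - measure (upper_variation (\<lambda>A. - \<nu> A)) A"
proof -
  have half: "measure (upper_variation \<kappa>) A \<le> \<kappa> A + measure (upper_variation (\<lambda>A. - \<kappa> A)) A"
    if \<kappa>: "real_charge \<kappa>" for \<kappa>
  proof (rule measure_upper_variation_le[OF \<kappa> A])
    note ge = measure_upper_variation_ge[OF real_charge_uminus[OF \<kappa>] A]
    show "0 \<le> \<kappa> A + measure (upper_variation (\<lambda>A. - \<kappa> A)) A"
      using ge[of A] A by simp
    fix B assume B: "B \<in> sets borel" "B \<subseteq> A"
    then show "\<kappa> B \<le> \<kappa> A + measure (upper_variation (\<lambda>A. - \<kappa> A)) A"
      using ge[of "A - B"] A real_charge_Diff[OF \<kappa> A B] by auto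
  qed
  show ?thesis
    using half[OF \<nu>] half[OF real_charge_uminus[OF \<nu>]] by simp
qed

lemma AE_upper_variation_supported:
  assumes \<nu>: "real_charge \<nu>" and E: "E \<in> sets borel"
    and s: "\<And>A. A \<in> sets borel \<Longrightarrow> A \<inter> E = {} \<Longrightarrow> \<nu> A = 0"
  shows "AE x in upper_variation \<nu>. x \<in> E"
proof -
  interpret finite_measure "upper_variation \<nu>" by (rule finite_measure_upper_variation) fact
  have "measure (upper_variation \<nu>) (-E) \<le> 0"
    by (rule measure_upper_variation_le[OF \<nu>]) (use E s in \<open>auto simp: disjoint_eq_subset_Compl\<close>)
  then have "emeasure (upper_variation \<nu>) (-E) = 0"
    by (simp add: emeasure_eq_measure measure_le_0_iff)
  then show ?thesis
    by (intro AE_I[where N="-E"]) (use E in auto)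
qed

text \<open>\<open>cm_integral\<close> is defined through Jordan decompositions, whereas the
  measures constructed below arise as other differences of positive measures; this makes the choice
  immaterial. Rewritten as \<open>A + D = B + C\<close>, the assumption involves only sums of
  positive measures, so it extends to nonnegative functions by the standard induction and to bounded
  complex functions by splitting.\<close>

lemma integral_measure_diff_cong:
  fixes h :: "'a::topological_space \<Rightarrow> complex"
  assumes fin: "finite_measure A" "finite_measure B" "finite_measure C" "finite_measure D"
    and s: "sets A = sets borel" "sets B = sets borel" "sets C = sets borel" "sets D = sets borel"
    and eq: "\<And>X. X \<in> sets borel \<Longrightarrow> measure A X - measure B X = measure C X - measure D X"
    and h: "h \<in> borel_measurable borel" and K: "\<And>x. cmod (h x) \<le> K"
  shows "integral\<^sup>L A h - integral\<^sup>L B h = integral\<^sup>L C h - integral\<^sup>L D h"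
proof -
  note [measurable_cong] = s
  interpret A: finite_measure A by fact
  interpret B: finite_measure B by fact
  interpret C: finite_measure C by fact
  interpret D: finite_measure D by fact
  have nn: "nn_integral A g + nn_integral D g = nn_integral B g + nn_integral C g"
    if "g \<in> borel_measurable borel" for g :: "'a \<Rightarrow> ennreal"
    using that
  proof (induction rule: borel_measurable_induct)
    case (cong f g)
    then show ?case
      using sets_eq_imp_space_eq[OF s(1)] sets_eq_imp_space_eq[OF s(2)]
        sets_eq_imp_space_eq[OF s(3)] sets_eq_imp_space_eq[OF s(4)]
      by (simp cong: nn_integral_cong)
  next
    case (set X)
    have "emeasure A X + emeasure D X = emeasure B X + emeasure C X"
      using eq[OF set] by (simp add: A.emeasure_eq_measure B.emeasure_eq_measure
        C.emeasure_eq_measure D.emeasure_eq_measure flip: ennreal_plus)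
    then show ?case using set s by simp
  next
    case (mult u c)
    note [measurable] = mult(2)
    from mult show ?case
      by (simp add: nn_integral_cmult flip: distrib_left)
  next
    case (add u v)
    note [measurable] = add(1,3)
    have "nn_integral A (\<lambda>x. v x + u x) + nn_integral D (\<lambda>x. v x + u x)
        = (nn_integral A v + nn_integral D v) + (nn_integral A u + nn_integral D u)"
      by (simp add: nn_integral_add ac_simps)
    also have "\<dots> = nn_integral B (\<lambda>x. v x + u x) + nn_integral C (\<lambda>x. v x + u x)"
      unfolding add by (simp add: nn_integral_add ac_simps)
    finally show ?case .
  next
    case (seq U)
    note [measurable] = seq(1)
    have M: "nn_integral M (\<lambda>x. SUP i. U i x) = (SUP i. nn_integral M (U i))"
      if "sets M = sets borel" for M
    proof (rule nn_integral_monotone_convergence_SUP)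
      show "incseq U" by fact
      show "U i \<in> borel_measurable M" for i using that seq(1) by (simp cong: measurable_cong_sets)
    qed
    have inc: "incseq (\<lambda>i. nn_integral M (U i))" for M
      using seq(3) by (auto simp: incseq_def le_fun_def intro!: nn_integral_mono)
    have "(SUP i. U i) = (\<lambda>x. SUP i. U i x)" by (auto simp: fun_eq_iff image_comp)
    then show ?case
      using seq by (simp add: M s ennreal_SUP_add[OF inc inc, symmetric])
  qed
  have I: "integrable M g" if "finite_measure M" "sets M = sets borel"
    "g \<in> borel_measurable borel" "\<And>x. \<bar>g x\<bar> \<le> K" for g :: "'a \<Rightarrow> real" and M
    by (rule finite_measure.integrable_const_bound[OF that(1), of _ K])
       (use that in \<open>auto cong: measurable_cong_sets\<close>)
  have pos: "integral\<^sup>L A g - integral\<^sup>L B g = integral\<^sup>L C g - integral\<^sup>L D g"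
    if g: "g \<in> borel_measurable borel" "\<And>x. 0 \<le> g x" "\<And>x. \<bar>g x\<bar> \<le> K" for g :: "'a \<Rightarrow> real"
  proof -
    have c: "nn_integral M (\<lambda>x. ennreal (g x)) = ennreal (integral\<^sup>L M g)"
      if "finite_measure M" "sets M = sets borel" for M
      using I[OF that g(1,3)] g(2) by (intro nn_integral_eq_integral) auto
    have "nn_integral A (\<lambda>x. ennreal (g x)) + nn_integral D (\<lambda>x. ennreal (g x)) =
      nn_integral B (\<lambda>x. ennreal (g x)) + nn_integral C (\<lambda>x. ennreal (g x))"
      using g by (intro nn) simp
    then show ?thesis
      using g(2) by (simp add: c fin s flip: ennreal_plus)
  qed
  have re: "integral\<^sup>L A g - integral\<^sup>L B g = integral\<^sup>L C g - integral\<^sup>L D g"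
    if g: "g \<in> borel_measurable borel" "\<And>x. \<bar>g x\<bar> \<le> K" for g :: "'a \<Rightarrow> real"
  proof -
    have sp: "integral\<^sup>L M g = integral\<^sup>L M (\<lambda>x. max 0 (g x)) - integral\<^sup>L M (\<lambda>x. max 0 (- g x))"
      if "finite_measure M" "sets M = sets borel" for M
    proof -
      have "integral\<^sup>L M g = integral\<^sup>L M (\<lambda>x. max 0 (g x) - max 0 (- g x))"
        by (rule Bochner_Integration.integral_cong) auto
      also have "\<dots> = integral\<^sup>L M (\<lambda>x. max 0 (g x)) - integral\<^sup>L M (\<lambda>x. max 0 (- g x))"
      proof (rule Bochner_Integration.integral_diff)
        have "\<bar>max 0 (g x)\<bar> \<le> K" "\<bar>max 0 (- g x)\<bar> \<le> K" for x using g(2)[of x] by auto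
        then show "integrable M (\<lambda>x. max 0 (g x))" "integrable M (\<lambda>x. max 0 (- g x))"
          using g(1) by (auto intro!: I[OF that])
      qed
      finally show ?thesis .
    qed
    have "\<bar>max 0 (g x)\<bar> \<le> K" "\<bar>max 0 (- g x)\<bar> \<le> K" for x using g(2)[of x] by auto
    then show ?thesis
      using pos[of "\<lambda>x. max 0 (g x)"] pos[of "\<lambda>x. max 0 (- g x)"] g(1)
      by (simp add: sp fin s)
  qed
  have b: "\<bar>Re (h x)\<bar> \<le> K" "\<bar>Im (h x)\<bar> \<le> K" for x
    using K[of x] abs_Re_le_cmod[of "h x"] abs_Im_le_cmod[of "h x"] by auto
  have cI: "integrable M h" if "finite_measure M" "sets M = sets borel" for M
    by (rule finite_measure.integrable_const_bound[OF that(1), of _ K])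
       (use that h K in \<open>auto cong: measurable_cong_sets\<close>)
  show ?thesis
    using re[of "\<lambda>x. Re (h x)"] re[of "\<lambda>x. Im (h x)"] h b
    by (simp add: complex_eq_iff integral_Re integral_Im cI fin s)
qed

section \<open>Complex measures as combinations of four positive measures\<close>

lemma complex_borel_measure_Re_mult:
  assumes "complex_borel_measure \<mu>"
  shows "real_charge (\<lambda>A. Re (c * \<mu> A))"
  unfolding real_charge_def
proof (intro allI impI)
  fix A :: "nat \<Rightarrow> 'a set" assume "range A \<subseteq> sets borel" "disjoint_family A"
  then have "(\<lambda>n. \<mu> (A n)) sums \<mu> (\<Union>n. A n)"
    using assms unfolding complex_borel_measure_def by blast
  then show "(\<lambda>n. Re (c * \<mu> (A n))) sums Re (c * \<mu> (\<Union>n. A n))"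
    by (intro sums_Re sums_mult)
qed

text \<open>Indexing by powers of \<open>\<i>\<close> allows a uniform treatment of the four Jordan
  parts: the charge is the sum of \<open>\<i> ^ j\<close> times the j-th part, and
  \<open>cnj (\<i> ^ j)\<close> rotates the j-th half-axis to the positive one.\<close>

definition part_measure :: "('a::topological_space set \<Rightarrow> complex) \<Rightarrow> nat \<Rightarrow> 'a measure" where
  "part_measure \<mu> j = upper_variation (\<lambda>A. Re (cnj (\<i> ^ j) * \<mu> A))"

lemma sets_part_measure [simp]: "sets (part_measure \<mu> j) = sets borel"
  by (simp add: part_measure_def)

lemma finite_part_measure:
  "complex_borel_measure \<mu> \<Longrightarrow> finite_measure (part_measure \<mu> j)"
  unfolding part_measure_def
  by (intro finite_measure_upper_variation complex_borel_measure_Re_mult)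

lemma AE_part_measure:
  assumes "complex_borel_measure \<mu>" "supported_on \<mu> E" "E \<in> sets borel"
  shows "AE x in part_measure \<mu> j. x \<in> E"
  unfolding part_measure_def
  by (intro AE_upper_variation_supported complex_borel_measure_Re_mult assms)
     (use assms in \<open>auto simp: supported_on_def\<close>)

lemma part_measure_simps:
  "part_measure \<mu> 0 = upper_variation (\<lambda>A. Re (\<mu> A))"
  "part_measure \<mu> 1 = upper_variation (\<lambda>A. Im (\<mu> A))"
  "part_measure \<mu> 2 = upper_variation (\<lambda>A. - Re (\<mu> A))"
  "part_measure \<mu> 3 = upper_variation (\<lambda>A. - Im (\<mu> A))"
  unfolding part_measure_def by (auto simp: power3_eq_cube)

lemma sum_lessThan_4: "(\<Sum>j<4. F j) = F 0 + F 1 + F 2 + F 3" for F :: "nat \<Rightarrow> 'a::comm_monoid_add"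
  by (simp add: eval_nat_numeral)

lemma cm_integral_eq_part_measures:
  "cm_integral \<mu> h = (\<Sum>j<4. \<i> ^ j * integral\<^sup>L (part_measure \<mu> j) h)"
  unfolding cm_integral_def sum_lessThan_4 part_measure_simps
  by (simp add: power3_eq_cube algebra_simps)

lemma charge_eq_part_measures:
  assumes \<mu>: "complex_borel_measure \<mu>" and A: "A \<in> sets borel"
  shows "\<mu> A = (\<Sum>j<4. \<i> ^ j * measure (part_measure \<mu> j) A)"
proof -
  have re: "Re (\<mu> A) = measure (part_measure \<mu> 0) A - measure (part_measure \<mu> 2) A"
    unfolding part_measure_simps
    using charge_eq_upper_variations[OF complex_borel_measure_Re_mult[OF \<mu>, of 1] A] by (simp only: mult_1)
  have im: "Im (\<mu> A) = measure (part_measure \<mu> 1) A - measure (part_measure \<mu> 3) A"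
    unfolding part_measure_simps
    using charge_eq_upper_variations[OF complex_borel_measure_Re_mult[OF \<mu>, of "-\<i>"] A] by simp
  show ?thesis
    unfolding sum_lessThan_4 complex_eq_iff using re im by (simp add: power3_eq_cube)
qed

lemma cm_integral_cong:
  assumes "complex_borel_measure \<mu>" "supported_on \<mu> E" "E \<in> sets borel"
    and "h \<in> borel_measurable borel" "h' \<in> borel_measurable borel"
    and eq: "\<And>x. x \<in> E \<Longrightarrow> h x = h' x"
  shows "cm_integral \<mu> h = cm_integral \<mu> h'"
proof -
  have "integral\<^sup>L (part_measure \<mu> j) h = integral\<^sup>L (part_measure \<mu> j) h'" for j
    using AE_part_measure[OF assms(1-3), of j] assms
    by (intro integral_cong_AE) (auto cong: measurable_cong_sets)
  then show ?thesis by (simp add: cm_integral_eq_part_measures)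
qed

section \<open>Measures with a density along a curve\<close>

lemma
  fixes g :: "real \<Rightarrow> real" and \<gamma> :: "real \<Rightarrow> 'a::topological_space" and h :: "'a \<Rightarrow> complex"
  assumes g: "integrable lborel g" "\<And>t. 0 \<le> g t" and \<gamma>: "\<gamma> \<in> borel_measurable borel"
  defines "N \<equiv> distr (density lborel (\<lambda>t. ennreal (g t))) borel \<gamma>"
  shows finite_measure_distr_density: "finite_measure N"
    and integral_distr_density: "h \<in> borel_measurable borel \<Longrightarrow>
           integral\<^sup>L N h = (\<integral>t. g t *\<^sub>R h (\<gamma> t) \<partial>lborel)"
    and measure_distr_density: "A \<in> sets borel \<Longrightarrow>
           measure N A = (\<integral>t. g t * indicator A (\<gamma> t) \<partial>lborel)"
proof -
  note [measurable] = \<gamma> borel_measurable_integrable[OF g(1)]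
  have "emeasure (density lborel (\<lambda>t. ennreal (g t))) UNIV = (\<integral>\<^sup>+t. ennreal (g t) \<partial>lborel)"
    by (simp add: emeasure_density)
  also have "\<dots> = ennreal (integral\<^sup>L lborel g)"
    using g by (intro nn_integral_eq_integral) auto
  finally have "finite_measure (density lborel (\<lambda>t. ennreal (g t)))"
    by (intro finite_measureI) auto
  then show "finite_measure N"
    unfolding N_def by (intro finite_measure.finite_measure_distr) auto
  then interpret N: finite_measure N .
  show I: "integral\<^sup>L N h = (\<integral>t. g t *\<^sub>R h (\<gamma> t) \<partial>lborel)"
    if [measurable]: "h \<in> borel_measurable borel" for h :: "'a \<Rightarrow> complex"
    unfolding N_def using g by (subst integral_distr; simp?) (subst integral_density; simp)
  show "measure N A = (\<integral>t. g t * indicator A (\<gamma> t) \<partial>lborel)" if A [measurable]: "A \<in> sets borel"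
  proof -
    have "measure N A = (\<integral>x. indicator A x \<partial>N)"
      using A by (simp add: N_def)
    also have "\<dots> = (\<integral>t. g t * indicator A (\<gamma> t) \<partial>lborel)"
      unfolding N_def using g by (subst integral_distr; simp?) (subst integral_density; simp)
    finally show ?thesis .
  qed
qed

lemma real_charge_measure_diff:
  assumes "finite_measure A" "finite_measure B" "sets A = sets borel" "sets B = sets borel"
  shows "real_charge (\<lambda>X. measure A X - measure B X)"
  unfolding real_charge_def
  using assms by (auto intro!: sums_diff finite_measure.finite_measure_UNION)

text \<open>The images under \<open>\<gamma>\<close> of the positive and the negative part of a
  density need not be mutually singular, since \<open>\<gamma>\<close> may identify parameters.
  Their difference is just some decomposition of the charge, which
  \<open>integral_measure_diff_cong\<close> compares with the Jordan decomposition.\<close>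

lemma curve_measure:
  fixes D :: "real \<Rightarrow> complex" and \<gamma> :: "real \<Rightarrow> 'a::topological_space"
  assumes D: "integrable lborel D" and \<gamma>: "\<gamma> \<in> borel_measurable borel"
  defines "\<mu> \<equiv> \<lambda>A. \<integral>t. D t * indicator A (\<gamma> t) \<partial>lborel"
  shows complex_borel_measure_curve: "complex_borel_measure \<mu>"
    and cm_integral_curve: "h \<in> borel_measurable borel \<Longrightarrow> (\<And>x. cmod (h x) \<le> K) \<Longrightarrow>
          cm_integral \<mu> h = (\<integral>t. D t * h (\<gamma> t) \<partial>lborel)"
proof -
  note [measurable] = \<gamma> borel_measurable_integrable[OF D]
  define N where "N u = distr (density lborel (\<lambda>t. ennreal (max 0 (u t)))) borel \<gamma>" for u :: "real \<Rightarrow> real"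
  have int_max: "integrable lborel (\<lambda>t. max 0 (u t))" if "integrable lborel u" for u :: "real \<Rightarrow> real"
    using that by auto
  have fin: "finite_measure (N u)" if "integrable lborel u" for u
    unfolding N_def by (rule finite_measure_distr_density[OF int_max[OF that]]) (auto simp: \<gamma>)
  have setsN [simp]: "sets (N u) = sets borel" for u by (simp add: N_def)
  have Im: "integrable lborel (\<lambda>t. u t * indicator A (\<gamma> t))"
    if "integrable lborel u" "A \<in> sets borel" for u :: "real \<Rightarrow> real" and A
  proof -
    note [measurable] = borel_measurable_integrable[OF that(1)] that(2)
    show ?thesis
      by (rule Bochner_Integration.integrable_bound[OF that(1)]) (auto simp: indicator_def)
  qed
  have mN: "measure (N u) A - measure (N (\<lambda>t. - u t)) A = (\<integral>t. u t * indicator A (\<gamma> t) \<partial>lborel)"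
    if u: "integrable lborel u" and A: "A \<in> sets borel" for u A
  proof -
    have iu: "integrable lborel (\<lambda>t. - u t)" using u by simp
    have "measure (N u) A - measure (N (\<lambda>t. - u t)) A =
       (\<integral>t. max 0 (u t) * indicator A (\<gamma> t) \<partial>lborel) - (\<integral>t. max 0 (- u t) * indicator A (\<gamma> t) \<partial>lborel)"
      unfolding N_def using measure_distr_density[OF int_max[OF u] _ \<gamma> A]
        measure_distr_density[OF int_max[OF iu] _ \<gamma> A] by simp
    also have "\<dots> = (\<integral>t. max 0 (u t) * indicator A (\<gamma> t) - max 0 (- u t) * indicator A (\<gamma> t) \<partial>lborel)"
      using int_max[OF u] int_max[OF iu] A
      by (intro Bochner_Integration.integral_diff[symmetric] Im)
    also have "\<dots> = (\<integral>t. u t * indicator A (\<gamma> t) \<partial>lborel)"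
      by (intro Bochner_Integration.integral_cong) (auto simp: max_def)
    finally show ?thesis .
  qed
  have ic: "integrable lborel (\<lambda>t. D t * h (\<gamma> t))"
    if [measurable]: "h \<in> borel_measurable borel" and K: "\<And>x. cmod (h x) \<le> K" for h :: "'a \<Rightarrow> complex" and K
  proof (rule Bochner_Integration.integrable_bound)
    show "integrable lborel (\<lambda>t. K *\<^sub>R D t)" using D by simp
    have "0 \<le> K" using K norm_ge_zero order_trans by blast
    then show "AE t in lborel. norm (D t * h (\<gamma> t)) \<le> norm (K *\<^sub>R D t)"
      using K by (auto simp: norm_mult mult.commute[of K] intro!: mult_left_mono)
  qed measurable
  have pt: "Re (c * \<mu> A) = measure (N (\<lambda>t. Re (c * D t))) A - measure (N (\<lambda>t. - Re (c * D t))) A"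
    if A: "A \<in> sets borel" for A c
  proof -
    have i: "integrable lborel (\<lambda>t. D t * indicator A (\<gamma> t))"
      using A by (intro ic[of _ 1]) (auto simp: indicator_def)
    have "Re (c * \<mu> A) = (\<integral>t. Re (c * (D t * indicator A (\<gamma> t))) \<partial>lborel)"
      unfolding \<mu>_def by (subst integral_Re) (use i in auto)
    also have "\<dots> = (\<integral>t. Re (c * D t) * indicator A (\<gamma> t) \<partial>lborel)"
      by (intro Bochner_Integration.integral_cong) (auto simp: indicator_def)
    finally show ?thesis
      using mN[of "\<lambda>t. Re (c * D t)", OF _ A] D by simp
  qed
  have iR: "integrable lborel (\<lambda>t. Re (c * D t))" for c
    using D by (intro integrable_Re) simp
  have rch: "real_charge (\<lambda>A. Re (c * \<mu> A))" for c
  proof -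
    have "real_charge (\<lambda>A. measure (N (\<lambda>t. Re (c * D t))) A - measure (N (\<lambda>t. - Re (c * D t))) A)"
      by (intro real_charge_measure_diff fin iR Bochner_Integration.integrable_minus setsN)
    note r = real_chargeD[OF this]
    show ?thesis
      unfolding real_charge_def
    proof (intro allI impI)
      fix A :: "nat \<Rightarrow> 'a set" assume A: "range A \<subseteq> sets borel" "disjoint_family A"
      have An: "A n \<in> sets borel" "(\<Union>n. A n) \<in> sets borel" for n using A by auto
      show "(\<lambda>n. Re (c * \<mu> (A n))) sums Re (c * \<mu> (\<Union>n. A n))"
        using r[OF A] by (simp only: pt An)
    qed
  qed
  show cbm: "complex_borel_measure \<mu>"
    unfolding complex_borel_measure_def
  proof (intro allI impI)
    fix A :: "nat \<Rightarrow> 'a set" assume A: "range A \<subseteq> sets borel" "disjoint_family A"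
    show "(\<lambda>n. \<mu> (A n)) sums \<mu> (\<Union>n. A n)"
      using real_chargeD[OF rch[of 1] A] real_chargeD[OF rch[of "-\<i>"] A]
      by (simp add: sums_complex_iff)
  qed
  show "cm_integral \<mu> h = (\<integral>t. D t * h (\<gamma> t) \<partial>lborel)"
    if h[measurable]: "h \<in> borel_measurable borel" and K: "\<And>x. cmod (h x) \<le> K"
  proof -
    have part: "integral\<^sup>L (upper_variation (\<lambda>A. Re (c * \<mu> A))) h - integral\<^sup>L (upper_variation (\<lambda>A. - Re (c * \<mu> A))) h
        = (\<integral>t. Re (c * D t) *\<^sub>R h (\<gamma> t) \<partial>lborel)" for c
    proof -
      define u where "u t = Re (c * D t)" for t
      have u: "integrable lborel u" unfolding u_def by (rule iR)
      then have iu: "integrable lborel (\<lambda>t. - u t)" by (rule Bochner_Integration.integrable_minus)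
      have bd: "integrable lborel (\<lambda>t. v t *\<^sub>R h (\<gamma> t))" if v: "integrable lborel v" for v :: "real \<Rightarrow> real"
      proof (rule Bochner_Integration.integrable_bound)
        show "integrable lborel (\<lambda>t. K *\<^sub>R v t)" using v by simp
        have "0 \<le> K" using K norm_ge_zero order_trans by blast
        then show "AE t in lborel. norm (v t *\<^sub>R h (\<gamma> t)) \<le> norm (K *\<^sub>R v t)"
          using K by (auto simp: abs_mult mult.commute[of K] intro!: mult_left_mono)
        show "(\<lambda>t. v t *\<^sub>R h (\<gamma> t)) \<in> borel_measurable lborel"
          using borel_measurable_integrable[OF v] by measurable
      qed
      have "integral\<^sup>L (upper_variation (\<lambda>A. Re (c * \<mu> A))) h - integral\<^sup>L (upper_variation (\<lambda>A. - Re (c * \<mu> A))) h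
         = integral\<^sup>L (N u) h - integral\<^sup>L (N (\<lambda>t. - u t)) h"
      proof (rule integral_measure_diff_cong[OF _ _ fin[OF u] fin[OF iu] _ _ _ _ _ h K])
        fix X :: "'a set" assume X: "X \<in> sets borel"
        show "measure (upper_variation (\<lambda>A. Re (c * \<mu> A))) X - measure (upper_variation (\<lambda>A. - Re (c * \<mu> A))) X =
         measure (N u) X - measure (N (\<lambda>t. - u t)) X"
          using charge_eq_upper_variations[OF rch X, of c] pt[OF X, of c] unfolding u_def by linarith
      qed (rule finite_measure_upper_variation real_charge_uminus rch sets_upper_variation setsN)+
      also have "\<dots> = (\<integral>t. max 0 (u t) *\<^sub>R h (\<gamma> t) \<partial>lborel) - (\<integral>t. max 0 (- u t) *\<^sub>R h (\<gamma> t) \<partial>lborel)"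
        unfolding N_def using integral_distr_density[OF int_max[OF u] _ \<gamma> h]
          integral_distr_density[OF int_max[OF iu] _ \<gamma> h] by simp
      also have "\<dots> = (\<integral>t. max 0 (u t) *\<^sub>R h (\<gamma> t) - max 0 (- u t) *\<^sub>R h (\<gamma> t) \<partial>lborel)"
        using int_max[OF u] int_max[OF iu] by (intro Bochner_Integration.integral_diff[symmetric] bd)
      also have "\<dots> = (\<integral>t. u t *\<^sub>R h (\<gamma> t) \<partial>lborel)"
        by (intro Bochner_Integration.integral_cong) (auto simp: max_def)
      finally show ?thesis by (simp add: u_def)
    qed
    have bd: "integrable lborel (\<lambda>t. Re (c * D t) *\<^sub>R h (\<gamma> t))" for c
    proof (rule Bochner_Integration.integrable_bound)
      show "integrable lborel (\<lambda>t. c * (D t * h (\<gamma> t)))"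
        using ic[OF h K] by (intro integrable_mult_right)
      show "AE t in lborel. norm (Re (c * D t) *\<^sub>R h (\<gamma> t)) \<le> norm (c * (D t * h (\<gamma> t)))"
      proof (intro AE_I2)
        fix t
        have "\<bar>Re (c * D t)\<bar> * cmod (h (\<gamma> t)) \<le> cmod (c * D t) * cmod (h (\<gamma> t))"
          by (intro mult_right_mono abs_Re_le_cmod norm_ge_zero)
        then show "norm (Re (c * D t) *\<^sub>R h (\<gamma> t)) \<le> norm (c * (D t * h (\<gamma> t)))"
          by (simp only: norm_scaleR norm_mult real_norm_def mult.assoc)
      qed
    qed measurable
    have "(\<integral>t. D t * h (\<gamma> t) \<partial>lborel) = (\<integral>t. Re (1 * D t) *\<^sub>R h (\<gamma> t) + \<i> * (Re (-\<i> * D t) *\<^sub>R h (\<gamma> t)) \<partial>lborel)"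
      by (intro Bochner_Integration.integral_cong) (auto simp: complex_eq_iff algebra_simps)
    also have "\<dots> = (\<integral>t. Re (1 * D t) *\<^sub>R h (\<gamma> t) \<partial>lborel) + \<i> * (\<integral>t. Re (-\<i> * D t) *\<^sub>R h (\<gamma> t) \<partial>lborel)"
      by (subst Bochner_Integration.integral_add[OF bd[of 1] integrable_mult_right[OF bd]])
         (simp only: integral_mult_right_zero)
    also have "\<dots> = cm_integral \<mu> h"
      unfolding cm_integral_def part[symmetric] by simp
    finally show ?thesis ..
  qed
qed

section \<open>The wave and its complement\<close>

definition wig :: "real \<Rightarrow> real" where "wig x = x ^ 7 * sin (pi / x ^ 8)"
definition dwig :: "real \<Rightarrow> real" where
  "dwig x = 7 * x ^ 6 * sin (pi / x ^ 8) - 8 * pi * cos (pi / x ^ 8) / x\<^sup>2"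
definition gam :: "real \<Rightarrow> complex" where "gam t = Complex t (wig t)"
definition wave :: "complex set" where "wave = gam ` {-1..1}"
text \<open>Beyond the ends of the arc, where \<open>|Re z| > 1\<close>, there is no condition:
  \<open>upper\<close> and \<open>lower\<close> overlap there and together cover the complement of
  the wave.\<close>

definition upper :: "complex set" where "upper = {z. \<bar>Re z\<bar> \<le> 1 \<longrightarrow> wig (Re z) < Im z}"
definition lower :: "complex set" where "lower = {z. \<bar>Re z\<bar> \<le> 1 \<longrightarrow> Im z < wig (Re z)}"
text \<open>The complement of the wave in the coordinate \<open>1 / z\<close>. As
  \<open>1 / 0 = 0\<close> lies in the wave, the point 0, which stands for infinity, needs a clause
  of its own.\<close>

definition inv_dom :: "complex set" where "inv_dom = {u. u = 0 \<or> 1 / u \<notin> wave}"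

lemma wig_minus [simp]: "wig (- x) = - wig x"
  by (simp add: wig_def)

lemma wig_0 [simp]: "wig 0 = 0" and wig_1 [simp]: "wig 1 = 0"
  by (auto simp: wig_def)

lemma abs_wig_le: "\<bar>wig x\<bar> \<le> \<bar>x\<bar> ^ 7"
proof -
  have "\<bar>x ^ 7\<bar> * \<bar>sin (pi / x ^ 8)\<bar> \<le> \<bar>x ^ 7\<bar> * 1"
    by (intro mult_left_mono) auto
  then show ?thesis by (simp add: wig_def abs_mult power_abs)
qed

lemma DERIV_wig: "x \<noteq> 0 \<Longrightarrow> (wig has_real_derivative dwig x) (at x)"
  unfolding wig_def[abs_def] dwig_def
  by (auto intro!: derivative_eq_intros simp: field_simps power_eq_if)

lemma isCont_wig: "isCont wig x"
proof (cases "x = 0")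
  case True
  have "(wig \<longlongrightarrow> 0) (at 0)"
  proof (rule Lim_null_comparison)
    show "\<forall>\<^sub>F x in at 0. norm (wig x) \<le> \<bar>x\<bar> ^ 7"
      by (intro always_eventually) (auto simp: abs_wig_le)
    show "((\<lambda>x::real. \<bar>x\<bar> ^ 7) \<longlongrightarrow> 0) (at 0)"
      by (rule tendsto_eq_intros refl | simp)+
  qed
  then show ?thesis by (simp add: True isCont_def)
next
  case False
  then show ?thesis using DERIV_wig DERIV_isCont by blast
qed

lemma continuous_on_wig [continuous_intros]:
  "continuous_on S f \<Longrightarrow> continuous_on S (\<lambda>x. wig (f x))"
  using continuous_on_compose2[of UNIV wig S f] isCont_wig
  by (auto simp: continuous_on_eq_continuous_at)

lemma Re_gam [simp]: "Re (gam t) = t" and Im_gam [simp]: "Im (gam t) = wig t"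
  by (simp_all add: gam_def)

lemma gam_minus: "gam (- t) = - gam t"
  by (simp add: gam_def complex_eq_iff)

lemma gam_0 [simp]: "gam 0 = 0" and gam_1 [simp]: "gam 1 = 1"
  by (simp_all add: gam_def complex_eq_iff)

lemma continuous_on_gam: "continuous_on S gam"
  unfolding gam_def[abs_def] by (intro continuous_intros)

lemma gam_measurable [measurable]: "gam \<in> borel_measurable borel"
  by (intro borel_measurable_continuous_onI continuous_on_gam)

lemma mem_wave: "z \<in> wave \<longleftrightarrow> \<bar>Re z\<bar> \<le> 1 \<and> Im z = wig (Re z)"
  unfolding wave_def by (auto simp: complex_eq_iff image_iff abs_le_iff intro!: bexI[of _ "Re z"])

lemma uminus_mem_wave: "- z \<in> wave \<longleftrightarrow> z \<in> wave"
  by (simp add: mem_wave)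

lemma uminus_mem_upper: "- z \<in> upper \<longleftrightarrow> z \<in> lower"
  by (auto simp: upper_def lower_def)

lemma lower_eq: "lower = uminus ` upper"
  using uminus_mem_upper by (force simp: image_iff)

lemma upper_Un_lower: "upper \<union> lower = - wave"
  by (auto simp: upper_def lower_def mem_wave)

lemma compact_wave: "compact wave"
  unfolding wave_def by (intro compact_continuous_image continuous_on_gam compact_Icc)

lemma closed_wave: "closed wave"
  using compact_wave by (rule compact_imp_closed)

lemma connected_wave: "connected wave"
  unfolding wave_def by (intro connected_continuous_image continuous_on_gam connected_Icc)

lemma zero_in_wave: "0 \<in> wave" and one_in_wave: "1 \<in> wave" and minus_one_in_wave: "-1 \<in> wave"
  using mem_wave by auto

lemma cmod_wave_le:
  assumes "z \<in> wave" shows "cmod z \<le> 2"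
proof -
  have "\<bar>wig (Re z)\<bar> \<le> 1"
    using abs_wig_le[of "Re z"] power_le_one[of "\<bar>Re z\<bar>" 7] assms by (simp add: mem_wave)
  then show ?thesis
    using cmod_le[of z] assms by (simp add: mem_wave)
qed

lemma open_upper: "open upper"
proof -
  have eq: "- upper = {z. \<bar>Re z\<bar> \<le> 1 \<and> Im z \<le> wig (Re z)}"
    by (auto simp: upper_def)
  have "closed (- upper)"
    unfolding eq by (intro closed_Collect_conj closed_Collect_le continuous_intros)
  then show ?thesis by (simp add: closed_def)
qed

lemma upper_add_up: "z \<in> upper \<Longrightarrow> 0 \<le> s \<Longrightarrow> z + \<i> * of_real s \<in> upper"
  by (auto simp: upper_def)

lemma halfplane_subset_upper: "{z. Im z > 1} \<subseteq> upper"
proof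
  fix z assume z: "z \<in> {z. Im z > 1}"
  have "wig (Re z) \<le> 1" if "\<bar>Re z\<bar> \<le> 1"
    using abs_wig_le[of "Re z"] power_le_one[of "\<bar>Re z\<bar>" 7] that by linarith
  then show "z \<in> upper" using z by (force simp: upper_def)
qed

text \<open>The vertical ray upwards from a point of \<open>upper\<close> stays in
  \<open>upper\<close> and ends in the half-plane \<open>Im z > 1\<close>, which all these rays
  share.\<close>

lemma connected_upper: "connected upper"
proof -
  have "\<exists>T. connected T \<and> T \<subseteq> upper \<and> z \<in> T \<and> {z. Im z > 1} \<subseteq> T" if z: "z \<in> upper" for z
  proof -
    define R where "R = (\<lambda>s. z + \<i> * of_real s) ` {0..}"
    have "connected R"
      unfolding R_def by (intro connected_continuous_image continuous_intros) auto
    moreover have "connected {z. Im z > 1}"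
      by (intro convex_connected convex_halfspace_Im_gt)
    moreover have "z + \<i> * of_real (\<bar>Im z\<bar> + 2) \<in> R \<inter> {z. Im z > 1}"
      unfolding R_def by (intro IntI image_eqI[of _ _ "\<bar>Im z\<bar> + 2"]) auto
    ultimately have "connected (R \<union> {z. Im z > 1})"
      by (intro connected_Un) auto
    moreover have "R \<subseteq> upper"
      using z by (auto simp: R_def intro!: upper_add_up)
    moreover have "z \<in> R" unfolding R_def by (rule image_eqI[of _ _ 0]) auto
    ultimately show ?thesis using halfplane_subset_upper by blast
  qed
  then obtain T where T: "\<And>z. z \<in> upper \<Longrightarrow> connected (T z) \<and> T z \<subseteq> upper \<and> z \<in> T z \<and> {z. Im z > 1} \<subseteq> T z"
    by metis
  have "connected (\<Union>z\<in>upper. T z)"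
  proof (rule connected_Union)
    have "Complex 0 2 \<in> \<Inter> (T ` upper)" using T by force
    then show "\<Inter> (T ` upper) \<noteq> {}" by blast
  qed (use T in auto)
  moreover have "(\<Union>z\<in>upper. T z) = upper" using T by blast
  ultimately show ?thesis by simp
qed

lemma components_unbounded:
  assumes "\<And>z. z \<in> S \<Longrightarrow> \<exists>T. connected T \<and> T \<subseteq> S \<and> z \<in> T \<and> \<not> bounded T"
    and C: "C \<in> components S"
  shows "\<not> bounded (C :: complex set)"
proof -
  obtain z where z: "z \<in> C" using in_components_nonempty[OF C] by blast
  then have "z \<in> S" using in_components_subset[OF C] by blast
  then obtain T where T: "connected T" "T \<subseteq> S" "z \<in> T" "\<not> bounded T" using assms(1) by meson
  then have "T \<subseteq> C" using components_maximal[OF C] z by blast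
  then show ?thesis using T bounded_subset by blast
qed

lemma unbounded_down_ray: "\<not> bounded ((\<lambda>s. z - \<i> * of_real s) ` {0::real..})"
proof
  assume "bounded ((\<lambda>s. z - \<i> * of_real s) ` {0::real..})"
  then obtain B where B: "\<And>s. s \<ge> 0 \<Longrightarrow> cmod (z - \<i> * of_real s) \<le> B"
    unfolding bounded_iff by auto
  have "0 \<le> cmod (z - \<i> * of_real 0)" by simp
  also have "\<dots> \<le> B" by (rule B) simp
  finally have B0: "B \<ge> 0" .
  have "cmod (\<i> * of_real (B + cmod z + 1)) - cmod z \<le> cmod (z - \<i> * of_real (B + cmod z + 1))"
    by (metis norm_minus_commute norm_triangle_ineq2)
  also have "\<dots> \<le> B" using B0 by (intro B) auto
  also have "cmod (\<i> * of_real (B + cmod z + 1)) = B + cmod z + 1"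
    using B0 by (simp only: norm_mult norm_of_real) simp
  finally show False by simp
qed

text \<open>The complement contains with each point the whole vertical ray downwards, so none of its
  components is bounded.\<close>

lemma simply_connected_upper: "simply_connected upper"
  unfolding simply_connected_eq_unbounded_complement_components[OF open_upper]
proof (intro conjI ballI connected_upper components_unbounded[of "- upper"])
  fix z assume z: "z \<in> - upper"
  show "\<exists>T. connected T \<and> T \<subseteq> - upper \<and> z \<in> T \<and> \<not> bounded T"
  proof (intro exI conjI)
    let ?T = "(\<lambda>s. z - \<i> * of_real s) ` {0::real..}"
    show "connected ?T" by (intro connected_continuous_image continuous_intros) auto
    show "?T \<subseteq> - upper" using z by (auto simp: upper_def)
    show "z \<in> ?T" by (rule image_eqI[of _ _ 0]) auto
    show "\<not> bounded ?T" by (rule unbounded_down_ray)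
  qed
qed

lemma connected_lower: "connected lower"
  unfolding lower_eq by (intro connected_continuous_image connected_upper continuous_intros)

lemma connected_compl_wave: "connected (- wave)"
proof -
  have "2 \<in> upper \<inter> lower" by (simp add: upper_def lower_def)
  then show ?thesis
    unfolding upper_Un_lower[symmetric] using connected_upper connected_lower by (intro connected_Un) auto
qed

section \<open>The complement in the coordinate at infinity\<close>

lemma compl_inv_dom: "- inv_dom = {u. 1/2 \<le> cmod u} \<inter> (\<lambda>u. 1 / u) -` wave"
proof -
  have *: "1/2 \<le> cmod u" if "u \<noteq> 0" "1 / u \<in> wave" for u
  proof -
    have "1 / cmod u \<le> 2" using cmod_wave_le[OF that(2)] by (simp only: norm_divide norm_one)
    moreover have "cmod u > 0" using that by simp
    ultimately show ?thesis by (simp add: divide_le_eq)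
  qed
  show ?thesis
  proof (intro set_eqI iffI)
    fix u assume "u \<in> - inv_dom"
    then have "u \<noteq> 0" "1 / u \<in> wave" by (simp_all add: inv_dom_def)
    then show "u \<in> {u. 1/2 \<le> cmod u} \<inter> (\<lambda>u. 1 / u) -` wave" using * by simp
  next
    fix u assume "u \<in> {u. 1/2 \<le> cmod u} \<inter> (\<lambda>u. 1 / u) -` wave"
    then show "u \<in> - inv_dom" by (auto simp only: inv_dom_def norm_zero)
  qed
qed

text \<open>The map \<open>1 / u\<close> is continuous only away from 0; as the wave is bounded by
  2, its preimage can be taken inside the closed set \<open>1/2 \<le> cmod u\<close>.\<close>

lemma open_inv_dom: "open inv_dom"
proof -
  have "closed ({u. 1/2 \<le> cmod u} \<inter> (\<lambda>u. 1 / u) -` wave)"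
    by (intro continuous_closed_preimage continuous_intros closed_Collect_le closed_wave) auto
  then show ?thesis unfolding compl_inv_dom[symmetric] by (simp add: closed_def)
qed

lemma zero_in_inv_dom: "0 \<in> inv_dom"
  by (simp add: inv_dom_def)

lemma inv_dom_iff: "u \<noteq> 0 \<Longrightarrow> u \<in> inv_dom \<longleftrightarrow> 1 / u \<notin> wave"
  by (simp add: inv_dom_def)

lemma inverse_in_inv_dom: "z \<notin> wave \<Longrightarrow> 1 / z \<in> inv_dom"
  using zero_in_wave by (auto simp: inv_dom_def)

lemma connected_inv_dom: "connected inv_dom"
proof -
  have eq: "inv_dom - {0} = (\<lambda>z. 1 / z) ` (- wave)"
  proof (intro subset_antisym image_subsetI subsetI)
    fix u assume u: "u \<in> inv_dom - {0}"
    then have "1 / u \<in> - wave" by (auto simp: inv_dom_def)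
    moreover have "u = 1 / (1 / u)" using u by simp
    ultimately show "u \<in> (\<lambda>z. 1 / z) ` (- wave)" by (rule rev_image_eqI)
  next
    fix z assume "z \<in> - wave"
    then show "1 / z \<in> inv_dom - {0}"
      using zero_in_wave inverse_in_inv_dom[of z] by auto
  qed
  have c: "connected (inv_dom - {0})"
    unfolding eq
  proof (rule connected_continuous_image[OF _ connected_compl_wave])
    show "continuous_on (- wave) (\<lambda>z. 1 / z)"
      by (intro continuous_on_divide continuous_on_const continuous_on_id) (use zero_in_wave in auto)
  qed
  have "0 \<in> interior inv_dom"
    using open_inv_dom zero_in_inv_dom by (simp add: interior_open)
  then have "0 islimpt inv_dom" by (rule interior_limit_point)
  then have "0 \<in> closure (inv_dom - {0})"
    by (simp only: islimpt_in_closure)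
  then show ?thesis
    by (intro connected_intermediate_closure[OF c]) (auto intro: closure_subset[THEN subsetD])
qed

text \<open>The wave passes through 0, so a point \<open>1 / gam t\<close> of the complement is
  joined to infinity by \<open>1 / gam (s * t)\<close> as \<open>s\<close> decreases to 0, and every
  component of the complement is unbounded.\<close>

lemma simply_connected_inv_dom: "simply_connected inv_dom"
  unfolding simply_connected_eq_unbounded_complement_components[OF open_inv_dom]
proof (intro conjI ballI connected_inv_dom components_unbounded[of "- inv_dom"])
  fix u assume u: "u \<in> - inv_dom"
  then have u0: "u \<noteq> 0" and "1 / u \<in> wave" by (auto simp: inv_dom_def)
  then obtain t where t: "1 / u = gam t" "t \<in> {-1..1}" unfolding wave_def by blast
  have t0: "t \<noteq> 0" using t(1) u0 by auto
  define T where "T = (\<lambda>s. 1 / gam (s * t)) ` {0<..1}"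
  have ne: "gam (s * t) \<noteq> 0" if "s > 0" for s
    using that t0 by (simp add: complex_eq_iff)
  show "\<exists>T. connected T \<and> T \<subseteq> - inv_dom \<and> u \<in> T \<and> \<not> bounded T"
  proof (intro exI conjI)
    show "connected T"
      unfolding T_def using ne
      by (intro connected_continuous_image continuous_intros continuous_on_compose2[OF continuous_on_gam[of UNIV]]) auto
    show "T \<subseteq> - inv_dom"
    proof
      fix v assume "v \<in> T"
      then obtain s where s: "s \<in> {0<..1}" "v = 1 / gam (s * t)" by (auto simp: T_def)
      have "\<bar>s * t\<bar> \<le> 1" using s t by (auto simp: abs_mult intro!: mult_le_one)
      then have "gam (s * t) \<in> wave" by (simp add: mem_wave)
      then show "v \<in> - inv_dom" using s ne[of s] by (simp add: inv_dom_def)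
    qed
    show "u \<in> T" unfolding T_def
      by (rule image_eqI[of _ _ 1]) (simp_all flip: t(1))
    show "\<not> bounded T"
    proof
      assume "bounded T"
      then obtain B where B': "\<forall>x\<in>T. cmod x \<le> B" by (auto simp: bounded_iff)
      have B: "cmod (1 / gam (s * t)) \<le> B" if "s \<in> {0<..1}" for s
        using B' that unfolding T_def by blast
      have "0 < cmod (1 / gam (1 * t))" using ne[of 1] by simp
      also have "\<dots> \<le> B" by (rule B) simp
      finally have B0: "B > 0" .
      have "((\<lambda>s. gam (s * t)) \<longlongrightarrow> gam (0 * t)) (at_right 0)"
        by (intro isCont_tendsto_compose[of _ gam] tendsto_intros)
          (use continuous_on_gam[of UNIV] in \<open>auto simp: continuous_on_eq_continuous_at\<close>)
      then have "\<forall>\<^sub>F s in at_right 0. dist (gam (s * t)) (gam (0 * t)) < 1 / (2 * B)"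
        by (rule tendstoD) (use B0 in simp)
      then have "\<forall>\<^sub>F s in at_right 0. cmod (gam (s * t)) < 1 / (2 * B)" by simp
      moreover have "\<forall>\<^sub>F s in at_right 0. s \<in> {0<..(1::real)}"
        by (intro eventually_at_rightI[of 0 1]) auto
      ultimately have "\<forall>\<^sub>F s::real in at_right 0. False"
      proof eventually_elim
        case (elim s)
        have "cmod (gam (s * t)) > 0" using ne[of s] elim by simp
        moreover have "1 \<le> B * cmod (gam (s * t))"
          using B[OF elim(2)] ne[of s] elim(2) by (auto simp: norm_divide field_simps)
        moreover have "B * cmod (gam (s * t)) < B * (1 / (2 * B))"
          using elim B0 by (intro mult_strict_left_mono) auto
        ultimately show False using B0 by simp
      qed
      then show False by simp
    qed
  qed
qed

section \<open>Riemann maps and logarithms\<close>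

lemma holomorphic_on_comp:
  "f holomorphic_on T \<Longrightarrow> g holomorphic_on S \<Longrightarrow> (\<And>z. z \<in> S \<Longrightarrow> g z \<in> T) \<Longrightarrow>
     (\<lambda>z. f (g z)) holomorphic_on S"
  by (rule holomorphic_on_compose_gen[unfolded o_def]) auto

text \<open>Rescaling to the unit disc and composing with the Moebius map that sends
  \<open>f z\<close> to 0 multiplies the derivative by \<open>r / (1 - |f z|^2)\<close>; the Schwarz
  lemma bounds the result by 1.\<close>

lemma Schwarz_Pick_deriv:
  assumes f: "f holomorphic_on ball z r" and r: "0 < r"
    and lt: "\<And>w. w \<in> ball z r \<Longrightarrow> cmod (f w) < 1"
  shows "cmod (deriv f z) \<le> (1 - (cmod (f z))\<^sup>2) / r"
proof -
  define a where "a = f z"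
  have a: "cmod a < 1" using lt[of z] r by (simp add: a_def)
  define g where "g w = Moebius_function 0 a (f (z + of_real r * w))" for w
  have mem: "z + of_real r * w \<in> ball z r" if "w \<in> ball 0 1" for w
    using that r by (simp add: dist_norm norm_mult)
  have hol1: "f \<circ> (\<lambda>w. z + of_real r * w) holomorphic_on ball 0 1"
  proof (rule holomorphic_on_compose_gen[OF _ f])
    show "(\<lambda>w. z + of_real r * w) ` ball 0 1 \<subseteq> ball z r" by (rule image_subsetI) (rule mem)
  qed (intro holomorphic_intros)
  have img: "(f \<circ> (\<lambda>w. z + of_real r * w)) ` ball 0 1 \<subseteq> ball 0 1"
  proof (rule image_subsetI)
    fix w :: complex assume "w \<in> ball 0 1"
    then show "(f \<circ> (\<lambda>w. z + of_real r * w)) w \<in> ball 0 1"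
      using lt[OF mem] by simp
  qed
  have holg: "g holomorphic_on ball 0 1"
    using holomorphic_on_compose_gen[OF hol1 Moebius_function_holomorphic[OF a, of 0] img]
    by (simp only: o_def g_def[abs_def])
  have g0: "g 0 = 0" by (simp add: g_def a_def Moebius_function_eq_zero)
  have glt: "cmod (g w) < 1" if "cmod w < 1" for w
    unfolding g_def using that lt mem by (intro Moebius_function_norm_lt_1 a) auto
  have dg: "cmod (deriv g 0) \<le> 1"
    using Schwarz_Lemma(2)[OF holg g0 glt, of 0] by simp
  have df: "(f has_field_derivative deriv f z) (at z)"
    using holomorphic_derivI[OF f open_ball, of z] r by simp
  have nr: "1 - cnj a * a = of_real (1 - (cmod a)\<^sup>2)"
    by (simp add: mult.commute[of "cnj a"] flip: complex_norm_square)
  have p: "0 < 1 - (cmod a)\<^sup>2"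
    using a by (simp add: power_less_one_iff)
  have na: "1 - cnj a * a \<noteq> 0"
    unfolding nr using p by (simp only: of_real_eq_0_iff)
  have dM: "(Moebius_function 0 a has_field_derivative 1 / (1 - cnj a * a)) (at a)"
    unfolding Moebius_function_simple[abs_def]
    by (rule derivative_eq_intros refl na | simp add: na)+
  have "((\<lambda>w. f (z + of_real r * w)) has_field_derivative deriv f z * of_real r) (at 0)"
    by (rule DERIV_chain2[of f _ "\<lambda>w. z + of_real r * w"])
       (use df in \<open>auto intro!: derivative_eq_intros\<close>)
  then have "(g has_field_derivative 1 / (1 - cnj a * a) * (deriv f z * of_real r)) (at 0)"
    unfolding g_def[abs_def]
    by (rule DERIV_chain2[of "Moebius_function 0 a" _ "\<lambda>w. f (z + of_real r * w)", rotated])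
       (use dM in \<open>simp add: a_def\<close>)
  then have "deriv g 0 = 1 / (1 - cnj a * a) * (deriv f z * of_real r)"
    by (rule DERIV_imp_deriv)
  then have "deriv g 0 = 1 / of_real (1 - (cmod a)\<^sup>2) * (deriv f z * of_real r)"
    by (simp only: nr)
  then have "cmod (deriv g 0) = cmod (deriv f z) * r / (1 - (cmod a)\<^sup>2)"
    using r p by (simp only: norm_mult norm_divide norm_of_real norm_one) simp
  then show ?thesis
    using dg p r by (simp add: field_simps a_def)
qed

lemma holomorphic_norm_le_1_cases:
  assumes "f holomorphic_on S" "open S" "connected S" and le: "\<And>z. z \<in> S \<Longrightarrow> cmod (f z) \<le> 1"
  shows "(\<forall>z\<in>S. cmod (f z) < 1) \<or> f constant_on S"
proof (rule disjCI)
  assume "\<not> f constant_on S"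
  show "\<forall>z\<in>S. cmod (f z) < 1"
  proof (rule ccontr)
    assume "\<not> (\<forall>z\<in>S. cmod (f z) < 1)"
    then obtain w where w: "w \<in> S" "cmod (f w) = 1" using le by force
    have "f constant_on S"
      by (rule maximum_modulus_principle[OF assms(1-3) assms(2) subset_refl w(1)]) (use le w in auto)
    then show False using \<open>\<not> f constant_on S\<close> by simp
  qed
qed

text \<open>No value at 0 is prescribed, as bounded competitors for the analytic capacity need not
  vanish at infinity. A derivative equal to 1 forces \<open>B 0 = 0\<close> by Schwarz-Pick, and
  then the equality case of the Schwarz lemma applies.\<close>

lemma
  assumes B: "B holomorphic_on ball 0 1" and le: "\<And>z. z \<in> ball 0 1 \<Longrightarrow> cmod (B z) \<le> 1"
  shows disc_deriv_le_1: "cmod (deriv B 0) \<le> 1"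
    and disc_deriv_eq_1: "deriv B 0 = 1 \<Longrightarrow> z \<in> ball 0 1 \<Longrightarrow> B z = z"
proof -
  have c: "(\<forall>z\<in>ball 0 1. cmod (B z) < 1) \<or> B constant_on ball 0 1"
    by (rule holomorphic_norm_le_1_cases[OF B]) (use le in auto)
  have d0: "deriv B 0 = 0" if cB: "B constant_on ball 0 1"
  proof -
    obtain c where "\<And>z. z \<in> ball 0 1 \<Longrightarrow> B z = c" using cB unfolding constant_on_def by metis
    then have "deriv B 0 = deriv (\<lambda>_. c) 0"
      by (intro deriv_cong_ev eventually_nhds_in_open[THEN eventually_mono, of "ball 0 1"]) auto
    then show ?thesis by simp
  qed
  show "cmod (deriv B 0) \<le> 1"
    using c
  proof
    assume lt: "\<forall>z\<in>ball 0 1. cmod (B z) < 1"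
    have "cmod (deriv B 0) \<le> (1 - (cmod (B 0))\<^sup>2) / 1"
      by (rule Schwarz_Pick_deriv[OF B]) (use lt in auto)
    also have "\<dots> \<le> 1" by simp
    finally show ?thesis .
  qed (simp add: d0)
  assume d1: "deriv B 0 = 1" and z: "z \<in> ball 0 1"
  then have lt: "\<forall>z\<in>ball 0 1. cmod (B z) < 1" using c d0 by auto
  have "cmod (deriv B 0) \<le> (1 - (cmod (B 0))\<^sup>2) / 1"
    by (rule Schwarz_Pick_deriv[OF B]) (use lt in auto)
  then have B0: "B 0 = 0" using d1 by simp
  obtain \<alpha> where \<alpha>: "\<And>z. cmod z < 1 \<Longrightarrow> B z = \<alpha> * z"
    using Schwarz_Lemma(3)[OF B B0, of 0] lt d1 by auto
  have "deriv B 0 = deriv (\<lambda>z. \<alpha> * z) 0"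
    using \<alpha> by (intro deriv_cong_ev eventually_nhds_in_open[THEN eventually_mono, of "ball 0 1"]) auto
  also have "\<dots> = \<alpha>" by (intro DERIV_imp_deriv) (auto intro!: derivative_eq_intros)
  finally show "B z = z" using \<alpha> z d1 by simp
qed

lemma normalized_Riemann_map:
  assumes S: "open S" "simply_connected S" "S \<noteq> UNIV" "0 \<in> S"
  obtains k h \<kappa> where "k holomorphic_on S" "h holomorphic_on ball 0 1"
    "\<And>z. z \<in> S \<Longrightarrow> k z \<in> ball 0 1 \<and> h (k z) = z"
    "\<And>z. z \<in> ball 0 1 \<Longrightarrow> h z \<in> S \<and> k (h z) = z"
    "k 0 = 0" "0 < \<kappa>" "deriv k 0 = of_real \<kappa>"
proof -
  have "\<exists>f g. f holomorphic_on S \<and> g holomorphic_on ball 0 1 \<and>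
       (\<forall>z\<in>S. f z \<in> ball 0 1 \<and> g (f z) = z) \<and> (\<forall>z\<in>ball 0 1. g z \<in> S \<and> f (g z) = z)"
    using iffD1[OF simply_connected_eq_biholomorphic_to_disc[OF S(1)] S(2)] S(3,4) by auto
  then obtain f g where f: "f holomorphic_on S" and g: "g holomorphic_on ball 0 1"
    and fg: "\<And>z. z \<in> S \<Longrightarrow> f z \<in> ball 0 1 \<and> g (f z) = z" "\<And>z. z \<in> ball 0 1 \<Longrightarrow> g z \<in> S \<and> f (g z) = z"
    by metis
  have b: "f 0 \<in> ball 0 1" using fg S by auto
  obtain m n where mn: "m (f 0) = 0" "m holomorphic_on ball 0 1" "m ` ball 0 1 \<subseteq> ball 0 1"
     "n holomorphic_on ball 0 1" "n ` ball 0 1 \<subseteq> ball 0 1"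
     "\<And>z. z \<in> ball 0 1 \<Longrightarrow> m (n z) = z" "\<And>z. z \<in> ball 0 1 \<Longrightarrow> n (m z) = z"
    using ball_biholomorphism_exists[OF b] by metis
  define k1 where "k1 z = m (f z)" for z
  define h1 where "h1 w = g (n w)" for w
  have k1: "k1 holomorphic_on S"
  proof -
    have "m \<circ> f holomorphic_on S"
      by (rule holomorphic_on_compose_gen[OF f mn(2)]) (use fg in blast)
    then show ?thesis by (simp add: o_def k1_def[abs_def])
  qed
  have h1: "h1 holomorphic_on ball 0 1"
  proof -
    have "g \<circ> n holomorphic_on ball 0 1"
      by (rule holomorphic_on_compose_gen[OF mn(4) g mn(5)])
    then show ?thesis by (simp add: o_def h1_def[abs_def])
  qed
  have kh1: "k1 z \<in> ball 0 1 \<and> h1 (k1 z) = z" if "z \<in> S" for z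
  proof -
    have "m (f z) \<in> ball 0 1" using fg(1)[OF that] mn(3) by blast
    then show ?thesis using fg(1)[OF that] mn(7) by (simp add: k1_def h1_def)
  qed
  have hk1: "h1 z \<in> S \<and> k1 (h1 z) = z" if "z \<in> ball 0 1" for z
  proof -
    have "n z \<in> ball 0 1" using that mn(5) by blast
    then show ?thesis using fg(2)[of "n z"] mn(6)[OF that] by (simp add: k1_def h1_def)
  qed
  have k10: "k1 0 = 0" by (simp add: k1_def mn(1))
  define c where "c = deriv k1 0"
  have dk: "(k1 has_field_derivative c) (at 0)"
    unfolding c_def by (rule holomorphic_derivI[OF k1 S(1) S(4)])
  have "(h1 has_field_derivative deriv h1 (k1 0)) (at (k1 0))"
    by (rule holomorphic_derivI[OF h1]) (auto simp: k10)
  then have "((\<lambda>z. h1 (k1 z)) has_field_derivative deriv h1 (k1 0) * c) (at 0)"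
    using dk by (rule DERIV_chain2)
  moreover have "((\<lambda>z. h1 (k1 z)) has_field_derivative 1) (at 0)"
    by (rule has_field_derivative_transform_within_open[OF DERIV_ident S(1) S(4)]) (use kh1 in auto)
  ultimately have "deriv h1 (k1 0) * c = 1" by (rule DERIV_unique)
  then have c0: "c \<noteq> 0" by auto
  \<comment> \<open>The rotation that turns the derivative \<open>c\<close> into the positive number
    \<open>cmod c\<close>.\<close>
  define e where "e = cnj c / of_real (cmod c)"
  have e1: "cmod e = 1" using c0 by (simp add: e_def norm_divide)
  then have ee: "cnj e * e = 1" by (simp add: complex_norm_square[symmetric] mult.commute)
  show thesis
  proof
    show "(\<lambda>z. e * k1 z) holomorphic_on S" by (intro holomorphic_intros k1)
    have m: "cnj e * w \<in> ball 0 1" if "w \<in> ball 0 1" for w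
      using that e1 by (simp add: norm_mult)
    show "(\<lambda>w. h1 (cnj e * w)) holomorphic_on ball 0 1"
    proof -
      have "h1 \<circ> (\<lambda>w. cnj e * w) holomorphic_on ball 0 1"
        by (rule holomorphic_on_compose_gen[OF _ h1]) (use m in \<open>auto intro!: holomorphic_intros\<close>)
      then show ?thesis by (simp only: o_def)
    qed
    show "e * k1 z \<in> ball 0 1 \<and> h1 (cnj e * (e * k1 z)) = z" if "z \<in> S" for z
      using kh1[OF that] e1 ee by (simp add: norm_mult flip: mult.assoc)
    show "h1 (cnj e * z) \<in> S \<and> e * k1 (h1 (cnj e * z)) = z" if "z \<in> ball 0 1" for z
      using hk1[OF m[OF that]] ee by (simp add: mult.commute[of e] flip: mult.assoc)
    show "e * k1 0 = 0" by (simp add: k10)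
    show "0 < cmod c" using c0 by simp
    have "((\<lambda>z. e * k1 z) has_field_derivative e * c) (at 0)"
      using DERIV_cmult[OF dk] .
    moreover have "e * c = of_real (cmod c)"
      using c0 by (simp add: e_def mult.commute[of "cnj c"] power2_eq_square flip: complex_norm_square)
    ultimately show "deriv (\<lambda>z. e * k1 z) 0 = of_real (cmod c)"
      by (simp add: DERIV_imp_deriv)
  qed
qed

lemma inv_dom_neq_UNIV: "inv_dom \<noteq> UNIV"
  using inv_dom_iff[of 1] one_in_wave by auto

lemma uminus_mem_inv_dom: "- u \<in> inv_dom \<longleftrightarrow> u \<in> inv_dom"
  using uminus_mem_wave[of "1 / u"] by (simp add: inv_dom_def)

section \<open>Logarithms of quotients of linear factors\<close>

lemma one_minus_mult_nonzero:
  assumes "p \<in> wave" "u \<in> inv_dom" shows "1 - p * u \<noteq> 0"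
proof
  assume *: "1 - p * u = 0"
  then have "u \<noteq> 0" by auto
  moreover have "1 / u = p" using * \<open>u \<noteq> 0\<close> by (simp add: field_simps)
  ultimately show False using assms by (simp add: inv_dom_iff)
qed

lemma not_nonpos_upper:
  assumes "z \<in> upper" "p \<in> wave" shows "- \<i> * (z - p) \<notin> \<real>\<^sub>\<le>\<^sub>0"
  using assms by (auto simp: complex_nonpos_Reals_iff upper_def mem_wave)

text \<open>With \<open>u = 1 / z\<close> the quotient \<open>(1 - p * u) / (1 - p' * u)\<close> is
  \<open>(z - p) / (z - p')\<close>. For \<open>z\<close> above the graph, \<open>z - p\<close>
  avoids the downward vertical ray, so the principal logarithm of \<open>- \<i> * (z - p)\<close> is
  continuous there. Two logarithms of one function on a connected set differ by a constant; letting
  \<open>z\<close> go to infinity along the imaginary axis, where the terms \<open>ln R\<close>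
  cancel, shows that it is 0.\<close>

lemma log_quotient_upper:
  assumes p: "p \<in> wave" "p' \<in> wave" and L: "L holomorphic_on inv_dom" "L 0 = 0"
    and exp: "\<And>u. u \<in> inv_dom \<Longrightarrow> exp (L u) = (1 - p * u) / (1 - p' * u)" and z: "z \<in> upper"
  shows "L (1 / z) = Ln (- \<i> * (z - p)) - Ln (- \<i> * (z - p'))"
proof -
  define N where "N z = L (1 / z) - (Ln (- \<i> * (z - p)) - Ln (- \<i> * (z - p')))" for z
  have up: "z \<noteq> 0" "1 / z \<in> inv_dom" "z \<noteq> p" "z \<noteq> p'" if "z \<in> upper" for z
    using that p zero_in_wave inverse_in_inv_dom[of z] upper_Un_lower by blast+
  have cN: "continuous_on upper N"
    unfolding N_def
  proof (intro continuous_intros)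
    show "continuous_on upper (\<lambda>z. L (1 / z))"
      by (rule continuous_on_compose2[OF holomorphic_on_imp_continuous_on[OF L(1)]])
         (use up in \<open>auto intro!: continuous_intros\<close>)
  qed (use not_nonpos_upper p in auto)
  have e1: "exp (N z) = 1" if "z \<in> upper" for z
  proof -
    note u = up[OF that]
    have "exp (N z) = (1 - p * (1 / z)) / (1 - p' * (1 / z)) / ((- \<i> * (z - p)) / (- \<i> * (z - p')))"
      unfolding N_def exp_diff exp[OF u(2)] using u by (simp add: exp_Ln)
    also have "\<dots> = 1" using u by (simp add: divide_simps)
    finally show ?thesis .
  qed
  have "N constant_on upper"
  proof (rule continuous_discrete_range_constant[OF connected_upper cN])
    fix x assume x: "x \<in> upper"
    show "\<exists>e>0. \<forall>y. y \<in> upper \<and> N y \<noteq> N x \<longrightarrow> e \<le> norm (N y - N x)"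
    proof (intro exI[of _ "2 * pi"] conjI allI impI)
      fix y assume y: "y \<in> upper \<and> N y \<noteq> N x"
      then have "exp (N y) = exp (N x)" using e1 x by simp
      then obtain n :: int where n: "N y = N x + (of_int (2 * n) * pi) * \<i>"
        unfolding exp_eq by blast
      then have "n \<noteq> 0" using y by auto
      then have "1 \<le> \<bar>of_int n :: real\<bar>" by linarith
      moreover have "norm (N y - N x) = 2 * pi * \<bar>of_int n\<bar>"
        by (simp add: n norm_mult)
      ultimately show "2 * pi \<le> norm (N y - N x)" by simp
    qed simp
  qed
  then obtain c where c: "\<And>z. z \<in> upper \<Longrightarrow> N z = c" unfolding constant_on_def by blast
  have "((\<lambda>R. N (\<i> * of_real R)) \<longlongrightarrow> 0) at_top"
  proof -
    have "((\<lambda>R::real. L (1 / (\<i> * of_real R)) - (Ln (1 + \<i> * p / of_real R) - Ln (1 + \<i> * p' / of_real R)))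
        \<longlongrightarrow> L 0 - (Ln (1 + 0) - Ln (1 + 0))) at_top"
    proof (intro tendsto_intros)
      have inv: "((\<lambda>R::real. c / of_real R) \<longlongrightarrow> 0) at_top" for c :: complex
      proof (rule tendsto_norm_zero_cancel)
        have "((\<lambda>R. cmod c / \<bar>R\<bar>) \<longlongrightarrow> 0) at_top"
          by (intro tendsto_divide_0[OF tendsto_const] filterlim_at_top_imp_at_infinity filterlim_abs_real)
        then show "((\<lambda>R::real. cmod (c / of_real R)) \<longlongrightarrow> 0) at_top"
          by (simp add: norm_divide)
      qed
      then show "((\<lambda>R::real. \<i> * p / of_real R) \<longlongrightarrow> 0) at_top" "((\<lambda>R::real. \<i> * p' / of_real R) \<longlongrightarrow> 0) at_top"
        by auto
      have "((\<lambda>R::real. 1 / (\<i> * of_real R)) \<longlongrightarrow> 0) at_top"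
        using inv[of "1 / \<i>"] by (simp only: divide_divide_eq_left)
      then show "((\<lambda>R::real. L (1 / (\<i> * of_real R))) \<longlongrightarrow> L 0) at_top"
        using isCont_tendsto_compose[of 0 L]
          holomorphic_on_imp_continuous_on[OF L(1)] zero_in_inv_dom open_inv_dom
        by (auto simp: continuous_on_eq_continuous_at)
    qed auto
    then have "((\<lambda>R::real. L (1 / (\<i> * of_real R)) - (Ln (1 + \<i> * p / of_real R) - Ln (1 + \<i> * p' / of_real R)))
        \<longlongrightarrow> 0) at_top" by (simp add: L)
    moreover have "\<forall>\<^sub>F R::real in at_top. L (1 / (\<i> * of_real R)) - (Ln (1 + \<i> * p / of_real R) - Ln (1 + \<i> * p' / of_real R)) = N (\<i> * of_real R)"
      using eventually_gt_at_top[of 2]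
    proof eventually_elim
      case (elim R)
      have "Ln (- \<i> * (\<i> * of_real R - q)) = of_real (ln R) + Ln (1 + \<i> * q / of_real R)" if "q \<in> wave" for q
      proof -
        have "cmod (\<i> * q / of_real R) < 1"
          using cmod_wave_le[OF that] elim by (simp add: norm_divide norm_mult)
        then have nz: "1 + \<i> * q / of_real R \<noteq> 0"
          by (metis add_eq_0_iff less_irrefl norm_minus_cancel norm_one)
        have "- \<i> * (\<i> * of_real R - q) = of_real R * (1 + \<i> * q / of_real R)"
          using elim by (simp add: algebra_simps)
        then show ?thesis using elim nz by (simp add: Ln_times_of_real Ln_of_real)
      qed
      then show ?case using p by (simp add: N_def)
    qed
    ultimately show ?thesis by (rule Lim_transform_eventually)
  qed
  moreover have "\<forall>\<^sub>F R::real in at_top. N (\<i> * of_real R) = c"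
    using eventually_gt_at_top[of 2]
  proof eventually_elim
    case (elim R)
    have "\<i> * of_real R \<in> {z. Im z > 1}" using elim by simp
    then show ?case using halfplane_subset_upper c by blast
  qed
  ultimately have "((\<lambda>R::real. c) \<longlongrightarrow> 0) at_top"
    by (rule Lim_transform_eventually)
  then have "c = 0" by (simp add: tendsto_const_iff)
  then show ?thesis using c[OF z] by (simp add: N_def)
qed

text \<open>On either side of the wave \<open>L\<close> is a difference of two principal logarithms,
  each with imaginary part between -pi and pi; the lower side reduces to the upper one because
  \<open>L (- u)\<close> belongs to the points \<open>- p\<close> and \<open>- p'\<close>. The bound
  2 pi is what puts \<open>exp (L u / 4)\<close> into the closed right half-plane.\<close>

lemma log_quotient_exists:
  assumes p: "p \<in> wave" "p' \<in> wave"
  obtains L where "L holomorphic_on inv_dom" "L 0 = 0"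
    "\<And>u. u \<in> inv_dom \<Longrightarrow> exp (L u) = (1 - p * u) / (1 - p' * u)"
    "\<And>u. u \<in> inv_dom \<Longrightarrow> \<bar>Im (L u)\<bar> \<le> 2 * pi"
proof -
  define r where "r u = (1 - p * u) / (1 - p' * u)" for u
  have "r holomorphic_on inv_dom"
    unfolding r_def using one_minus_mult_nonzero[OF p(2)] by (auto intro!: holomorphic_intros)
  moreover have "r u \<noteq> 0" if "u \<in> inv_dom" for u
    using one_minus_mult_nonzero[OF p(1) that] one_minus_mult_nonzero[OF p(2) that] by (simp add: r_def)
  moreover note conjunct2[OF iffD1[OF simply_connected_eq_holomorphic_log[OF open_inv_dom] simply_connected_inv_dom],
      THEN spec, of r]
  ultimately have "\<exists>g. g holomorphic_on inv_dom \<and> (\<forall>u\<in>inv_dom. r u = exp (g u))" by simp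
  then obtain g where g: "g holomorphic_on inv_dom"
    "\<And>u. u \<in> inv_dom \<Longrightarrow> (1 - p * u) / (1 - p' * u) = exp (g u)"
    unfolding r_def by blast
  define L where "L u = g u - g 0" for u
  have L: "L holomorphic_on inv_dom" "L 0 = 0"
    unfolding L_def[abs_def] by (intro holomorphic_intros g) simp
  have e: "exp (L u) = (1 - p * u) / (1 - p' * u)" if "u \<in> inv_dom" for u
    using g(2)[OF that] g(2)[OF zero_in_inv_dom] by (simp add: L_def exp_diff)
  have im: "\<bar>Im (Ln a - Ln b)\<bar> \<le> 2 * pi" if "a \<noteq> 0" "b \<noteq> 0" for a b
    using mpi_less_Im_Ln[OF that(1)] Im_Ln_le_pi[OF that(1)] mpi_less_Im_Ln[OF that(2)] Im_Ln_le_pi[OF that(2)]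
    by auto
  have nz: "- \<i> * (z - q) \<noteq> 0" if "z \<in> upper" "q \<in> wave" for z q
    using not_nonpos_upper[OF that] by auto
  have up: "\<bar>Im (L (1 / z))\<bar> \<le> 2 * pi" if z: "z \<in> upper" for z
    using log_quotient_upper[OF p L e z] im[OF nz[OF z p(1)] nz[OF z p(2)]] by metis
  have lo: "\<bar>Im (L (1 / z))\<bar> \<le> 2 * pi" if z: "z \<in> lower" for z
  proof -
    have z': "- z \<in> upper" using z uminus_mem_upper by simp
    have q: "- p \<in> wave" "- p' \<in> wave" using p by (simp_all add: uminus_mem_wave)
    have L': "(\<lambda>u. L (- u)) holomorphic_on inv_dom"
      by (rule holomorphic_on_comp[OF L(1)]) (auto simp: uminus_mem_inv_dom intro!: holomorphic_intros)
    have "L (- (1 / - z)) = Ln (- \<i> * (- z - - p)) - Ln (- \<i> * (- z - - p'))"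
      by (rule log_quotient_upper[OF q L' _ _ z']) (use L e in \<open>auto simp: uminus_mem_inv_dom\<close>)
    then have "L (1 / z) = Ln (- \<i> * (- z - - p)) - Ln (- \<i> * (- z - - p'))"
      by (simp only: minus_divide_right minus_minus)
    then show ?thesis
      using im[OF nz[OF z' q(1)] nz[OF z' q(2)]] by metis
  qed
  have "\<bar>Im (L u)\<bar> \<le> 2 * pi" if "u \<in> inv_dom" for u
  proof (cases "u = 0")
    case False
    then have "1 / u \<in> upper \<union> lower"
      using that by (simp add: upper_Un_lower inv_dom_iff)
    then show ?thesis using up[of "1 / u"] lo[of "1 / u"] by auto
  qed (simp add: L)
  then show thesis using that L e by metis
qed

section \<open>The Ahlfors function near the wave\<close>

text \<open>Taking fourth powers reduces the constants to \<open>4^3 \<le> 3^4\<close>,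
  \<open>100^3 \<le> 32^4\<close> and \<open>4^4 * 2 \<le> 5^4\<close>.\<close>

lemma powr_quarter_aux:
  fixes y :: real
  assumes "0 < y"
  shows "(y / 4) powr (-3/4) \<le> 3 * y powr (-3/4)" "(y / 100) powr (-3/4) \<le> 32 * y powr (-3/4)"
    "4 * (2 * y) powr (1/4) \<le> 5 * y powr (1/4)"
proof -
  have "(4::real) powr (3/4) = 64 powr (1/4)" using powr_powr[of "4::real" 3 "1/4"] by simp
  also have "\<dots> \<le> 81 powr (1/4)" by (intro powr_mono2) auto
  also have "\<dots> = 3" using powr_powr[of "3::real" 4 "1/4"] by simp
  finally have a: "(4::real) powr (3/4) \<le> 3" .
  have "(100::real) powr (3/4) = 1000000 powr (1/4)" using powr_powr[of "100::real" 3 "1/4"] by simp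
  also have "\<dots> \<le> 1048576 powr (1/4)" by (intro powr_mono2) auto
  also have "\<dots> = 32" using powr_powr[of "32::real" 4 "1/4"] by simp
  finally have b: "(100::real) powr (3/4) \<le> 32" .
  have "4 * (2::real) powr (1/4) = 512 powr (1/4)"
    using powr_mult[of 256 2 "1/4"] powr_powr[of "4::real" 4 "1/4"] by simp
  also have "\<dots> \<le> 625 powr (1/4)" by (intro powr_mono2) auto
  also have "\<dots> = 5" using powr_powr[of "5::real" 4 "1/4"] by simp
  finally have c: "4 * (2::real) powr (1/4) \<le> 5" .
  have "(y / 4) powr (-3/4) = 4 powr (3/4) * y powr (-3/4)"
    using assms by (simp add: powr_divide powr_minus field_simps)
  also have "\<dots> \<le> 3 * y powr (-3/4)" using a by (intro mult_right_mono) auto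
  finally show "(y / 4) powr (-3/4) \<le> 3 * y powr (-3/4)" .
  have "(y / 100) powr (-3/4) = 100 powr (3/4) * y powr (-3/4)"
    using assms by (simp add: powr_divide powr_minus field_simps)
  also have "\<dots> \<le> 32 * y powr (-3/4)" using b by (intro mult_right_mono) auto
  finally show "(y / 100) powr (-3/4) \<le> 32 * y powr (-3/4)" .
  have "4 * (2 * y) powr (1/4) = (4 * 2 powr (1/4)) * y powr (1/4)"
    using assms by (simp add: powr_mult)
  also have "\<dots> \<le> 5 * y powr (1/4)" using c by (intro mult_right_mono) auto
  finally show "4 * (2 * y) powr (1/4) \<le> 5 * y powr (1/4)" .
qed

locale wave_map =
  fixes k h :: "complex \<Rightarrow> complex" and \<kappa> :: real
  assumes k_holo: "k holomorphic_on inv_dom" and h_holo: "h holomorphic_on ball 0 1"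
    and k_inv: "\<And>z. z \<in> inv_dom \<Longrightarrow> k z \<in> ball 0 1 \<and> h (k z) = z"
    and h_inv: "\<And>z. z \<in> ball 0 1 \<Longrightarrow> h z \<in> inv_dom \<and> k (h z) = z"
    and k_0: "k 0 = 0" and kappa_pos: "0 < \<kappa>" and deriv_k_0: "deriv k 0 = of_real \<kappa>"
begin

definition F :: "complex \<Rightarrow> complex" where "F z = k (1 / z)"

lemma h_0: "h 0 = 0"
  using k_inv[OF zero_in_inv_dom] k_0 by simp

lemma comp_h:
  assumes K: "K holomorphic_on inv_dom"
  shows "(\<lambda>w. K (h w)) holomorphic_on ball 0 1"
    and "deriv (\<lambda>w. K (h w)) 0 = deriv K 0 / of_real \<kappa>"
proof -
  show "(\<lambda>w. K (h w)) holomorphic_on ball 0 1"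
    by (rule holomorphic_on_comp[OF K h_holo]) (use h_inv in blast)
  have chain: "((\<lambda>w. G (h w)) has_field_derivative deriv G 0 * deriv h 0) (at 0)"
    if G: "G holomorphic_on inv_dom" for G
  proof (rule DERIV_chain2[of G _ h])
    show "(G has_field_derivative deriv G 0) (at (h 0))"
      unfolding h_0 by (rule holomorphic_derivI[OF G open_inv_dom zero_in_inv_dom])
    show "(h has_field_derivative deriv h 0) (at 0)"
      by (rule holomorphic_derivI[OF h_holo]) auto
  qed
  have "((\<lambda>w. k (h w)) has_field_derivative 1) (at 0)"
    by (rule has_field_derivative_transform_within_open[OF DERIV_ident open_ball, of _ 0 1])
       (use h_inv in auto)
  with chain[OF k_holo] have "of_real \<kappa> * deriv h 0 = 1"
    unfolding deriv_k_0 by (rule DERIV_unique)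
  then have "deriv h 0 = 1 / of_real \<kappa>"
    using kappa_pos by (simp add: nonzero_eq_divide_eq mult.commute)
  then show "deriv (\<lambda>w. K (h w)) 0 = deriv K 0 / of_real \<kappa>"
    using DERIV_imp_deriv[OF chain[OF K]] by simp
qed

text \<open>Composition with \<open>h\<close> carries the extremal problem to the unit disc and
  divides the derivative at 0 by \<open>\<kappa>\<close>; in the disc the identity is the only
  function with derivative 1.\<close>

lemma
  assumes K: "K holomorphic_on inv_dom" and le: "\<And>u. u \<in> inv_dom \<Longrightarrow> cmod (K u) \<le> 1"
  shows extremal_le: "cmod (deriv K 0) \<le> \<kappa>"
    and extremal_unique: "deriv K 0 = of_real \<kappa> \<Longrightarrow> u \<in> inv_dom \<Longrightarrow> K u = k u"
proof -
  note c = comp_h[OF K]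
  have le': "cmod (K (h z)) \<le> 1" if "z \<in> ball 0 1" for z
    using le h_inv[OF that] by blast
  have "cmod (deriv (\<lambda>w. K (h w)) 0) \<le> 1"
    by (rule disc_deriv_le_1[OF c(1) le'])
  then show "cmod (deriv K 0) \<le> \<kappa>"
    unfolding c(2) using kappa_pos by (simp add: norm_divide)
  assume d: "deriv K 0 = of_real \<kappa>" and u: "u \<in> inv_dom"
  have "deriv (\<lambda>w. K (h w)) 0 = 1" unfolding c(2) d using kappa_pos by simp
  then have "K (h (k u)) = k u"
    using disc_deriv_eq_1[OF c(1) le', of "k u"] k_inv[OF u] by blast
  then show "K u = k u" using k_inv[OF u] by simp
qed

text \<open>By the symmetry of the wave, \<open>- k (- u)\<close> is again admissible with the same
  derivative at 0, so uniqueness identifies it with \<open>k u\<close>.\<close>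

lemma k_odd:
  assumes "u \<in> inv_dom" shows "k (- u) = - k u"
proof -
  have hol: "(\<lambda>u. - k (- u)) holomorphic_on inv_dom"
    by (intro holomorphic_on_minus holomorphic_on_comp[OF k_holo])
       (auto simp: uminus_mem_inv_dom intro!: holomorphic_intros)
  have "((\<lambda>u. - k (- u)) has_field_derivative - (of_real \<kappa> * - 1)) (at 0)"
  proof (rule DERIV_minus, rule DERIV_chain2[of k _ uminus])
    show "(k has_field_derivative of_real \<kappa>) (at (- 0))"
      using holomorphic_derivI[OF k_holo open_inv_dom zero_in_inv_dom] by (simp add: deriv_k_0)
    show "(uminus has_field_derivative - 1) (at (0::complex))"
      by (auto intro!: derivative_eq_intros)
  qed
  then have "deriv (\<lambda>u. - k (- u)) 0 = of_real \<kappa>"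
    by (simp add: DERIV_imp_deriv)
  then have "- k (- u) = k u"
    by (intro extremal_unique[OF hol _ _ assms])
       (use k_inv uminus_mem_inv_dom in \<open>force simp: less_imp_le\<close>)+
  then show ?thesis by (metis minus_minus)
qed

text \<open>This is the Schwarz lemma for \<open>\<psi>\<close> composed with \<open>h\<close>. It
  turns every explicit bounded function that vanishes at infinity into a lower bound for
  \<open>|F|\<close>.\<close>

lemma k_dominates:
  assumes \<psi>: "\<psi> holomorphic_on inv_dom" and le: "\<And>u. u \<in> inv_dom \<Longrightarrow> cmod (\<psi> u) \<le> 1"
    and \<psi>0: "\<psi> 0 = 0" and u: "u \<in> inv_dom"
  shows "cmod (\<psi> u) \<le> cmod (k u)"
proof -
  have lt: "cmod (\<psi> u) < 1" if "u \<in> inv_dom" for u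
  proof -
    have "(\<forall>z\<in>inv_dom. cmod (\<psi> z) < 1) \<or> \<psi> constant_on inv_dom"
      by (rule holomorphic_norm_le_1_cases[OF \<psi> open_inv_dom connected_inv_dom le])
    then show ?thesis
    proof
      assume "\<psi> constant_on inv_dom"
      then have "\<psi> u = \<psi> 0"
        using that zero_in_inv_dom unfolding constant_on_def by auto
      then show ?thesis by (simp add: \<psi>0)
    qed (use that in blast)
  qed
  have "cmod (\<psi> (h (k u))) \<le> cmod (k u)"
  proof (rule Schwarz_Lemma(1)[OF comp_h(1)[OF \<psi>]])
    show "\<psi> (h 0) = 0" by (simp add: h_0 \<psi>0)
    show "cmod (\<psi> (h z)) < 1" if "cmod z < 1" for z
      using lt h_inv that by simp
    show "cmod (k u) < 1" using k_inv[OF u] by simp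
  qed
  then show ?thesis using k_inv[OF u] by simp
qed

lemma F_holo: "F holomorphic_on - wave"
  unfolding F_def[abs_def]
  by (rule holomorphic_on_comp[OF k_holo])
     (use zero_in_wave in \<open>auto simp: inverse_in_inv_dom intro!: holomorphic_intros\<close>)

lemma F_lt_1: "z \<notin> wave \<Longrightarrow> cmod (F z) < 1"
  using k_inv[OF inverse_in_inv_dom] by (simp add: F_def)

lemma F_deriv: "z \<notin> wave \<Longrightarrow> (F has_field_derivative deriv F z) (at z)"
  by (rule holomorphic_derivI[OF F_holo]) (auto simp: closed_wave)

lemma F_odd: "z \<notin> wave \<Longrightarrow> F (- z) = - F z"
  using k_odd[OF inverse_in_inv_dom] by (simp add: F_def)

text \<open>Compare \<open>k\<close> with \<open>(1 - s) / (1 + s)\<close>, where \<open>s\<close> is the fourth root of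
  \<open>(z - p) / (z - p')\<close>, \<open>p\<close> is the point of the arc nearest to \<open>z\<close> and \<open>p'\<close> is an
  endpoint of the arc.\<close>

lemma F_lower_bound:
  assumes z: "z \<notin> wave"
  shows "1 - cmod (F z) \<le> 2 * (2 * infdist z wave) powr (1/4)"
proof -
  define d where "d = infdist z wave"
  obtain p where p: "p \<in> wave" "d = dist z p"
    using infdist_attains_inf[OF closed_wave, of z] zero_in_wave unfolding d_def by blast
  have d0: "0 < d" using p z by auto
  \<comment> \<open>The endpoint on the other side of the imaginary axis has distance at least 1
    from \<open>p\<close>; hence \<open>|z - p'|\<close> cannot be small along with
    \<open>|z - p|\<close>, and the ratio is \<open>O(d)\<close>.\<close>
  define p' :: complex where "p' = (if 0 \<le> Re p then -1 else 1)"
  have p': "p' \<in> wave" by (simp add: p'_def one_in_wave minus_one_in_wave)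
  have pp: "1 \<le> cmod (p - p')"
    using abs_Re_le_cmod[of "p - p'"] by (auto simp: p'_def split: if_splits)
  have dz: "d \<le> cmod (z - p')"
    using infdist_le[OF p', of z] by (simp add: d_def dist_norm)
  have ratio: "cmod (z - p) / cmod (z - p') \<le> 2 * d"
  proof (cases "d \<ge> 1/2")
    case True
    have "cmod (z - p) / cmod (z - p') \<le> 1"
      using dz d0 p by (simp add: dist_norm divide_le_eq_1)
    then show ?thesis using True by simp
  next
    case False
    have "cmod (p - p') \<le> cmod (z - p') + cmod (z - p)"
      using norm_triangle_ineq4[of "z - p'" "z - p"] by simp
    then have *: "1/2 \<le> cmod (z - p')" using False p pp by (simp add: dist_norm)
    have "d * 1 \<le> d * (2 * cmod (z - p'))"
      using * d0 by (intro mult_left_mono) auto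
    then have "d \<le> 2 * d * cmod (z - p')" by simp
    moreover have "0 < cmod (z - p')" using * by linarith
    ultimately show ?thesis using p by (simp add: dist_norm divide_le_eq)
  qed
  obtain L where L: "L holomorphic_on inv_dom" "L 0 = 0"
    and eL: "\<And>u. u \<in> inv_dom \<Longrightarrow> exp (L u) = (1 - p * u) / (1 - p' * u)"
    and imL: "\<And>u. u \<in> inv_dom \<Longrightarrow> \<bar>Im (L u)\<bar> \<le> 2 * pi"
    by (rule log_quotient_exists[OF p(1) p']) (rule that)
  define s where "s u = exp (L u / 4)" for u
  have Re_s: "0 \<le> Re (s u)" if "u \<in> inv_dom" for u
  proof -
    have "0 \<le> cos (Im (L u) / 4)"
      using imL[OF that] by (intro cos_ge_zero) auto
    then show ?thesis by (simp add: s_def Re_exp)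
  qed
  have nz: "1 + s u \<noteq> 0" if "u \<in> inv_dom" for u
    using Re_s[OF that] by (auto simp: complex_eq_iff)
  define \<psi> where "\<psi> u = (1 - s u) / (1 + s u)" for u
  have hol: "\<psi> holomorphic_on inv_dom"
    unfolding \<psi>_def s_def using nz by (intro holomorphic_intros L) (auto simp: s_def)
  have le: "cmod (\<psi> u) \<le> 1" if "u \<in> inv_dom" for u
  proof -
    have "(cmod (1 - s u))\<^sup>2 \<le> (cmod (1 + s u))\<^sup>2"
      using Re_s[OF that] unfolding cmod_power2 by (simp add: power2_eq_square algebra_simps)
    then have "cmod (1 - s u) \<le> cmod (1 + s u)"
      by (rule power2_le_imp_le) simp
    then show ?thesis using nz[OF that] by (simp add: \<psi>_def norm_divide)
  qed
  define u where "u = 1 / z"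
  have u: "u \<in> inv_dom" using inverse_in_inv_dom[OF z] by (simp add: u_def)
  have "cmod (\<psi> u) \<le> cmod (F z)"
    unfolding F_def u_def[symmetric]
    by (rule k_dominates[OF hol le _ u]) (simp_all add: \<psi>_def s_def L(2))
  moreover have "1 - cmod (\<psi> u) \<le> 2 * cmod (s u)"
  proof -
    have "1 - cmod (\<psi> u) \<le> cmod (1 - \<psi> u)"
      using norm_triangle_ineq2[of 1 "\<psi> u"] by simp
    also have "1 - \<psi> u = 2 * s u / (1 + s u)"
      using nz[OF u] by (simp add: \<psi>_def field_simps)
    also have "cmod (2 * s u / (1 + s u)) = 2 * cmod (s u) / cmod (1 + s u)"
      by (simp add: norm_divide norm_mult)
    also have "\<dots> \<le> 2 * cmod (s u) / 1"
    proof (intro divide_left_mono)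
      show "1 \<le> cmod (1 + s u)"
        using complex_Re_le_cmod[of "1 + s u"] Re_s[OF u] by simp
    qed (use nz[OF u] in auto)
    finally show ?thesis by simp
  qed
  moreover have "cmod (s u) \<le> (2 * d) powr (1/4)"
  proof -
    have z0: "z \<noteq> 0" using z zero_in_wave by auto
    have "exp (L u) = (z - p) / (z - p')"
      unfolding eL[OF u] using z0 by (simp add: u_def divide_simps)
    then have "exp (Re (L u)) = cmod (z - p) / cmod (z - p')"
      by (metis norm_exp_eq_Re norm_divide)
    then have "exp (Re (L u)) \<le> 2 * d" using ratio by simp
    then have "exp (Re (L u)) powr (1/4) \<le> (2 * d) powr (1/4)"
      by (intro powr_mono2) auto
    moreover have "exp (Re (L u)) powr (1/4) = exp (Re (L u) / 4)"
      by (simp add: powr_def)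
    ultimately show ?thesis by (simp add: s_def)
  qed
  ultimately show ?thesis unfolding d_def by linarith
qed

text \<open>Schwarz-Pick is applied on the largest disc around \<open>z\<close> that misses the
  wave, of radius \<open>d \<ge> r\<close>. There \<open>1 - |F|^2\<close> is at most
  \<open>2 * (1 - |F|)\<close>, so the bound is \<open>4 * (2 * d) powr (1/4) / d\<close>, and
  \<open>d powr (-3/4)\<close> decreases in \<open>d\<close>.\<close>

lemma F_deriv_bound:
  assumes r: "0 < r" and b: "ball z r \<inter> wave = {}"
  shows "cmod (deriv F z) \<le> 5 * r powr (-3/4)"
proof -
  define d where "d = infdist z wave"
  have z: "z \<notin> wave" using b centre_in_ball[of z r] r by blast
  obtain p where p: "p \<in> wave" "d = dist z p"
    using infdist_attains_inf[OF closed_wave, of z] zero_in_wave unfolding d_def by blast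
  have rd: "r \<le> d" using p b by (metis IntI empty_iff mem_ball not_less)
  then have d0: "0 < d" using r by linarith
  have dball: "w \<notin> wave" if "w \<in> ball z d" for w
    using that infdist_le[of w wave z] by (auto simp: d_def)
  have "F holomorphic_on ball z d"
    by (rule holomorphic_on_subset[OF F_holo]) (use dball in auto)
  then have "cmod (deriv F z) \<le> (1 - (cmod (F z))\<^sup>2) / d"
    by (rule Schwarz_Pick_deriv[OF _ d0]) (use dball F_lt_1 in auto)
  also have "1 - (cmod (F z))\<^sup>2 = (1 - cmod (F z)) * (1 + cmod (F z))"
    by (simp add: power2_eq_square algebra_simps)
  also have "\<dots> / d \<le> (2 * (2 * d) powr (1/4)) * 2 / d"
    using F_lower_bound[OF z] F_lt_1[OF z] d0
    by (intro divide_right_mono mult_mono) (auto simp: d_def)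
  also have "\<dots> = 4 * (2 * d) powr (1/4) / d" by simp
  also have "\<dots> \<le> 5 * d powr (1/4) / d"
    using powr_quarter_aux(3)[OF d0] d0 by (intro divide_right_mono) auto
  also have "\<dots> = 5 * d powr (-3/4)"
    using d0 powr_diff[of d "1/4" 1] by simp
  also have "\<dots> \<le> 5 * r powr (-3/4)"
    using rd r by (intro mult_left_mono powr_mono2') auto
  finally show ?thesis .
qed

lemma F_Lipschitz:
  assumes S: "convex S" "0 < r" "\<And>z. z \<in> S \<Longrightarrow> ball z r \<inter> wave = {}" and "x \<in> S" "y \<in> S"
  shows "cmod (F x - F y) \<le> 5 * r powr (-3/4) * cmod (x - y)"
proof (rule field_differentiable_bound[OF S(1), where f' = "deriv F"])
  fix z assume z: "z \<in> S"
  have "z \<notin> wave" using S(3)[OF z] centre_in_ball[of z r] S(2) by blast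
  then show "(F has_field_derivative deriv F z) (at z within S)"
    using F_deriv has_field_derivative_at_within by blast
  show "cmod (deriv F z) \<le> 5 * r powr (-3/4)"
    by (rule F_deriv_bound[OF S(2) S(3)[OF z]])
qed fact+

end

section \<open>Discs that miss the wave\<close>

lemma ball_disjoint_wave_above:
  assumes "8 * \<bar>x\<bar> ^ 7 \<le> y" "0 < y" "y \<le> 1/2"
  shows "ball (Complex x y) (y / 4) \<inter> wave = {}"
proof (rule ccontr)
  assume "ball (Complex x y) (y / 4) \<inter> wave \<noteq> {}"
  then obtain p where p: "dist (Complex x y) p < y / 4" "p \<in> wave" by auto
  have re: "\<bar>Re p - x\<bar> < y / 4" and im: "\<bar>Im p - y\<bar> < y / 4"
    using abs_Re_le_cmod[of "p - Complex x y"] abs_Im_le_cmod[of "p - Complex x y"] p(1)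
    by (auto simp: dist_norm norm_minus_commute)
  have "3/4 * y < Im p" using im by linarith
  also have "Im p \<le> \<bar>Re p\<bar> ^ 7"
    using abs_wig_le[of "Re p"] p(2) by (simp add: mem_wave)
  finally have *: "3/4 * y < \<bar>Re p\<bar> ^ 7" .
  \<comment> \<open>If \<open>|x| \<le> y\<close>, then \<open>|Re p|\<close> is at most
    \<open>5/4 * y\<close> and its seventh power is small because \<open>y \<le> 1/2\<close>.
    Otherwise \<open>|Re p|\<close> is at most \<open>5/4 * |x|\<close>, and the factor 8 in the
    hypothesis absorbs \<open>(5/4)^7 < 6\<close>.\<close>
  show False
  proof (cases "\<bar>x\<bar> \<le> y")
    case True
    have "\<bar>Re p\<bar> ^ 7 \<le> (5/4 * y) ^ 7"
      using re True by (intro power_mono; linarith)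
    also have "\<dots> = (5/4) ^ 7 * y ^ 6 * y" by (simp add: power_mult_distrib eval_nat_numeral)
    also have "\<dots> \<le> (5/4) ^ 7 * (1/2) ^ 6 * y"
      using assms by (intro mult_right_mono mult_left_mono power_mono) auto
    also have "\<dots> \<le> 3/4 * y"
      using assms by (intro mult_right_mono) (auto simp: power_divide)
    finally show False using * by simp
  next
    case False
    have "\<bar>Re p\<bar> ^ 7 \<le> (5/4 * \<bar>x\<bar>) ^ 7"
      using re False by (intro power_mono; linarith)
    also have "\<dots> = (5/4) ^ 7 * \<bar>x\<bar> ^ 7" by (simp only: power_mult_distrib)
    also have "\<dots> \<le> (5/4) ^ 7 * (y / 8)"
      using assms by (intro mult_left_mono) auto
    also have "\<dots> \<le> 3/4 * y" using assms by (simp add: power_divide)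
    finally show False using * by simp
  qed
qed

text \<open>\<open>|x|^9\<close> is the scale on which the phase \<open>pi / t^8\<close> changes by
  a bounded amount. Within a hundredth of it the phase moves by at most 0.64, so the cosine factor
  is at least 7/10 and \<open>|t|^7\<close> at least \<open>93/100 * |x|^7\<close>. Their product
  0.651 exceeds 1/2 + 1/100; the extra \<open>|x|^9 / 100\<close> leaves room for the vertical
  extent of a disc in \<open>ball_disjoint_wave_valley\<close>.\<close>

lemma wig_near_minimum:
  assumes x: "0 < \<bar>x\<bar>" "\<bar>x\<bar> \<le> 1/2" and min: "wig x = - (\<bar>x\<bar> ^ 7)"
    and t: "\<bar>t - x\<bar> < \<bar>x\<bar> ^ 9 / 100"
  shows "wig t < - (\<bar>x\<bar> ^ 7 / 2) - \<bar>x\<bar> ^ 9 / 100"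
proof -
  define d where "d = (t - x) / x"
  have x0: "x \<noteq> 0" using x by auto
  have td: "t = x * (1 + d)" using x0 by (simp add: d_def field_simps)
  have x9: "\<bar>x\<bar> ^ 9 = \<bar>x\<bar> ^ 8 * \<bar>x\<bar>" by (simp add: eval_nat_numeral)
  have x8: "\<bar>x\<bar> ^ 8 \<le> (1/2) ^ 8" using x by (intro power_mono) auto
  have "\<bar>d\<bar> * \<bar>x\<bar> < \<bar>x\<bar> ^ 8 / 100 * \<bar>x\<bar>"
    using t x0 x9 by (simp add: d_def)
  then have d: "\<bar>d\<bar> < \<bar>x\<bar> ^ 8 / 100" using x by (simp only: mult_less_cancel_right_pos)
  have d1: "\<bar>d\<bar> < 1/100" using d x8 by (simp add: power_divide)
  have dd: "- 1 \<le> d" "- 1 \<le> - d" using d1 by linarith+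
  have "1 + 8 * d \<le> (1 + d) ^ 8" "1 - 8 * d \<le> (1 - d) ^ 8" "1 + 7 * d \<le> (1 + d) ^ 7"
    using Bernoulli_inequality[OF dd(1), of 8] Bernoulli_inequality[OF dd(2), of 8]
      Bernoulli_inequality[OF dd(1), of 7] by simp_all
  then have bern: "1 - 8 * \<bar>d\<bar> \<le> (1 + d) ^ 8" "1 - 8 * \<bar>d\<bar> \<le> (1 - d) ^ 8" "1 - 7 * \<bar>d\<bar> \<le> (1 + d) ^ 7"
    by linarith+
  \<comment> \<open>The ratio of the phases at \<open>t\<close> and at \<open>x\<close>. The
    Bernoulli inequalities put it within \<open>16 * |d|\<close> of 1.\<close>
  define q where "q = 1 / (1 + d) ^ 8"
  have p8: "0 < (1 + d) ^ 8" using d1 by (intro zero_less_power) linarith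
  have q1: "q \<le> 1 + 16 * \<bar>d\<bar>"
  proof -
    have "0 \<le> 8 * \<bar>d\<bar> * (1 - 16 * \<bar>d\<bar>)" using d1 by (intro mult_nonneg_nonneg) auto
    then have "1 \<le> (1 + 16 * \<bar>d\<bar>) * (1 - 8 * \<bar>d\<bar>)" by (simp add: algebra_simps)
    also have "\<dots> \<le> (1 + 16 * \<bar>d\<bar>) * (1 + d) ^ 8"
      using bern by (intro mult_left_mono) auto
    finally show ?thesis using p8 by (simp add: q_def divide_le_eq)
  qed
  have q2: "1 - 8 * \<bar>d\<bar> \<le> q"
  proof -
    have "(1 - d) * (1 + d) \<le> 1" by (simp add: algebra_simps)
    moreover have "0 \<le> (1 - d) * (1 + d)" using d1 by (intro mult_nonneg_nonneg) auto
    ultimately have "((1 - d) * (1 + d)) ^ 8 \<le> 1" by (simp add: power_le_one)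
    then have "(1 - d) ^ 8 \<le> q"
      using p8 by (simp add: q_def le_divide_eq power_mult_distrib)
    then show ?thesis using bern by linarith
  qed
  define v where "v = pi / t ^ 8"
  define v0 where "v0 = pi / x ^ 8"
  have vq: "v - v0 = v0 * (q - 1)"
    unfolding v_def v0_def q_def td power_mult_distrib by (simp add: right_diff_distrib)
  have q3: "\<bar>q - 1\<bar> \<le> 16 * (\<bar>x\<bar> ^ 8 / 100)" using q1 q2 d by linarith
  have "\<bar>v - v0\<bar> = pi / \<bar>x\<bar> ^ 8 * \<bar>q - 1\<bar>"
    unfolding vq abs_mult by (simp add: v0_def power_abs)
  also have "\<dots> \<le> pi / \<bar>x\<bar> ^ 8 * (16 * (\<bar>x\<bar> ^ 8 / 100))"
    using q3 by (intro mult_left_mono) auto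
  also have "\<dots> = pi * 4 / 25" using x0 by simp
  also have "\<dots> \<le> 0.64" using pi_less_4 by simp
  finally have vv: "\<bar>v - v0\<bar> \<le> 0.64" .
  have sgn: "\<bar>x\<bar> ^ 7 = sgn x * x ^ 7" "\<bar>t\<bar> ^ 7 = sgn x * t ^ 7"
  proof -
    have st: "sgn t = sgn x" unfolding td using d1 by (simp add: sgn_mult)
    have "\<bar>y\<bar> ^ 7 = sgn y * y ^ 7" for y :: real
      by (cases "y \<ge> 0") (auto simp: sgn_if)
    from this[of x] this[of t] st show "\<bar>x\<bar> ^ 7 = sgn x * x ^ 7" "\<bar>t\<bar> ^ 7 = sgn x * t ^ 7" by simp_all
  qed
  have s2: "sgn x * sgn x = 1" using x0 by (simp add: sgn_if)
  have "x ^ 7 * sin v0 = x ^ 7 * - sgn x" using min sgn by (simp add: wig_def v0_def)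
  moreover have "x ^ 7 \<noteq> 0" using x0 by simp
  \<comment> \<open>At the minimum the sine is extremal and the cosine vanishes, so to first order
    the sine does not change with the phase.\<close>
  ultimately have s0: "sin v0 = - sgn x" by (metis mult_left_cancel)
  have "(sin v0)\<^sup>2 + (cos v0)\<^sup>2 = 1" by simp
  then have c0: "cos v0 = 0" using s2 by (simp add: s0 power2_eq_square)
  have "sin v = sin (v0 + (v - v0))" by simp
  also have "\<dots> = - sgn x * cos (v - v0)" by (simp only: sin_add s0 c0)
  finally have sv: "sin v = - sgn x * cos (v - v0)" .
  have "(v - v0)\<^sup>2 \<le> 0.64\<^sup>2" using vv by (intro abs_le_square_iff[THEN iffD1]) auto
  moreover have "1 - (v - v0)\<^sup>2 / 2 \<le> cos (v - v0)"
  proof -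
    have "cos (2 * ((v - v0) / 2)) = 1 - 2 * (sin ((v - v0) / 2))\<^sup>2"
      by (rule cos_double_sin)
    moreover have "2 * ((v - v0) / 2) = v - v0" by simp
    ultimately have "cos (v - v0) = 1 - 2 * (sin ((v - v0) / 2))\<^sup>2" by (simp only:)
    moreover have "(sin ((v - v0) / 2))\<^sup>2 \<le> ((v - v0) / 2)\<^sup>2"
      using abs_sin_x_le_abs_x[of "(v - v0) / 2"] by (simp only: abs_le_square_iff)
    ultimately show ?thesis by (simp add: power_divide)
  qed
  ultimately have c: "7/10 \<le> cos (v - v0)" by (simp add: power2_eq_square)
  have "wig t = - (sgn x * t ^ 7) * cos (v - v0)"
    by (simp add: wig_def sv flip: v_def)
  also have "\<dots> = - (\<bar>t\<bar> ^ 7 * cos (v - v0))" by (simp add: sgn)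
  finally have wt: "wig t = - (\<bar>t\<bar> ^ 7 * cos (v - v0))" .
  have "\<bar>t\<bar> ^ 7 = \<bar>x\<bar> ^ 7 * (1 + d) ^ 7"
    using d1 by (simp add: td abs_mult power_mult_distrib)
  also have "\<dots> \<ge> \<bar>x\<bar> ^ 7 * (93/100)"
    using bern d1 by (intro mult_left_mono) auto
  finally have "\<bar>x\<bar> ^ 7 * (93/100) * (7/10) \<le> \<bar>t\<bar> ^ 7 * cos (v - v0)"
    using c by (intro mult_mono) auto
  moreover have "\<bar>x\<bar> ^ 9 \<le> \<bar>x\<bar> ^ 7" using x by (intro power_decreasing) auto
  moreover have "0 < \<bar>x\<bar> ^ 7" using x by simp
  ultimately show ?thesis unfolding wt by linarith
qed

lemma ball_disjoint_wave_valley: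
  assumes x: "0 < \<bar>x\<bar>" "\<bar>x\<bar> \<le> 1/2" and min: "wig x = - (\<bar>x\<bar> ^ 7)"
    and y: "- (\<bar>x\<bar> ^ 7 / 2) \<le> y"
  shows "ball (Complex x y) (\<bar>x\<bar> ^ 9 / 100) \<inter> wave = {}"
proof (rule ccontr)
  assume "ball (Complex x y) (\<bar>x\<bar> ^ 9 / 100) \<inter> wave \<noteq> {}"
  then obtain p where p: "dist (Complex x y) p < \<bar>x\<bar> ^ 9 / 100" "p \<in> wave" by auto
  have re: "\<bar>Re p - x\<bar> < \<bar>x\<bar> ^ 9 / 100" and im: "\<bar>Im p - y\<bar> < \<bar>x\<bar> ^ 9 / 100"
    using abs_Re_le_cmod[of "p - Complex x y"] abs_Im_le_cmod[of "p - Complex x y"] p(1)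
    by (auto simp: dist_norm norm_minus_commute)
  have "Im p < - (\<bar>x\<bar> ^ 7 / 2) - \<bar>x\<bar> ^ 9 / 100"
    using wig_near_minimum[OF x min re] p(2) by (simp add: mem_wave)
  then show False using im y by linarith
qed

section \<open>Behaviour of the Ahlfors function near 0\<close>

context wave_map
begin

text \<open>If the clearance at height \<open>y\<close> is proportional to \<open>y\<close>, then
  \<open>|F'|\<close> is at most \<open>5 * A powr (3/4) * y powr (-3/4)\<close>, which is
  integrable at 0 with primitive \<open>20 * A powr (3/4) * y powr (1/4)\<close>.\<close>

lemma F_vertical_general:
  assumes y: "0 < y1" "y1 \<le> y2" and A: "0 < A"
    and b: "\<And>y. y1 \<le> y \<Longrightarrow> y \<le> y2 \<Longrightarrow> ball (z + \<i> * of_real y) (y / A) \<inter> wave = {}"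
  shows "cmod (F (z + \<i> * of_real y2) - F (z + \<i> * of_real y1)) \<le> 20 * A powr (3/4) * y2 powr (1/4)"
proof (cases "y1 = y2")
  case False
  define K where "K = 5 * A powr (3/4)"
  have nw: "z + \<i> * of_real y \<notin> wave" if "y1 \<le> y" "y \<le> y2" for y
    using b[OF that] centre_in_ball[of "z + \<i> * of_real y" "y / A"] that y A by fastforce
  have hv: "((\<lambda>y. F (z + \<i> * of_real y)) has_vector_derivative \<i> * deriv F (z + \<i> * of_real y)) (at y)"
    if "y1 \<le> y" "y \<le> y2" for y
  proof -
    have "((\<lambda>y. z + \<i> * of_real y) has_vector_derivative \<i>) (at y)"
      by (auto intro!: derivative_eq_intros simp: has_vector_derivative_def scaleR_conv_of_real)
    from field_vector_diff_chain_at[OF this F_deriv[OF nw[OF that]]]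
    show ?thesis by (simp add: o_def)
  qed
  have "norm (F (z + \<i> * of_real y2) - F (z + \<i> * of_real y1)) \<le> 4 * K * y2 powr (1/4) - 4 * K * y1 powr (1/4)"
  proof (rule differentiable_bound_general)
    show "y1 < y2" using False y by simp
    show "continuous_on {y1..y2} (\<lambda>y. F (z + \<i> * of_real y))"
      by (rule continuous_on_vector_derivative, rule has_vector_derivative_at_within, rule hv) auto
    show "continuous_on {y1..y2} (\<lambda>y. 4 * K * y powr (1/4))"
      using y by (intro continuous_intros) auto
    show "((\<lambda>y. F (z + \<i> * of_real y)) has_vector_derivative \<i> * deriv F (z + \<i> * of_real y)) (at y)"
      if "y1 < y" "y < y2" for y using hv that by simp
    show "((\<lambda>y. 4 * K * y powr (1/4)) has_vector_derivative K * y powr (-3/4)) (at y)"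
      if "y1 < y" "y < y2" for y
      unfolding has_real_derivative_iff_has_vector_derivative[symmetric]
      using that y by (auto intro!: derivative_eq_intros)
    show "norm (\<i> * deriv F (z + \<i> * of_real y)) \<le> K * y powr (-3/4)" if "y1 < y" "y < y2" for y
    proof -
      have "norm (deriv F (z + \<i> * of_real y)) \<le> 5 * (y / A) powr (-3/4)"
        using that y A by (intro F_deriv_bound b) auto
      also have "(y / A) powr (-3/4) = A powr (3/4) * y powr (-3/4)"
        using that y A by (simp add: powr_divide powr_minus field_simps)
      finally show ?thesis by (simp add: norm_mult K_def)
    qed
  qed
  moreover have "0 \<le> 4 * K * y1 powr (1/4)" by (simp add: K_def)
  ultimately show ?thesis unfolding K_def by linarith
qed simp

lemma F_vertical:
  assumes "8 * \<bar>x\<bar> ^ 7 \<le> y1" "0 < y1" "y1 \<le> y2" "y2 \<le> 1/2"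
  shows "cmod (F (Complex x y2) - F (Complex x y1)) \<le> 60 * y2 powr (1/4)"
proof -
  have C: "of_real x + \<i> * of_real y = Complex x y" for y by (simp add: complex_eq_iff)
  have "ball (of_real x + \<i> * of_real y) (y / 4) \<inter> wave = {}" if "y1 \<le> y" "y \<le> y2" for y
    unfolding C using that assms by (intro ball_disjoint_wave_above) auto
  then have "cmod (F (Complex x y2) - F (Complex x y1)) \<le> 20 * 4 powr (3/4) * y2 powr (1/4)"
    using F_vertical_general[of y1 y2 4 "of_real x"] assms by (simp add: C)
  also have "\<dots> \<le> 20 * 3 * y2 powr (1/4)"
    using powr_quarter_aux(1)[of 1] by (intro mult_right_mono mult_left_mono) (auto simp: powr_divide powr_minus)
  finally show ?thesis by simp
qed

lemma Cauchy_quarter: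
  fixes X :: "nat \<Rightarrow> complex"
  assumes est: "\<And>m n. N \<le> m \<Longrightarrow> m \<le> n \<Longrightarrow> cmod (X n - X m) \<le> K * (1 / real (m + 2)) powr (1/4)"
  shows "Cauchy X"
proof (rule metric_CauchyI)
  fix e :: real assume "0 < e"
  have "(\<lambda>n. 1 / real (n + 2)) \<longlonglongrightarrow> 0"
    using LIMSEQ_ignore_initial_segment[OF lim_inverse_n, of 2] by (simp add: inverse_eq_divide)
  then have "(\<lambda>n. K * (1 / real (n + 2)) powr (1/4)) \<longlonglongrightarrow> K * 0 powr (1/4)"
    by (intro tendsto_intros) auto
  then have "(\<lambda>n. K * (1 / real (n + 2)) powr (1/4)) \<longlonglongrightarrow> 0" by simp
  then have "\<forall>\<^sub>F n in sequentially. K * (1 / real (n + 2)) powr (1/4) < e / 2"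
    by (rule order_tendstoD(2)) (use \<open>0 < e\<close> in simp)
  with eventually_ge_at_top[of N] have "\<forall>\<^sub>F n in sequentially. N \<le> n \<and> K * (1 / real (n + 2)) powr (1/4) < e / 2"
    by eventually_elim simp
  then obtain M where M: "N \<le> M" "K * (1 / real (M + 2)) powr (1/4) < e / 2"
    unfolding eventually_sequentially by auto
  have "dist (X m) (X n) < e" if "m \<ge> M" "n \<ge> M" for m n
  proof -
    have "dist (X m) (X n) \<le> dist (X m) (X M) + dist (X n) (X M)"
      by (rule dist_triangle2)
    also have "\<dots> < e / 2 + e / 2"
      using est[OF M(1) that(1)] est[OF M(1) that(2)] M(2) by (intro add_strict_mono) (auto simp: dist_norm)
    finally show ?thesis by simp
  qed
  then show "\<exists>M. \<forall>m\<ge>M. \<forall>n\<ge>M. dist (X m) (X n) < e" by blast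
qed

text \<open>The limit along the positive imaginary axis exists by the vertical estimate; it is
  unimodular since 0 is on the wave, so that \<open>F_lower_bound\<close> drives \<open>|F|\<close>
  to 1.\<close>

lemma F_limit_at_0:
  obtains c where "cmod c = 1" "\<And>y. 0 < y \<Longrightarrow> y \<le> 1/2 \<Longrightarrow> cmod (F (Complex 0 y) - c) \<le> 60 * y powr (1/4)"
proof -
  \<comment> \<open>The shift by 2 keeps the heights at most 1/2, as \<open>F_vertical\<close>
    requires.\<close>
  define X where "X n = F (Complex 0 (1 / real (n + 2)))" for n
  have lim0: "(\<lambda>n. K * (1 / real (n + 2)) powr (1/4)) \<longlonglongrightarrow> 0" for K
  proof -
    have "(\<lambda>n. 1 / real (n + 2)) \<longlonglongrightarrow> 0"
      using LIMSEQ_ignore_initial_segment[OF lim_inverse_n, of 2] by (simp add: inverse_eq_divide)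
    then have "(\<lambda>n. K * (1 / real (n + 2)) powr (1/4)) \<longlonglongrightarrow> K * 0 powr (1/4)"
      by (intro tendsto_intros) auto
    then show ?thesis by simp
  qed
  have est: "cmod (X n - X m) \<le> 60 * (1 / real (m + 2)) powr (1/4)" if "m \<le> n" for m n
    using F_vertical[of 0 "1 / real (n + 2)" "1 / real (m + 2)"] that
    by (auto simp: X_def norm_minus_commute field_simps)
  have "Cauchy X" by (rule Cauchy_quarter[of 0]) (rule est)
  then obtain c where c: "X \<longlonglongrightarrow> c" using Cauchy_convergent_iff convergent_def by blast
  show thesis
  proof
    show "cmod (F (Complex 0 y) - c) \<le> 60 * y powr (1/4)" if y: "0 < y" "y \<le> 1/2" for y
    proof (rule tendsto_upperbound)
      show "(\<lambda>n. cmod (F (Complex 0 y) - X n)) \<longlonglongrightarrow> cmod (F (Complex 0 y) - c)"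
        by (intro tendsto_intros c)
      have "\<forall>\<^sub>F n in sequentially. 1 / real (n + 2) < y"
        using LIMSEQ_ignore_initial_segment[OF lim_inverse_n, of 2] y
        by (intro order_tendstoD(2)) (simp_all add: inverse_eq_divide)
      then show "\<forall>\<^sub>F n in sequentially. cmod (F (Complex 0 y) - X n) \<le> 60 * y powr (1/4)"
      proof eventually_elim
        case (elim n)
        then show ?case unfolding X_def using y by (intro F_vertical) auto
      qed
    qed simp
    show "cmod c = 1"
    proof (rule LIMSEQ_unique)
      show "(\<lambda>n. cmod (X n)) \<longlonglongrightarrow> cmod c" by (intro tendsto_intros c)
      show "(\<lambda>n. cmod (X n)) \<longlonglongrightarrow> 1"
      proof (rule tendsto_sandwich[OF _ _ _ tendsto_const])
        have bnd: "1 - 2 * (2 * (1 / real (n + 2))) powr (1/4) \<le> cmod (X n) \<and> cmod (X n) \<le> 1" for n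
        proof -
          define y where "y = 1 / real (n + 2)"
          have y: "0 < y" "y \<le> 1/2" by (auto simp: y_def field_simps)
          have nw: "Complex 0 y \<notin> wave" using y by (simp add: mem_wave)
          have "infdist (Complex 0 y) wave \<le> y"
            using infdist_le[OF zero_in_wave, of "Complex 0 y"] y by (simp add: cmod_def)
          then have "(2 * infdist (Complex 0 y) wave) powr (1/4) \<le> (2 * y) powr (1/4)"
            by (intro powr_mono2) (auto simp: infdist_nonneg)
          then show ?thesis
            unfolding X_def y_def[symmetric]
            using F_lower_bound[OF nw] F_lt_1[OF nw] by (intro conjI; linarith)
        qed
        show "\<forall>\<^sub>F n in sequentially. 1 - 2 * (2 * (1 / real (n + 2))) powr (1/4) \<le> cmod (X n)"
          "\<forall>\<^sub>F n in sequentially. cmod (X n) \<le> 1" using bnd by auto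
        have "(\<lambda>n. 1 - 2 * 2 powr (1/4) * (1 / real (n + 2)) powr (1/4)) \<longlonglongrightarrow> 1 - 0"
          by (intro tendsto_diff tendsto_const lim0)
        then show "(\<lambda>n. 1 - 2 * (2 * (1 / real (n + 2))) powr (1/4)) \<longlonglongrightarrow> 1"
          by (subst powr_mult) (auto simp: mult.assoc)
      qed
    qed
  qed
qed

text \<open>In the valleys of the wave near 0 the function is close to its limit \<open>c\<close> from above;
  by oddness it is close to \<open>- c\<close> under the peaks.\<close>

lemma F_in_valleys:
  obtains c where "cmod c = 1"
    "\<And>x y. 0 < \<bar>x\<bar> \<Longrightarrow> \<bar>x\<bar> \<le> 1/2 \<Longrightarrow> wig x = - (\<bar>x\<bar> ^ 7) \<Longrightarrow> \<bar>y\<bar> \<le> \<bar>x\<bar> ^ 7 / 2 \<Longrightarrow>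
       cmod (F (Complex x y) - c) \<le> 1600 * \<bar>x\<bar> powr (1/4)"
proof -
  obtain c where c: "cmod c = 1" "\<And>y. 0 < y \<Longrightarrow> y \<le> 1/2 \<Longrightarrow> cmod (F (Complex 0 y) - c) \<le> 60 * y powr (1/4)"
    by (rule F_limit_at_0) (rule that)
  show thesis
  proof (rule that[OF c(1)])
    fix x y :: real assume x: "0 < \<bar>x\<bar>" "\<bar>x\<bar> \<le> 1/2" and min: "wig x = - (\<bar>x\<bar> ^ 7)" and y: "\<bar>y\<bar> \<le> \<bar>x\<bar> ^ 7 / 2"
    define a where "a = \<bar>x\<bar>"
    have a: "0 < a" "a \<le> 1/2" using x by (simp_all add: a_def)
    \<comment> \<open>This is where the exponents matter: height 7 against width 9 gives
      \<open>7 - 9 * 3/4 = 1/4 > 0\<close>.\<close>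
    have pw: "a * (a powr (-3/4)) = a powr (1/4)" "a ^ 7 * (a ^ 9) powr (-3/4) = a powr (1/4)"
      using a powr_add[of a 1 "-3/4"] powr_add[of a 7 "- 27/4"] powr_powr[of a 9 "-3/4"]
      by (simp_all add: powr_numeral)
    have a7: "8 * a ^ 7 \<le> a"
    proof -
      have "8 * a ^ 7 = 8 * a ^ 6 * a" by (simp add: eval_nat_numeral)
      also have "\<dots> \<le> 8 * (1/2) ^ 6 * a"
        using a by (intro mult_right_mono mult_left_mono power_mono) auto
      also have "\<dots> \<le> a" using a by (simp add: power_divide)
      finally show ?thesis .
    qed
    have a70: "0 < a ^ 7" using a by simp
    \<comment> \<open>The point is linked to 0 in four moves: up the valley to
      \<open>8 * a ^ 7\<close>, on to height \<open>a\<close>, horizontally to the imaginary axis,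
      and down that axis. The constants 1360, 60, 15 and 60 add up to less than 1600.\<close>
    have 1: "cmod (F (Complex x y) - F (Complex x (8 * a ^ 7))) \<le> 1360 * a powr (1/4)"
    proof -
      have "cmod (F (Complex x y) - F (Complex x (8 * a ^ 7)))
         \<le> 5 * (a ^ 9 / 100) powr (-3/4) * cmod (Complex x y - Complex x (8 * a ^ 7))"
      proof (rule F_Lipschitz[of "closed_segment (Complex x y) (Complex x (8 * a ^ 7))"])
        show "0 < a ^ 9 / 100" using a by simp
        show "ball z (a ^ 9 / 100) \<inter> wave = {}"
          if z: "z \<in> closed_segment (Complex x y) (Complex x (8 * a ^ 7))" for z
        proof -
          have "Re z = x" "y \<le> Im z"
            using z y a70 by (auto simp: closed_segment_same_Re closed_segment_eq_real_ivl a_def split: if_splits)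
          then have "z = Complex x (Im z)" "- (\<bar>x\<bar> ^ 7 / 2) \<le> Im z" using y by (auto simp: complex_eq_iff)
          then show ?thesis
            using ball_disjoint_wave_valley[OF x min, of "Im z"] by (simp add: a_def)
        qed
      qed auto
      also have "cmod (Complex x y - Complex x (8 * a ^ 7)) = \<bar>y - 8 * a ^ 7\<bar>"
        by (simp add: cmod_def)
      also have "5 * (a ^ 9 / 100) powr (-3/4) * \<bar>y - 8 * a ^ 7\<bar>
         \<le> 5 * (32 * (a ^ 9) powr (-3/4)) * (8.5 * a ^ 7)"
        using powr_quarter_aux(2)[of "a ^ 9"] a a70 y by (intro mult_mono) (auto simp: a_def)
      also have "\<dots> = 1360 * (a ^ 7 * (a ^ 9) powr (-3/4))" by simp
      finally show ?thesis unfolding pw .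
    qed
    have 2: "cmod (F (Complex x (8 * a ^ 7)) - F (Complex x a)) \<le> 60 * a powr (1/4)"
      using F_vertical[of x "8 * a ^ 7" a] a a7 a70 by (simp add: a_def norm_minus_commute)
    have 3: "cmod (F (Complex x a) - F (Complex 0 a)) \<le> 15 * a powr (1/4)"
    proof -
      have "cmod (F (Complex x a) - F (Complex 0 a)) \<le> 5 * (a / 4) powr (-3/4) * cmod (Complex x a - Complex 0 a)"
      proof (rule F_Lipschitz[of "closed_segment (Complex x a) (Complex 0 a)"])
        show "0 < a / 4" using a by simp
        show "ball z (a / 4) \<inter> wave = {}" if z: "z \<in> closed_segment (Complex x a) (Complex 0 a)" for z
        proof -
          have "Im z = a" "\<bar>Re z\<bar> \<le> a"
            using z by (auto simp: closed_segment_same_Im closed_segment_eq_real_ivl a_def split: if_splits)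
          moreover from this have "8 * \<bar>Re z\<bar> ^ 7 \<le> 8 * a ^ 7" by (intro mult_left_mono power_mono) auto
          moreover have "z = Complex (Re z) (Im z)" by simp
          ultimately show ?thesis
            using ball_disjoint_wave_above[of "Re z" a] a a7 by (metis order_trans)
        qed
      qed auto
      also have "cmod (Complex x a - Complex 0 a) = a" by (simp add: cmod_def a_def)
      also have "5 * (a / 4) powr (-3/4) * a \<le> 5 * (3 * a powr (-3/4)) * a"
        using powr_quarter_aux(1)[of a] a by (intro mult_right_mono mult_left_mono) auto
      also have "\<dots> = 15 * (a * a powr (-3/4))" by simp
      finally show ?thesis unfolding pw .
    qed
    have 4: "cmod (F (Complex 0 a) - c) \<le> 60 * a powr (1/4)"
      using c(2)[of a] a by simp
    have "cmod (F (Complex x y) - c) \<le> cmod (F (Complex x y) - F (Complex x (8 * a ^ 7)))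
      + cmod (F (Complex x (8 * a ^ 7)) - F (Complex x a)) + cmod (F (Complex x a) - F (Complex 0 a)) + cmod (F (Complex 0 a) - c)"
      by (smt (verit, ccfv_SIG) norm_diff_triangle_le order_refl)
    then show "cmod (F (Complex x y) - c) \<le> 1600 * \<bar>x\<bar> powr (1/4)"
      using 1 2 3 4 powr_ge_zero[of a "1/4"] unfolding a_def[symmetric] by linarith
  qed
qed

end

section \<open>Integrals over rectangles\<close>

text \<open>A segment integral in Lebesgue form. Fubini applies to it directly, and it makes sense
  for integrands that are not known to be continuous where the wave crosses the segment.\<close>

definition side_int :: "complex \<Rightarrow> complex \<Rightarrow> (complex \<Rightarrow> complex) \<Rightarrow> complex" where
  "side_int a b \<phi> = (b - a) * (LINT \<tau>:{0..1}|lborel. \<phi> (linepath a b \<tau>))"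

definition rect_int :: "complex \<Rightarrow> complex \<Rightarrow> (complex \<Rightarrow> complex) \<Rightarrow> complex" where
  "rect_int a1 a3 \<phi> =
     side_int a1 (Complex (Re a3) (Im a1)) \<phi> + side_int (Complex (Re a3) (Im a1)) a3 \<phi> +
     side_int a3 (Complex (Re a1) (Im a3)) \<phi> + side_int (Complex (Re a1) (Im a3)) a1 \<phi>"

lemma side_int_cong:
  assumes "\<And>z. z \<in> closed_segment a b \<Longrightarrow> \<phi> z = \<psi> z"
  shows "side_int a b \<phi> = side_int a b \<psi>"
  unfolding side_int_def
  by (subst set_lebesgue_integral_cong[of "{0..1}" lborel _ "\<lambda>\<tau>. \<psi> (linepath a b \<tau>)"])
     (auto intro!: assms simp: linepath_in_path)

lemma has_contour_integral_side_int:
  assumes "continuous_on (closed_segment a b) \<phi>"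
  shows "(\<phi> has_contour_integral side_int a b \<phi>) (linepath a b)"
proof -
  have "continuous_on {0..1} (\<lambda>\<tau>. \<phi> (linepath a b \<tau>))"
    by (rule continuous_on_compose2[OF assms continuous_on_linepath]) (auto simp: linepath_in_path)
  then have i: "set_integrable lborel {0..1} (\<lambda>\<tau>. \<phi> (linepath a b \<tau>))"
    by (rule borel_integrable_atLeastAtMost')
  have "((\<lambda>\<tau>. \<phi> (linepath a b \<tau>)) has_integral (LINT \<tau>:{0..1}|lborel. \<phi> (linepath a b \<tau>))) {0..1}"
    using set_borel_integral_eq_integral[OF i] by (simp add: has_integral_iff)
  then have "((\<lambda>\<tau>. \<phi> (linepath a b \<tau>) * (b - a)) has_integral
       (LINT \<tau>:{0..1}|lborel. \<phi> (linepath a b \<tau>)) * (b - a)) {0..1}"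
    by (rule has_integral_mult_left)
  then show ?thesis
    unfolding has_contour_integral_linepath side_int_def by (simp only: mult.commute)
qed

lemma rectpath_sides:
  assumes "Re a1 \<le> Re a3" "Im a1 \<le> Im a3"
  shows "path_image (rectpath a1 a3) =
     closed_segment a1 (Complex (Re a3) (Im a1)) \<union> closed_segment (Complex (Re a3) (Im a1)) a3 \<union>
     closed_segment a3 (Complex (Re a1) (Im a3)) \<union> closed_segment (Complex (Re a1) (Im a3)) a1"
  by (simp add: rectpath_def Let_def path_image_join Un_assoc)

lemma has_contour_integral_rect_int:
  assumes le: "Re a1 \<le> Re a3" "Im a1 \<le> Im a3" and c: "continuous_on (path_image (rectpath a1 a3)) \<phi>"
  shows "(\<phi> has_contour_integral rect_int a1 a3 \<phi>) (rectpath a1 a3)"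
proof -
  have "(\<phi> has_contour_integral
     (side_int a1 (Complex (Re a3) (Im a1)) \<phi> + (side_int (Complex (Re a3) (Im a1)) a3 \<phi> +
     (side_int a3 (Complex (Re a1) (Im a3)) \<phi> + side_int (Complex (Re a1) (Im a3)) a1 \<phi>)))) (rectpath a1 a3)"
    unfolding rectpath_def Let_def
    by (intro has_contour_integral_join has_contour_integral_side_int continuous_on_subset[OF c])
       (auto simp: rectpath_sides[OF le] intro!: valid_path_join)
  then show ?thesis by (simp add: rect_int_def add.assoc)
qed

text \<open>Outside \<open>E\<close> the kernel is cut off to 0, so that it is bounded everywhere.\<close>

lemma side_int_Fubini:
  assumes M: "finite_measure M" and sM: "sets M = sets borel" and AE: "AE \<xi> in M. \<xi> \<in> E"
    and E: "E \<in> sets borel" and h: "continuous_on UNIV h"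
    and C: "\<And>\<xi> z. \<xi> \<in> E \<Longrightarrow> z \<in> closed_segment a b \<Longrightarrow> cmod (h z) \<le> C * cmod (z - \<xi>)"
  shows "side_int a b (\<lambda>z. \<integral>\<xi>. h z / (z - \<xi>) \<partial>M) = (\<integral>\<xi>. indicator E \<xi> * side_int a b (\<lambda>z. h z / (z - \<xi>)) \<partial>M)"
    and "set_integrable lborel {0..1} (\<lambda>\<tau>. \<integral>\<xi>. h (linepath a b \<tau>) / (linepath a b \<tau> - \<xi>) \<partial>M)"
    and "integrable M (\<lambda>\<xi>. indicator E \<xi> * side_int a b (\<lambda>z. h z / (z - \<xi>)))"
proof -
  interpret M: finite_measure M by fact
  define I where "I = restrict_space lborel {0..1::real}"
  interpret I: finite_measure I
    by (intro finite_measureI) (simp add: I_def emeasure_restrict_space space_restrict_space)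
  interpret pair_sigma_finite M I ..
  note [measurable_cong] = sM
  have [measurable]: "h \<in> borel_measurable borel" "linepath a b \<in> borel_measurable borel"
    using h by (auto intro!: borel_measurable_continuous_onI continuous_on_linepath)
  have [measurable]: "linepath a b \<in> borel_measurable I"
    unfolding I_def by (rule measurable_restrict_space1) simp
  note [measurable] = E
  define K where "K \<xi> \<tau> = indicator E \<xi> * (h (linepath a b \<tau>) / (linepath a b \<tau> - \<xi>))" for \<xi> \<tau>
  have K: "cmod (K \<xi> \<tau>) \<le> max 0 C" if "\<tau> \<in> {0..1}" for \<xi> \<tau>
  proof (cases "\<xi> \<in> E \<and> linepath a b \<tau> \<noteq> \<xi>")
    case True
    then have "cmod (h (linepath a b \<tau>)) / cmod (linepath a b \<tau> - \<xi>) \<le> C"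
      using C[of \<xi> "linepath a b \<tau>"] that by (simp add: linepath_in_path divide_le_eq)
    then show ?thesis using True by (simp add: K_def norm_divide)
  qed (auto simp: K_def)
  have Kint: "integrable (M \<Otimes>\<^sub>M I) (case_prod K)"
  proof (rule finite_measure.integrable_const_bound)
    show "finite_measure (M \<Otimes>\<^sub>M I)"
      by (intro finite_measure_pair_measure M.finite_measure_axioms I.finite_measure_axioms)
    show "AE x in M \<Otimes>\<^sub>M I. norm (case_prod K x) \<le> max 0 C"
      by (intro AE_I2) (auto simp: space_pair_measure I_def space_restrict_space intro!: K)
    show "case_prod K \<in> borel_measurable (M \<Otimes>\<^sub>M I)"
      unfolding K_def by measurable
  qed
  have inner: "(\<integral>\<xi>. K \<xi> \<tau> \<partial>M) = (\<integral>\<xi>. h (linepath a b \<tau>) / (linepath a b \<tau> - \<xi>) \<partial>M)" for \<tau>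
    unfolding K_def by (intro integral_cong_AE) (use AE in auto)
  have I_eq: "integral\<^sup>L I f = (LINT \<tau>:{0..1}|lborel. f \<tau>)" for f :: "real \<Rightarrow> complex"
    unfolding I_def set_lebesgue_integral_def by (subst integral_restrict_space) auto
  have outer: "(b - a) * (\<integral>\<tau>. K \<xi> \<tau> \<partial>I) = indicator E \<xi> * side_int a b (\<lambda>z. h z / (z - \<xi>))" for \<xi>
    unfolding I_eq side_int_def K_def by (cases "\<xi> \<in> E") auto
  have "side_int a b (\<lambda>z. \<integral>\<xi>. h z / (z - \<xi>) \<partial>M) = (b - a) * (\<integral>\<tau>. (\<integral>\<xi>. K \<xi> \<tau> \<partial>M) \<partial>I)"
    unfolding side_int_def I_eq inner ..
  also have "\<dots> = (b - a) * (\<integral>\<xi>. (\<integral>\<tau>. K \<xi> \<tau> \<partial>I) \<partial>M)"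
    using Fubini_integral[OF Kint] by simp
  also have "\<dots> = (\<integral>\<xi>. (b - a) * (\<integral>\<tau>. K \<xi> \<tau> \<partial>I) \<partial>M)"
    by (rule integral_mult_right_zero[symmetric])
  also have "\<dots> = (\<integral>\<xi>. indicator E \<xi> * side_int a b (\<lambda>z. h z / (z - \<xi>)) \<partial>M)"
    unfolding outer ..
  finally show "side_int a b (\<lambda>z. \<integral>\<xi>. h z / (z - \<xi>) \<partial>M) = (\<integral>\<xi>. indicator E \<xi> * side_int a b (\<lambda>z. h z / (z - \<xi>)) \<partial>M)" .
  have "integrable I (\<lambda>\<tau>. \<integral>\<xi>. K \<xi> \<tau> \<partial>M)"
    by (rule integrable_snd[OF Kint])
  then show "set_integrable lborel {0..1} (\<lambda>\<tau>. \<integral>\<xi>. h (linepath a b \<tau>) / (linepath a b \<tau> - \<xi>) \<partial>M)"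
    unfolding inner I_def set_integrable_def by (subst (asm) integrable_restrict_space) auto
  have "integrable M (\<lambda>\<xi>. (b - a) * (\<integral>\<tau>. K \<xi> \<tau> \<partial>I))"
    by (intro integrable_mult_right integrable_fst[OF Kint])
  then show "integrable M (\<lambda>\<xi>. indicator E \<xi> * side_int a b (\<lambda>z. h z / (z - \<xi>)))"
    unfolding outer .
qed

text \<open>At a point \<open>\<xi>\<close> of the contour the quotient \<open>h z / (z - \<xi>)\<close> has the value 0 for \<open>z = \<xi>\<close>;
  the assumption \<open>crossing\<close> says that this agrees with an entire function, which holds when \<open>h\<close>
  has a double zero at \<open>\<xi>\<close>.\<close>

lemma rect_int_kernel:
  assumes le: "Re a1 \<le> Re a3" "Im a1 \<le> Im a3" and h: "h holomorphic_on UNIV"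
    and crossing: "\<xi> \<in> path_image (rectpath a1 a3) \<Longrightarrow>
        \<exists>p. p holomorphic_on UNIV \<and> (\<forall>z. h z / (z - \<xi>) = p z)"
  shows "cmod (rect_int a1 a3 (\<lambda>z. h z / (z - \<xi>))) \<le> 2 * pi * cmod (h \<xi>) * indicator (cbox a1 a3) \<xi>"
proof (cases "\<xi> \<in> path_image (rectpath a1 a3)")
  case True
  then obtain p where p: "p holomorphic_on UNIV" "\<And>z. h z / (z - \<xi>) = p z" using crossing by blast
  have "(p has_contour_integral rect_int a1 a3 p) (rectpath a1 a3)"
    by (intro has_contour_integral_rect_int le holomorphic_on_imp_continuous_on holomorphic_on_subset[OF p(1)]) auto
  moreover have "(p has_contour_integral 0) (rectpath a1 a3)"
    by (rule Cauchy_theorem_convex_simple[OF p(1)]) auto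
  ultimately have "rect_int a1 a3 p = 0" by (rule has_contour_integral_unique)
  then show ?thesis unfolding p(2) by simp
next
  case False
  have "((\<lambda>z. h z / (z - \<xi>)) has_contour_integral 2 * pi * \<i> * winding_number (rectpath a1 a3) \<xi> * h \<xi>) (rectpath a1 a3)"
    by (rule Cauchy_integral_formula_convex_simple[OF convex_UNIV h]) (use False in auto)
  moreover have "((\<lambda>z. h z / (z - \<xi>)) has_contour_integral rect_int a1 a3 (\<lambda>z. h z / (z - \<xi>))) (rectpath a1 a3)"
  proof (intro has_contour_integral_rect_int le continuous_intros)
    show "continuous_on (path_image (rectpath a1 a3)) h"
      by (intro holomorphic_on_imp_continuous_on holomorphic_on_subset[OF h]) auto
  qed (use False in auto)
  ultimately have eq: "rect_int a1 a3 (\<lambda>z. h z / (z - \<xi>)) = 2 * pi * \<i> * winding_number (rectpath a1 a3) \<xi> * h \<xi>"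
    by (rule has_contour_integral_unique[rotated])
  show ?thesis
  proof (cases "\<xi> \<in> cbox a1 a3")
    case True
    then have "\<xi> \<in> box a1 a3" using False by (simp add: path_image_rectpath_cbox_minus_box[OF le])
    then show ?thesis unfolding eq using True by (simp add: winding_number_rectpath norm_mult)
  next
    case False
    then have "winding_number (rectpath a1 a3) \<xi> = 0" by (rule winding_number_rectpath_outside[OF le])
    then show ?thesis unfolding eq by simp
  qed
qed

text \<open>Fubini turns the integral of \<open>g\<close> into integrals over \<open>\<xi>\<close>
  of the contour integral of \<open>h z / (z - \<xi>)\<close>, which Cauchy's formula evaluates: it
  is \<open>2 * pi * \<i> * h \<xi>\<close> inside the rectangle and 0 outside and at the crossings.
  Hence a large integral around the rectangle forces mass inside it. The constant \<open>C\<close>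
  only justifies Fubini, so it may depend on the rectangle in any way.\<close>

lemma rect_pairing_bound:
  assumes \<mu>: "complex_borel_measure \<mu>" and s: "supported_on \<mu> E" and E: "E \<in> sets borel"
    and le: "Re a1 \<le> Re a3" "Im a1 \<le> Im a3" and h: "h holomorphic_on UNIV"
    and C: "\<And>\<xi> z. \<xi> \<in> E \<Longrightarrow> z \<in> path_image (rectpath a1 a3) \<Longrightarrow> cmod (h z) \<le> C * cmod (z - \<xi>)"
    and crossing: "\<And>\<xi>. \<xi> \<in> E \<Longrightarrow> \<xi> \<in> path_image (rectpath a1 a3) \<Longrightarrow>
        \<exists>p. p holomorphic_on UNIV \<and> (\<forall>z. h z / (z - \<xi>) = p z)"
    and B: "\<And>\<xi>. \<xi> \<in> E \<Longrightarrow> \<xi> \<in> cbox a1 a3 \<Longrightarrow> cmod (h \<xi>) \<le> B" "0 \<le> B"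
    and G: "\<And>z. z \<in> path_image (rectpath a1 a3) \<Longrightarrow> g z = h z * cm_integral \<mu> (\<lambda>\<xi>. 1 / (\<xi> - z))"
  shows "cmod (rect_int a1 a3 g) \<le> 2 * pi * B * (\<Sum>j<4. measure (part_measure \<mu> j) (cbox a1 a3))"
proof -
  let ?M = "part_measure \<mu>"
  have fin: "finite_measure (?M j)" for j by (rule finite_part_measure[OF \<mu>])
  have AE: "AE \<xi> in ?M j. \<xi> \<in> E" for j by (rule AE_part_measure[OF \<mu> s E])
  have hc: "continuous_on UNIV h" using h by (rule holomorphic_on_imp_continuous_on)
  define T where "T j z = (\<integral>\<xi>. h z / (z - \<xi>) \<partial>?M j)" for j z
  have gT: "g z = - (\<Sum>j<4. \<i> ^ j * T j z)" if "z \<in> path_image (rectpath a1 a3)" for z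
  proof -
    have "h z * (\<integral>\<xi>. 1 / (\<xi> - z) \<partial>?M j) = - T j z" for j
    proof -
      \<comment> \<open>For \<open>\<xi> = z\<close> both sides are 0, because division by 0 gives
        0.\<close>
      have a: "h z * (1 / (\<xi> - z)) = - (h z / (z - \<xi>))" for \<xi>
        by (cases "\<xi> = z") (simp_all add: divide_simps algebra_simps)
      have "h z * (\<integral>\<xi>. 1 / (\<xi> - z) \<partial>?M j) = (\<integral>\<xi>. h z * (1 / (\<xi> - z)) \<partial>?M j)"
        by (rule integral_mult_right_zero[symmetric])
      then show ?thesis unfolding a T_def by simp
    qed
    then have "h z * (\<i> ^ j * (\<integral>\<xi>. 1 / (\<xi> - z) \<partial>?M j)) = - (\<i> ^ j * T j z)" for j
      by (metis mult.left_commute mult_minus_right)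
    then show ?thesis
      unfolding G[OF that] cm_integral_eq_part_measures sum_distrib_left sum_negf[symmetric] by simp
  qed
  have Cs: "cmod (h z) \<le> C * cmod (z - \<xi>)"
    if "\<xi> \<in> E" "z \<in> closed_segment a b" "closed_segment a b \<subseteq> path_image (rectpath a1 a3)" for \<xi> z a b
    using C that by blast
  have side: "side_int a b g = - (\<Sum>j<4. \<i> ^ j * side_int a b (T j))"
    if sub: "closed_segment a b \<subseteq> path_image (rectpath a1 a3)" for a b
  proof -
    have int: "set_integrable lborel {0..1} (\<lambda>\<tau>. T j (linepath a b \<tau>))" for j
      unfolding T_def
      by (rule side_int_Fubini(2)[OF fin sets_part_measure AE E hc]) (use Cs sub in blast)
    have "side_int a b g = side_int a b (\<lambda>z. - (\<Sum>j<4. \<i> ^ j * T j z))"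
      by (rule side_int_cong) (use gT sub in blast)
    also have "\<dots> = - (\<Sum>j<4. \<i> ^ j * side_int a b (T j))"
      using int unfolding side_int_def sum_lessThan_4 set_integrable_def set_lebesgue_integral_def
      by (simp add: algebra_simps scaleR_conv_of_real)
    finally show ?thesis .
  qed
  note sub = rectpath_sides[OF le]
  have R: "rect_int a1 a3 g = - (\<Sum>j<4. \<i> ^ j * rect_int a1 a3 (T j))"
    unfolding rect_int_def sum_lessThan_4 by (subst (1 2 3 4) side) (auto simp: sub sum_lessThan_4 algebra_simps)
  have bound: "cmod (rect_int a1 a3 (T j)) \<le> 2 * pi * B * measure (?M j) (cbox a1 a3)" for j
  proof -
    interpret M: finite_measure "?M j" by (rule fin)
    let ?k = "\<lambda>\<xi>. h z / (z - \<xi>)"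
    have Fs: "side_int a b (T j) = (\<integral>\<xi>. indicator E \<xi> * side_int a b (\<lambda>z. h z / (z - \<xi>)) \<partial>?M j)"
       "integrable (?M j) (\<lambda>\<xi>. indicator E \<xi> * side_int a b (\<lambda>z. h z / (z - \<xi>)))"
      if "closed_segment a b \<subseteq> path_image (rectpath a1 a3)" for a b
      unfolding T_def
      by (rule side_int_Fubini[OF fin sets_part_measure AE E hc]; use Cs that in blast)+
    have eq: "rect_int a1 a3 (T j) = (\<integral>\<xi>. indicator E \<xi> * rect_int a1 a3 (\<lambda>z. h z / (z - \<xi>)) \<partial>?M j)"
    proof -
      define a2 where "a2 = Complex (Re a3) (Im a1)"
      define a4 where "a4 = Complex (Re a1) (Im a3)"
      have seg: "closed_segment a1 a2 \<subseteq> path_image (rectpath a1 a3)" "closed_segment a2 a3 \<subseteq> path_image (rectpath a1 a3)"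
        "closed_segment a3 a4 \<subseteq> path_image (rectpath a1 a3)" "closed_segment a4 a1 \<subseteq> path_image (rectpath a1 a3)"
        unfolding sub a2_def a4_def by auto
      show ?thesis
        unfolding rect_int_def distrib_left a2_def[symmetric] a4_def[symmetric] seg[THEN Fs(1)]
        using seg[THEN Fs(2)] by simp
    qed
    have "cmod (rect_int a1 a3 (T j)) \<le> (\<integral>\<xi>. 2 * pi * B * indicator (cbox a1 a3) \<xi> \<partial>?M j)"
      unfolding eq
    proof (rule Bochner_Integration.integral_norm_bound_integral)
      show "integrable (?M j) (\<lambda>\<xi>. indicator E \<xi> * rect_int a1 a3 (\<lambda>z. h z / (z - \<xi>)))"
        unfolding rect_int_def distrib_left
        by (intro Bochner_Integration.integrable_add Fs(2)) (auto simp: sub)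
      show "integrable (?M j) (\<lambda>\<xi>. 2 * pi * B * indicator (cbox a1 a3) \<xi> :: real)"
        by (intro integrable_mult_right integrable_real_indicator) (auto simp: M.emeasure_finite less_top[symmetric])
      fix \<xi>
      show "norm (indicator E \<xi> * rect_int a1 a3 (\<lambda>z. h z / (z - \<xi>))) \<le> 2 * pi * B * indicator (cbox a1 a3) \<xi>"
      proof (cases "\<xi> \<in> E")
        case True
        have "cmod (rect_int a1 a3 (\<lambda>z. h z / (z - \<xi>))) \<le> 2 * pi * cmod (h \<xi>) * indicator (cbox a1 a3) \<xi>"
          by (rule rect_int_kernel[OF le h crossing[OF True]])
        also have "\<dots> \<le> 2 * pi * B * indicator (cbox a1 a3) \<xi>"
          using B(1)[OF True] by (auto simp: indicator_def)
        finally show ?thesis using True by simp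
      qed (use B(2) in auto)
    qed
    then show ?thesis by simp
  qed
  have "cmod (rect_int a1 a3 g) \<le> (\<Sum>j<4. cmod (\<i> ^ j * rect_int a1 a3 (T j)))"
    unfolding R by (simp add: norm_sum)
  also have "\<dots> \<le> (\<Sum>j<4. 2 * pi * B * measure (?M j) (cbox a1 a3))"
    by (intro sum_mono) (use bound in \<open>simp add: norm_mult norm_power\<close>)
  finally show ?thesis by (simp add: sum_distrib_left)
qed

section \<open>Teeth of the wave\<close>

text \<open>The positive solution of \<open>1 / x^8 = u\<close>, so that the phase of the wave at
  \<open>node u\<close> is \<open>pi * u\<close>.\<close>

definition node :: "real \<Rightarrow> real" where "node u = u powr (-1/8)"
text \<open>Tooth \<open>m\<close> is the descending half-wave from the peak at phase
  \<open>(2m + 1/2) * pi\<close> on the left to the valley at phase \<open>(2m - 1/2) * pi\<close>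
  on the right. Its height parameter is half of the smaller of the two extreme values, the one on
  the left.\<close>

definition tooth_left :: "nat \<Rightarrow> real" where "tooth_left m = node (2 * real m + 1/2)"
definition tooth_right :: "nat \<Rightarrow> real" where "tooth_right m = node (2 * real m - 1/2)"
definition tooth_height :: "nat \<Rightarrow> real" where "tooth_height m = tooth_left m ^ 7 / 2"

lemma node_pos: "0 < u \<Longrightarrow> 0 < node u"
  by (simp add: node_def)

lemma node_pow_8:
  assumes "0 < u" shows "node u ^ 8 = 1 / u"
proof -
  have "node u ^ 8 = (u powr (-1/8)) powr (real 8)"
    unfolding node_def by (rule powr_realpow[symmetric]) (use assms in simp)
  also have "\<dots> = u powr (- 1)" unfolding powr_powr by simp
  also have "\<dots> = 1 / u" using assms by (simp add: powr_minus_divide)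
  finally show ?thesis .
qed

lemma node_antimono: "0 < u \<Longrightarrow> u < v \<Longrightarrow> node v < node u"
  unfolding node_def by (rule powr_less_mono2_neg) auto

lemma node_le_1: "1 \<le> u \<Longrightarrow> node u \<le> 1"
  using powr_mono2'[of "-1/8" 1 u] by (simp add: node_def)

lemma wig_node: "0 < u \<Longrightarrow> wig (node u) = node u ^ 7 * sin (pi * u)"
  by (simp add: wig_def node_pow_8)

lemma sin_pi_shift: "sin (pi * (2 * real m + s)) = sin (pi * s)"
  and cos_pi_shift: "cos (pi * (2 * real m + s)) = cos (pi * s)"
proof -
  have e: "pi * (2 * real m + s) = 2 * real m * pi + pi * s" by (simp add: algebra_simps)
  show "sin (pi * (2 * real m + s)) = sin (pi * s)" "cos (pi * (2 * real m + s)) = cos (pi * s)"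
    unfolding e sin_add cos_add sin_2npi cos_2npi by simp_all
qed

context
  fixes m :: nat
  assumes m: "1 \<le> m"
begin

lemma tooth_bounds:
  "0 < tooth_left m" "tooth_left m < tooth_right m" "tooth_right m \<le> 1" "0 < tooth_height m"
  "wig (tooth_left m) = tooth_left m ^ 7" "wig (tooth_right m) = - (tooth_right m ^ 7)"
proof -
  have "1 \<le> real m" using m by simp
  then have p: "1 \<le> 2 * real m - 1/2" by linarith
  show "0 < tooth_left m" unfolding tooth_left_def by (intro node_pos) auto
  then show "0 < tooth_height m" unfolding tooth_height_def by simp
  show "tooth_left m < tooth_right m"
    unfolding tooth_left_def tooth_right_def using p by (intro node_antimono) auto
  show "tooth_right m \<le> 1" unfolding tooth_right_def using p by (rule node_le_1)
  show "wig (tooth_left m) = tooth_left m ^ 7"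
    using sin_pi_shift[of m "1/2"] by (simp add: tooth_left_def wig_node)
  show "wig (tooth_right m) = - (tooth_right m ^ 7)"
    using sin_pi_shift[of m "-1/2"] p by (simp add: tooth_right_def wig_node)
qed

text \<open>At a phase offset of at least 1/6 the sine is at least
  \<open>sin (pi / 6) = 1/2\<close>, so \<open>|wig t| \<ge> t^7 / 2\<close>. This exceeds
  \<open>tooth_height m\<close> except for equality at the left end, where the wave is in fact twice
  as high.\<close>

lemma tooth_crossing:
  assumes t: "tooth_left m \<le> t" "t \<le> tooth_right m" and w: "\<bar>wig t\<bar> \<le> tooth_height m"
  shows "\<bar>1 / t ^ 8 - 2 * real m\<bar> < 1/6"
proof (rule ccontr)
  note b = tooth_bounds
  have t0: "0 < t" using t(1) b(1) by linarith
  have rm: "1 \<le> real m" using m by simp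
  define s where "s = 1 / t ^ 8 - 2 * real m"
  assume "\<not> ?thesis"
  then have s1: "1/6 \<le> \<bar>s\<bar>" by (simp add: s_def)
  have "tooth_left m ^ 8 \<le> t ^ 8" "t ^ 8 \<le> tooth_right m ^ 8"
    using t t0 b by (auto intro!: power_mono)
  then have "1 / (2 * real m + 1/2) \<le> t ^ 8" "t ^ 8 \<le> 1 / (2 * real m - 1/2)"
    using rm by (simp_all add: tooth_left_def tooth_right_def node_pow_8)
  then have "1 / t ^ 8 \<le> 2 * real m + 1/2" "2 * real m - 1/2 \<le> 1 / t ^ 8"
    using t0 rm by (simp_all add: field_simps)
  then have s2: "\<bar>s\<bar> \<le> 1/2" unfolding s_def by (intro abs_leI; linarith)
  have "\<bar>sin (pi * s)\<bar> = sin (pi * \<bar>s\<bar>)"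
  proof (cases "0 \<le> s")
    case True
    then have "0 \<le> sin (pi * s)" using s2 by (intro sin_ge_zero) auto
    then show ?thesis using True by simp
  next
    case False
    have "0 \<le> sin (pi * - s)"
    proof (rule sin_ge_zero)
      show "0 \<le> pi * - s" using False by (intro mult_nonneg_nonneg) auto
      show "pi * - s \<le> pi" using mult_left_mono[of "- s" 1 pi] s2 by simp
    qed
    then show ?thesis using False by simp
  qed
  moreover have "sin (pi / 6) \<le> sin (pi * \<bar>s\<bar>)"
    using s1 s2 by (intro sin_monotone_2pi_le) (auto simp: field_simps)
  ultimately have sn: "1/2 \<le> \<bar>sin (pi * s)\<bar>" by (simp add: sin_30)
  have "wig t = t ^ 7 * sin (pi * (2 * real m + s))"
    using t0 by (simp add: wig_def s_def)
  then have "\<bar>wig t\<bar> = t ^ 7 * \<bar>sin (pi * s)\<bar>"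
    using t0 by (simp add: sin_pi_shift abs_mult)
  then have ge: "t ^ 7 / 2 \<le> \<bar>wig t\<bar>"
    using sn t0 mult_left_mono[OF sn, of "t ^ 7"] by simp
  show False
  proof (cases "t = tooth_left m")
    case True
    then show False using w b by (simp add: tooth_height_def)
  next
    case False
    then have "tooth_left m ^ 7 < t ^ 7" using t b by (intro power_strict_mono) auto
    then show False using w ge by (simp add: tooth_height_def)
  qed
qed

text \<open>In this phase range the cosine is at least 4/5, so the derivative is at most
  \<open>7 - 8 * 3 * 4/5 < -1\<close>. Thus vertical distances along the tooth control horizontal
  ones.\<close>

lemma tooth_steep:
  assumes s: "0 < s" "\<bar>1 / s ^ 8 - 2 * real m\<bar> \<le> 1/6" and t: "t \<le> 1" "\<bar>1 / t ^ 8 - 2 * real m\<bar> \<le> 1/6"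
    and st: "s \<le> t"
  shows "t - s \<le> wig s - wig t"
proof (cases "s = t")
  case False
  then have "s < t" using st by simp
  moreover have "(wig has_real_derivative dwig x) (at x)" if "s \<le> x" for x
    using that s by (intro DERIV_wig) auto
  ultimately obtain z where z: "s < z" "z < t" "wig t - wig s = (t - s) * dwig z"
    using MVT2[of s t wig dwig] by auto
  have z0: "0 < z" using z s by linarith
  have "1 / z ^ 8 \<le> 1 / s ^ 8" "1 / t ^ 8 \<le> 1 / z ^ 8"
    using z s z0 by (auto intro!: divide_left_mono power_mono mult_pos_pos)
  define r where "r = 1 / z ^ 8 - 2 * real m"
  have r: "\<bar>r\<bar> \<le> 1/6"
    using s t \<open>1 / z ^ 8 \<le> 1 / s ^ 8\<close> \<open>1 / t ^ 8 \<le> 1 / z ^ 8\<close> unfolding r_def by linarith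
  have "cos (pi / 6) \<le> cos \<bar>pi * r\<bar>"
    using r by (intro cos_monotone_0_pi_le) (auto simp: abs_mult field_simps)
  moreover have "8/5 \<le> sqrt 3" by (rule real_le_rsqrt) (simp add: power2_eq_square)
  ultimately have c: "4/5 \<le> cos (pi * r)" by (simp add: cos_30)
  have dw: "dwig z = 7 * z ^ 6 * sin (pi * r) - 8 * pi * cos (pi * r) / z\<^sup>2"
    using sin_pi_shift[of m r] cos_pi_shift[of m r] by (simp add: dwig_def r_def)
  have z6: "z ^ 6 \<le> 1" "z\<^sup>2 \<le> 1" using z z0 t by (auto intro!: power_le_one)
  have "7 * z ^ 6 * sin (pi * r) \<le> 7 * 1 * 1"
  proof -
    have "7 * z ^ 6 * sin (pi * r) \<le> 7 * z ^ 6 * 1" using z0 by (intro mult_left_mono) auto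
    then show ?thesis using z6 by linarith
  qed
  moreover have "8 * 3 * (4/5) / 1 \<le> 8 * pi * cos (pi * r) / z\<^sup>2"
    using c z0 z6 pi_gt3 by (intro frac_le mult_mono) auto
  ultimately have "dwig z \<le> -1" unfolding dw by linarith
  then have "(t - s) * dwig z \<le> (t - s) * -1" using st by (intro mult_left_mono) auto
  then show ?thesis using z by simp
qed simp

lemma tooth_levels:
  obtains a b where "tooth_left m \<le> a" "a \<le> tooth_right m" "wig a = - tooth_height m"
    "tooth_left m \<le> b" "b \<le> tooth_right m" "wig b = tooth_height m"
proof -
  note b = tooth_bounds
  have "tooth_left m ^ 7 \<le> tooth_right m ^ 7" using b by (intro power_mono) auto
  then have r: "wig (tooth_right m) \<le> - tooth_height m" "- tooth_height m \<le> wig (tooth_left m)"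
     "wig (tooth_right m) \<le> tooth_height m" "tooth_height m \<le> wig (tooth_left m)"
    using zero_less_power[OF b(1), of 7] unfolding b(5,6) tooth_height_def by linarith+
  have c: "continuous_on {tooth_left m..tooth_right m} wig"
    by (intro continuous_on_wig continuous_on_id)
  show thesis
    using IVT2'[OF r(1,2) _ c] IVT2'[OF r(3,4) _ c] b that by auto
qed

lemma tooth_steep_abs:
  assumes s: "tooth_left m \<le> s" "s \<le> tooth_right m" "\<bar>wig s\<bar> \<le> tooth_height m"
    and t: "0 < t" "t \<le> 1" "\<bar>1 / t ^ 8 - 2 * real m\<bar> \<le> 1/6"
  shows "\<bar>s - t\<bar> \<le> \<bar>wig s - wig t\<bar>"
proof -
  note b = tooth_bounds
  have "0 < s" "s \<le> 1" using s b by linarith+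
  moreover have "\<bar>1 / s ^ 8 - 2 * real m\<bar> \<le> 1/6" using tooth_crossing[OF s] by simp
  ultimately show ?thesis
    using tooth_steep[of s t] tooth_steep[of t s] t by (cases "s \<le> t") auto
qed

text \<open>Inside the rectangle the wave stays off the two vertical sides; it can enter and leave
  only through top and bottom.\<close>

lemma tooth_mem_cbox:
  assumes "\<xi> \<in> wave" "\<xi> \<in> cbox (Complex (tooth_left m) (- tooth_height m)) (Complex (tooth_right m) (tooth_height m))"
  shows "tooth_left m < Re \<xi>" "Re \<xi> < tooth_right m" "Im \<xi> = wig (Re \<xi>)"
    "\<bar>wig (Re \<xi>)\<bar> \<le> tooth_height m" "\<bar>1 / Re \<xi> ^ 8 - 2 * real m\<bar> < 1/6"
proof -
  note b = tooth_bounds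
  have rm: "1 \<le> real m" using m by simp
  show w: "Im \<xi> = wig (Re \<xi>)" using assms by (simp add: mem_wave)
  have le: "tooth_left m \<le> Re \<xi>" "Re \<xi> \<le> tooth_right m" and wl: "\<bar>wig (Re \<xi>)\<bar> \<le> tooth_height m"
    using assms w by (auto simp: in_cbox_complex_iff)
  show "\<bar>wig (Re \<xi>)\<bar> \<le> tooth_height m" by fact
  show c: "\<bar>1 / Re \<xi> ^ 8 - 2 * real m\<bar> < 1/6" by (rule tooth_crossing[OF le wl])
  have "1 / tooth_left m ^ 8 - 2 * real m = 1/2" "1 / tooth_right m ^ 8 - 2 * real m = - 1/2"
    using rm by (simp_all add: tooth_left_def tooth_right_def node_pow_8)
  then have "Re \<xi> \<noteq> tooth_left m" "Re \<xi> \<noteq> tooth_right m" using c by auto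
  then show "tooth_left m < Re \<xi>" "Re \<xi> < tooth_right m" using le by auto
qed

text \<open>If \<open>\<xi>\<close> lies outside the steep middle of the tooth, or \<open>z\<close>
  on a vertical side, then \<open>|z - \<xi>|\<close> is bounded below. If \<open>z\<close> is on
  the bottom or the top, steepness bounds the distance from \<open>z\<close> to the crossing on that
  side by \<open>2 * |z - \<xi>|\<close>, and one factor of the polynomial does the work.\<close>

lemma tooth_kernel_bound:
  assumes a: "tooth_left m \<le> a" "a \<le> tooth_right m" "wig a = - tooth_height m"
    and b: "tooth_left m \<le> b" "b \<le> tooth_right m" "wig b = tooth_height m"
  defines "a1 \<equiv> Complex (tooth_left m) (- tooth_height m)" and "a3 \<equiv> Complex (tooth_right m) (tooth_height m)"
  obtains C where "\<And>\<xi> z. \<xi> \<in> wave \<Longrightarrow> z \<in> path_image (rectpath a1 a3) \<Longrightarrow>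
     cmod (((z - gam a) * (z - gam b))\<^sup>2) \<le> C * cmod (z - \<xi>)"
proof -
  note tb = tooth_bounds
  have rm: "1 \<le> real m" using m by simp
  have Y1: "tooth_height m \<le> 1/2"
    using tb power_le_one[of "tooth_left m" 7] by (simp add: tooth_height_def)
  have pim: "path_image (rectpath a1 a3) = {z. Re z \<in> {tooth_left m, tooth_right m} \<and> Im z \<in> {- tooth_height m..tooth_height m}} \<union>
       {z. Im z \<in> {- tooth_height m, tooth_height m} \<and> Re z \<in> {tooth_left m..tooth_right m}}"
    using tb by (subst path_image_rectpath) (auto simp: a1_def a3_def)
  have sub: "path_image (rectpath a1 a3) \<subseteq> cbox a1 a3"
    using tb by (intro path_image_rectpath_subset_cbox) (auto simp: a1_def a3_def)
  have dist3: "cmod (z - gam s) \<le> 3" if "z \<in> path_image (rectpath a1 a3)" "\<bar>wig s\<bar> \<le> tooth_height m"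
    "tooth_left m \<le> s" "s \<le> tooth_right m" for z s
  proof -
    have "cmod (z - gam s) \<le> \<bar>Re z - s\<bar> + \<bar>Im z - wig s\<bar>"
      using cmod_le[of "z - gam s"] by simp
    also have "\<dots> \<le> 1 + 1"
      using that Y1 tb unfolding pim by (intro add_mono) (auto simp: abs_le_iff)
    finally show ?thesis by simp
  qed
  \<comment> \<open>The points at phases 2m + 1/6 and 2m - 1/6 delimit the steep middle.\<close>
  define x1 where "x1 = node (2 * real m + 1/6)"
  define x2 where "x2 = node (2 * real m - 1/6)"
  have x12: "0 < x1" "tooth_left m < x1" "x2 < tooth_right m" "x2 \<le> 1" "0 < x2" "x1 \<le> 1"
    unfolding x1_def x2_def tooth_left_def tooth_right_def using rm
    by (auto intro!: node_pos node_antimono node_le_1)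
  have x8: "1 / x1 ^ 8 = 2 * real m + 1/6" "1 / x2 ^ 8 = 2 * real m - 1/6"
    unfolding x1_def x2_def using rm by (simp_all add: node_pow_8)
  have zone: "\<bar>1 / t ^ 8 - 2 * real m\<bar> \<le> 1/6" if "x1 \<le> t" "t \<le> x2" for t
  proof -
    have "0 < t" using that x12 by linarith
    then have "1 / t ^ 8 \<le> 1 / x1 ^ 8" "1 / x2 ^ 8 \<le> 1 / t ^ 8"
      using that x12 by (auto intro!: divide_left_mono power_mono mult_pos_pos)
    then show ?thesis using x8 by (intro abs_leI; linarith)
  qed
  \<comment> \<open>The rest of the wave: a compact set disjoint from the contour, hence at positive
    distance from it.\<close>
  define E' where "E' = gam ` ({-1..x1} \<union> {x2..1})"
  have "compact E'"
    unfolding E'_def by (intro compact_continuous_image continuous_on_gam compact_Un compact_Icc)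
  moreover have "closed (path_image (rectpath a1 a3))"
    by (intro compact_imp_closed compact_path_image) simp
  moreover have "E' \<inter> path_image (rectpath a1 a3) = {}"
  proof (rule ccontr)
    assume "E' \<inter> path_image (rectpath a1 a3) \<noteq> {}"
    then obtain t where t: "t \<in> {-1..x1} \<union> {x2..1}" "gam t \<in> cbox a1 a3" using sub unfolding E'_def by blast
    have "- 1 \<le> t" "t \<le> 1"
      using t(1) x12 by (simp_all only: Un_iff atLeastAtMost_iff; linarith)+
    then have "gam t \<in> wave" by (simp add: mem_wave abs_le_iff)
    from tooth_mem_cbox[OF this t(2)[unfolded a1_def a3_def]]
    have c: "\<bar>1 / t ^ 8 - 2 * real m\<bar> < 1/6" and tl: "tooth_left m < t" by auto
    have t0: "0 < t" using tl tb by linarith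
    from t(1) show False
    proof
      assume "t \<in> {-1..x1}"
      then have "1 / x1 ^ 8 \<le> 1 / t ^ 8"
        using t0 by (auto intro!: divide_left_mono power_mono mult_pos_pos)
      then show False using c x8 by simp
    next
      assume "t \<in> {x2..1}"
      then have "1 / t ^ 8 \<le> 1 / x2 ^ 8"
        using t0 x12 by (auto intro!: divide_left_mono power_mono mult_pos_pos)
      then show False using c x8 by simp
    qed
  qed
  ultimately obtain d1 where d1: "d1 > 0" "\<And>x y. x \<in> E' \<Longrightarrow> y \<in> path_image (rectpath a1 a3) \<Longrightarrow> d1 \<le> dist x y"
    using separate_compact_closed[of E' "path_image (rectpath a1 a3)"] by blast
  define d where "d = min d1 (min (x1 - tooth_left m) (tooth_right m - x2))"
  have d: "0 < d" using d1 x12 by (simp add: d_def)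
  show thesis
  proof (rule that)
    fix \<xi> z assume \<xi>: "\<xi> \<in> wave" and z: "z \<in> path_image (rectpath a1 a3)"
    have za: "cmod (z - gam a) \<le> 3" using a tb by (intro dist3 z) auto
    have zb: "cmod (z - gam b) \<le> 3" using b tb by (intro dist3 z) auto
    have hz: "cmod (((z - gam a) * (z - gam b))\<^sup>2) = cmod (z - gam a) * cmod (z - gam a) * (cmod (z - gam b) * cmod (z - gam b))"
      by (simp add: norm_mult norm_power power2_eq_square)
    have h81: "cmod (((z - gam a) * (z - gam b))\<^sup>2) \<le> 3 * 3 * (3 * 3)"
      unfolding hz using za zb by (intro mult_mono) auto
    have far: "cmod (((z - gam a) * (z - gam b))\<^sup>2) \<le> (54 + 81 / d) * cmod (z - \<xi>)" if "d \<le> cmod (z - \<xi>)"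
    proof -
      have "81 = 81 / d * d" using d by simp
      also have "\<dots> \<le> 81 / d * cmod (z - \<xi>)" using that d by (intro mult_left_mono) auto
      also have "\<dots> \<le> (54 + 81 / d) * cmod (z - \<xi>)" by (intro mult_right_mono) auto
      finally show ?thesis using h81 by linarith
    qed
    have near: "cmod (((z - gam a) * (z - gam b))\<^sup>2) \<le> (54 + 81 / d) * cmod (z - \<xi>)"
      if "cmod (z - gam a) \<le> 2 * cmod (z - \<xi>) \<or> cmod (z - gam b) \<le> 2 * cmod (z - \<xi>)"
    proof -
      have "cmod (((z - gam a) * (z - gam b))\<^sup>2) \<le> 54 * cmod (z - \<xi>)"
        using that
      proof
        assume *: "cmod (z - gam a) \<le> 2 * cmod (z - \<xi>)"
        have "cmod (((z - gam a) * (z - gam b))\<^sup>2) \<le> (2 * cmod (z - \<xi>)) * 3 * (3 * 3)"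
          unfolding hz using za zb * by (intro mult_mono) auto
        then show ?thesis by simp
      next
        assume *: "cmod (z - gam b) \<le> 2 * cmod (z - \<xi>)"
        have "cmod (((z - gam a) * (z - gam b))\<^sup>2) \<le> 3 * 3 * ((2 * cmod (z - \<xi>)) * 3)"
          unfolding hz using za zb * by (intro mult_mono) auto
        then show ?thesis by simp
      qed
      also have "\<dots> \<le> (54 + 81 / d) * cmod (z - \<xi>)" using d by (intro mult_right_mono) auto
      finally show ?thesis .
    qed
    show "cmod (((z - gam a) * (z - gam b))\<^sup>2) \<le> (54 + 81 / d) * cmod (z - \<xi>)"
    proof (cases "x1 \<le> Re \<xi> \<and> Re \<xi> \<le> x2")
      case False
      then have "\<xi> \<in> E'"
        using \<xi> unfolding E'_def by (intro image_eqI[of _ _ "Re \<xi>"]) (auto simp: mem_wave complex_eq_iff)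
      then have "d1 \<le> cmod (z - \<xi>)" using d1(2)[OF _ z, of \<xi>] by (simp add: dist_norm norm_minus_commute)
      then show ?thesis by (intro far) (simp add: d_def)
    next
      case True
      define t where "t = Re \<xi>"
      have t: "0 < t" "t \<le> 1" "\<bar>1 / t ^ 8 - 2 * real m\<bar> \<le> 1/6" "Im \<xi> = wig t"
        using True x12 zone \<xi> by (auto simp: t_def mem_wave)
      have re: "\<bar>Re z - t\<bar> \<le> cmod (z - \<xi>)" and im: "\<bar>Im z - wig t\<bar> \<le> cmod (z - \<xi>)"
        using abs_Re_le_cmod[of "z - \<xi>"] abs_Im_le_cmod[of "z - \<xi>"] t(4) by (simp_all add: t_def)
      consider "Re z = tooth_left m" | "Re z = tooth_right m" | "Im z = - tooth_height m" | "Im z = tooth_height m"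
        using z unfolding pim by auto
      then show ?thesis
      proof cases
        case 1
        then show ?thesis using True re by (intro far) (auto simp: d_def t_def)
      next
        case 2
        then show ?thesis using True re by (intro far) (auto simp: d_def t_def)
      next
        case 3
        have "\<bar>a - t\<bar> \<le> \<bar>wig a - wig t\<bar>" using a tb t by (intro tooth_steep_abs) auto
        then have "\<bar>Re z - a\<bar> \<le> 2 * cmod (z - \<xi>)" using re im 3 a by linarith
        moreover have "z - gam a = of_real (Re z - a)" using 3 a by (simp add: complex_eq_iff)
        ultimately show ?thesis by (intro near) (simp only: norm_of_real simp_thms)
      next
        case 4
        have "\<bar>b - t\<bar> \<le> \<bar>wig b - wig t\<bar>" using b tb t by (intro tooth_steep_abs) auto
        then have "\<bar>Re z - b\<bar> \<le> 2 * cmod (z - \<xi>)" using re im 4 b by linarith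
        moreover have "z - gam b = of_real (Re z - b)" using 4 b by (simp add: complex_eq_iff)
        ultimately show ?thesis by (intro near) (simp only: norm_of_real simp_thms)
      qed
    qed
  qed
qed

end

section \<open>The Ahlfors function is not a Cauchy transform\<close>

lemma side_int_bound:
  assumes B: "\<And>z. z \<in> closed_segment a b \<Longrightarrow> cmod (\<phi> z) \<le> B" "0 \<le> B"
  shows "cmod (side_int a b \<phi>) \<le> cmod (b - a) * B"
proof -
  have "cmod (LINT \<tau>:{0..1}|lborel. \<phi> (linepath a b \<tau>)) \<le> (\<integral>\<tau>. B * indicator {0..1::real} \<tau> \<partial>lborel)"
    unfolding set_lebesgue_integral_def
  \<comment> \<open>A function that is not integrable has integral 0 by convention, which satisfies
    the bound as well.\<close>
  proof (cases "integrable lborel (\<lambda>\<tau>. indicator {0..1::real} \<tau> *\<^sub>R \<phi> (linepath a b \<tau>))")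
    case True
    then show "cmod (\<integral>\<tau>. indicator {0..1::real} \<tau> *\<^sub>R \<phi> (linepath a b \<tau>) \<partial>lborel)
      \<le> (\<integral>\<tau>. B * indicator {0..1::real} \<tau> \<partial>lborel)"
    proof (rule Bochner_Integration.integral_norm_bound_integral)
      show "integrable lborel (\<lambda>\<tau>. B * indicator {0..1::real} \<tau>)"
        by (intro integrable_mult_right integrable_real_indicator) auto
    qed (use B in \<open>auto simp: indicator_def linepath_in_path\<close>)
  qed (use B in \<open>auto simp: not_integrable_integral_eq\<close>)
  then have "cmod (LINT \<tau>:{0..1}|lborel. \<phi> (linepath a b \<tau>)) \<le> B" by simp
  then show ?thesis unfolding side_int_def norm_mult by (intro mult_left_mono) auto
qed

lemma side_int_approx:
  assumes \<phi>: "continuous_on (closed_segment a b) \<phi>" and \<psi>: "continuous_on {0..1} \<psi>"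
    and e: "\<And>\<tau>. 0 \<le> \<tau> \<Longrightarrow> \<tau> \<le> 1 \<Longrightarrow> cmod (\<phi> (linepath a b \<tau>) - \<psi> \<tau>) \<le> e" "0 \<le> e"
  shows "cmod (side_int a b \<phi> - (b - a) * (LINT \<tau>:{0..1}|lborel. \<psi> \<tau>)) \<le> cmod (b - a) * e"
proof -
  have "continuous_on {0..1} (\<lambda>\<tau>. \<phi> (linepath a b \<tau>))"
    by (rule continuous_on_compose2[OF \<phi> continuous_on_linepath]) (auto simp: linepath_in_path)
  then have i: "set_integrable lborel {0..1} (\<lambda>\<tau>. \<phi> (linepath a b \<tau>))" "set_integrable lborel {0..1} \<psi>"
    using \<psi> by (auto intro: borel_integrable_atLeastAtMost')
  have "cmod (LINT \<tau>:{0..1}|lborel. \<phi> (linepath a b \<tau>) - \<psi> \<tau>) \<le> (\<integral>\<tau>. e * indicator {0..1::real} \<tau> \<partial>lborel)"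
    unfolding set_lebesgue_integral_def
  proof (rule Bochner_Integration.integral_norm_bound_integral)
    show "integrable lborel (\<lambda>\<tau>. indicator {0..1::real} \<tau> *\<^sub>R (\<phi> (linepath a b \<tau>) - \<psi> \<tau>))"
      using set_integral_diff(1)[OF i] by (simp only: set_integrable_def)
    show "integrable lborel (\<lambda>\<tau>. e * indicator {0..1::real} \<tau>)"
      by (intro integrable_mult_right integrable_real_indicator) auto
  qed (use e in \<open>auto simp: indicator_def\<close>)
  then have "cmod ((LINT \<tau>:{0..1}|lborel. \<phi> (linepath a b \<tau>)) - (LINT \<tau>:{0..1}|lborel. \<psi> \<tau>)) \<le> e"
    by (simp add: set_integral_diff(2)[OF i])
  then show ?thesis
    unfolding side_int_def right_diff_distrib[symmetric] norm_mult by (intro mult_left_mono) auto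
qed

text \<open>Up to the factor \<open>c\<close>, the mean of \<open>(Y^2 - y^2)^2\<close> over the
  interval from \<open>-Y\<close> to \<open>Y\<close>, parametrized by
  \<open>y = Y * (2 * \<tau> - 1)\<close>: \<open>16 * (1/3 - 1/2 + 1/5) = 8/15\<close>.\<close>

lemma set_integral_quartic:
  fixes c :: complex and Y :: real
  shows "(LINT \<tau>:{0..1}|lborel. c * of_real ((Y\<^sup>2 - (Y * (2 * \<tau> - 1))\<^sup>2)\<^sup>2)) = c * of_real (8 / 15 * Y ^ 4)"
proof -
  have eq: "(Y\<^sup>2 - (Y * (2 * \<tau> - 1))\<^sup>2)\<^sup>2 = 16 * Y ^ 4 * (\<tau>\<^sup>2 - 2 * \<tau> ^ 3 + \<tau> ^ 4)" for \<tau> :: real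
    by (simp add: power2_eq_square power3_eq_cube power4_eq_xxxx algebra_simps)
  have "((\<lambda>\<tau>. 16 * Y ^ 4 * (\<tau>\<^sup>2 - 2 * \<tau> ^ 3 + \<tau> ^ 4)) has_integral
     (16 * Y ^ 4 * (1 ^ 3 / 3 - 1 ^ 4 / 2 + 1 ^ 5 / 5) - 16 * Y ^ 4 * (0 ^ 3 / 3 - 0 ^ 4 / 2 + 0 ^ 5 / 5))) {0..1::real}"
    by (rule fundamental_theorem_of_calculus)
       (auto intro!: derivative_eq_intros simp flip: has_real_derivative_iff_has_vector_derivative)
  then have "integral {0..1} (\<lambda>\<tau>. (Y\<^sup>2 - (Y * (2 * \<tau> - 1))\<^sup>2)\<^sup>2) = 8 / 15 * Y ^ 4"
    unfolding eq by (subst integral_unique) auto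
  moreover have "set_integrable lborel {0..1} (\<lambda>\<tau>. (Y\<^sup>2 - (Y * (2 * \<tau> - 1))\<^sup>2)\<^sup>2)"
    by (intro borel_integrable_atLeastAtMost' continuous_intros)
  ultimately have "(LINT \<tau>:{0..1}|lborel. (Y\<^sup>2 - (Y * (2 * \<tau> - 1))\<^sup>2)\<^sup>2) = 8 / 15 * Y ^ 4"
    by (simp only: set_borel_integral_eq_integral)
  then show ?thesis by (simp only: set_integral_mult_right set_integral_complex_of_real)
qed

text \<open>With \<open>p = q = 0\<close> the product would be exactly \<open>Y^2 - y^2\<close>.
  Hence on the vertical sides of a thin rectangle the quartic is almost real and nonnegative, and
  nothing cancels in the integral. The product is off by at most \<open>5 * X * Y\<close>, which
  gives 35 = 5 * 7 and 36 = 6^2 after squaring.\<close>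

lemma quartic_near_side:
  assumes X: "0 \<le> X" "X \<le> Y" and p: "\<bar>p\<bar> \<le> X" "\<bar>q\<bar> \<le> X" and y: "\<bar>y\<bar> \<le> Y"
  shows "cmod ((Complex p (y + Y) * Complex q (y - Y))\<^sup>2 - of_real ((Y\<^sup>2 - y\<^sup>2)\<^sup>2)) \<le> 35 * X * Y ^ 3"
    and "cmod ((Complex p (y + Y) * Complex q (y - Y))\<^sup>2) \<le> 36 * Y ^ 4"
proof -
  have Y: "0 \<le> Y" using X by linarith
  define P where "P = Complex p (y + Y) * Complex q (y - Y)"
  define D where "D = P - of_real (Y\<^sup>2 - y\<^sup>2)"
  have "D = Complex (p * q) (p * (y - Y) + q * (y + Y))"
    unfolding D_def P_def by (simp add: complex_eq_iff power2_eq_square algebra_simps)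
  then have "cmod D \<le> \<bar>p * q\<bar> + \<bar>p * (y - Y) + q * (y + Y)\<bar>"
    using cmod_le[of D] by simp
  also have "\<dots> \<le> X * Y + (X * (2 * Y) + X * (2 * Y))"
  proof (intro add_mono order_trans[OF abs_triangle_ineq])
    show "\<bar>p * q\<bar> \<le> X * Y" unfolding abs_mult using p X by (intro mult_mono) auto
    show "\<bar>p * (y - Y)\<bar> \<le> X * (2 * Y)" unfolding abs_mult using p X y by (intro mult_mono) auto
    show "\<bar>q * (y + Y)\<bar> \<le> X * (2 * Y)" unfolding abs_mult using p X y by (intro mult_mono) auto
  qed
  finally have D: "cmod D \<le> 5 * X * Y" by simp
  have "y\<^sup>2 \<le> Y\<^sup>2" using y by (simp add: abs_le_square_iff[symmetric])
  then have w: "0 \<le> Y\<^sup>2 - y\<^sup>2" "Y\<^sup>2 - y\<^sup>2 \<le> Y\<^sup>2" by auto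
  have wn: "cmod (of_real (Y\<^sup>2 - y\<^sup>2)) \<le> Y\<^sup>2" using w by (simp only: norm_of_real)
  have XY: "5 * X * Y \<le> 5 * Y\<^sup>2" using X Y by (simp add: power2_eq_square mult_right_mono)
  have Ps: "P = of_real (Y\<^sup>2 - y\<^sup>2) + D" by (simp add: D_def)
  have s: "P\<^sup>2 - of_real ((Y\<^sup>2 - y\<^sup>2)\<^sup>2) = D * (2 * of_real (Y\<^sup>2 - y\<^sup>2) + D)"
    unfolding Ps of_real_power by (simp add: power2_eq_square algebra_simps)
  have "cmod (2 * of_real (Y\<^sup>2 - y\<^sup>2) + D) \<le> cmod (2 * of_real (Y\<^sup>2 - y\<^sup>2)) + cmod D"
    by (rule norm_triangle_ineq)
  also have "\<dots> \<le> 2 * Y\<^sup>2 + 5 * Y\<^sup>2"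
    using wn D XY by (intro add_mono) (auto simp only: norm_mult norm_numeral)
  finally have "cmod D * cmod (2 * of_real (Y\<^sup>2 - y\<^sup>2) + D) \<le> (5 * X * Y) * (7 * Y\<^sup>2)"
    using D X Y by (intro mult_mono) auto
  then show "cmod (P\<^sup>2 - of_real ((Y\<^sup>2 - y\<^sup>2)\<^sup>2)) \<le> 35 * X * Y ^ 3"
    unfolding s norm_mult by (simp add: power2_eq_square power3_eq_cube mult_ac)
  have "cmod P \<le> Y\<^sup>2 + 5 * Y\<^sup>2"
    unfolding Ps using norm_triangle_ineq[of "of_real (Y\<^sup>2 - y\<^sup>2)" D] wn D XY by linarith
  then have "(cmod P)\<^sup>2 \<le> (6 * Y\<^sup>2)\<^sup>2" by (intro power_mono) auto
  also have "(6 * Y\<^sup>2)\<^sup>2 = 36 * Y ^ 4" by (simp add: power_mult_distrib)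
  finally show "cmod (P\<^sup>2) \<le> 36 * Y ^ 4" by (simp only: norm_power)
qed

lemma linepath_vertical: "linepath (Complex x (- Y)) (Complex x Y) \<tau> = Complex x (Y * (2 * \<tau> - 1))"
  by (simp add: linepath_def complex_eq_iff algebra_simps)

lemma linepath_vertical': "linepath (Complex x Y) (Complex x (- Y)) \<tau> = Complex x (- (Y * (2 * \<tau> - 1)))"
  by (simp add: linepath_def complex_eq_iff algebra_simps)

section \<open>Mass of a representing measure inside one rectangle\<close>

context wave_map
begin

text \<open>The two vertical sides contribute equal main terms of order \<open>Y^5\<close>. The
  horizontal sides are short compared with \<open>Y\<close> and contribute little, while the measure
  can account for at most \<open>2 * pi * 81 * Y^4\<close> times its mass in the rectangle. Dividing
  by \<open>Y^4\<close> leaves the bound.\<close>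

lemma tooth_mass:
  assumes \<mu>: "complex_borel_measure \<mu>" and s: "supported_on \<mu> wave"
    and rep: "\<And>z. z \<notin> wave \<Longrightarrow> F z = cm_integral \<mu> (\<lambda>\<xi>. 1 / (\<xi> - z))"
    and c1: "cmod c = 1"
    and valley: "\<And>x y. 0 < \<bar>x\<bar> \<Longrightarrow> \<bar>x\<bar> \<le> 1/2 \<Longrightarrow> wig x = - (\<bar>x\<bar> ^ 7) \<Longrightarrow> \<bar>y\<bar> \<le> \<bar>x\<bar> ^ 7 / 2 \<Longrightarrow>
       cmod (F (Complex x y) - c) \<le> 1600 * \<bar>x\<bar> powr (1/4)"
    and m: "1 \<le> m" and small: "tooth_right m \<le> 1/2" "1600 * tooth_right m powr (1/4) \<le> 1/500"
      "tooth_right m - tooth_left m \<le> tooth_height m / 500"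
  shows "tooth_height m \<le> 650 * (\<Sum>j<4. measure (part_measure \<mu> j)
     (cbox (Complex (tooth_left m) (- tooth_height m)) (Complex (tooth_right m) (tooth_height m))))"
proof -
  define l where "l = tooth_left m"
  define r where "r = tooth_right m"
  define Y where "Y = tooth_height m"
  define X where "X = r - l"
  note tb = tooth_bounds[OF m, folded l_def r_def Y_def]
  note sm = small[folded l_def r_def Y_def X_def]
  have X500: "X \<le> Y / 500" using sm(3) unfolding X_def by simp
  have X0: "0 \<le> X" using tb by (simp add: X_def)
  have XY: "X \<le> Y" using sm(3) tb(4) unfolding X_def by linarith
  have l7: "Y = l ^ 7 / 2" by (simp add: Y_def l_def tooth_height_def)
  obtain a b where a: "l \<le> a" "a \<le> r" "wig a = - Y" and b: "l \<le> b" "b \<le> r" "wig b = Y"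
    using tooth_levels[OF m] unfolding l_def r_def Y_def by blast
  define a1 where "a1 = Complex l (- Y)"
  define a3 where "a3 = Complex r Y"
  define h where "h z = ((z - gam a) * (z - gam b))\<^sup>2" for z
  have le: "Re a1 \<le> Re a3" "Im a1 \<le> Im a3" using tb by (auto simp: a1_def a3_def)
  have hh: "h holomorphic_on UNIV" unfolding h_def by (intro holomorphic_intros)
  obtain C where C: "\<And>\<xi> z. \<xi> \<in> wave \<Longrightarrow> z \<in> path_image (rectpath a1 a3) \<Longrightarrow> cmod (h z) \<le> C * cmod (z - \<xi>)"
    using tooth_kernel_bound[OF m a[unfolded l_def r_def Y_def] b[unfolded l_def r_def Y_def]]
    unfolding h_def a1_def a3_def l_def r_def Y_def by blast
  have sub: "path_image (rectpath a1 a3) \<subseteq> cbox a1 a3" by (rule path_image_rectpath_subset_cbox[OF le])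
  have pim: "path_image (rectpath a1 a3) = {z. Re z \<in> {l, r} \<and> Im z \<in> {- Y..Y}} \<union> {z. Im z \<in> {- Y, Y} \<and> Re z \<in> {l..r}}"
    using path_image_rectpath[OF le] by (simp add: a1_def a3_def)
  \<comment> \<open>By steepness each of the levels \<open>- Y\<close> and \<open>Y\<close> is
    attained only once in the tooth.\<close>
  have cross: "\<xi> = gam a \<or> \<xi> = gam b" if \<xi>: "\<xi> \<in> wave" "\<xi> \<in> path_image (rectpath a1 a3)" for \<xi>
  proof -
    have cb: "\<xi> \<in> cbox (Complex (tooth_left m) (- tooth_height m)) (Complex (tooth_right m) (tooth_height m))"
      using \<xi>(2) sub unfolding a1_def a3_def l_def r_def Y_def by blast
    note t = tooth_mem_cbox[OF m \<xi>(1) cb, folded l_def r_def Y_def]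
    have "wig (Re \<xi>) = - Y \<or> wig (Re \<xi>) = Y" using \<xi>(2) t unfolding pim by auto
    moreover have "\<bar>a - Re \<xi>\<bar> \<le> \<bar>wig a - wig (Re \<xi>)\<bar>" "\<bar>b - Re \<xi>\<bar> \<le> \<bar>wig b - wig (Re \<xi>)\<bar>"
      using a b t tb unfolding l_def r_def Y_def by (intro tooth_steep_abs[OF m]; linarith)+
    ultimately have "Re \<xi> = a \<or> Re \<xi> = b" using a b by auto
    then show ?thesis using t(3) by (auto simp: complex_eq_iff)
  qed
  have crossing: "\<exists>p. p holomorphic_on UNIV \<and> (\<forall>z. h z / (z - \<xi>) = p z)"
    if "\<xi> \<in> wave" "\<xi> \<in> path_image (rectpath a1 a3)" for \<xi>
    using cross[OF that]
  proof
    assume "\<xi> = gam a"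
    then have "\<forall>z. h z / (z - \<xi>) = (z - gam a) * (z - gam b)\<^sup>2"
      by (auto simp: h_def power2_eq_square)
    then show ?thesis
      by (intro exI[of _ "\<lambda>z. (z - gam a) * (z - gam b)\<^sup>2"] conjI) (auto intro!: holomorphic_intros)
  next
    assume "\<xi> = gam b"
    then have "\<forall>z. h z / (z - \<xi>) = (z - gam a)\<^sup>2 * (z - gam b)"
      by (auto simp: h_def power2_eq_square)
    then show ?thesis
      by (intro exI[of _ "\<lambda>z. (z - gam a)\<^sup>2 * (z - gam b)"] conjI) (auto intro!: holomorphic_intros)
  qed
  have h_cbox: "cmod (h \<xi>) \<le> 81 * Y ^ 4" if "\<xi> \<in> cbox a1 a3" for \<xi>
  proof -
    have "cmod (\<xi> - gam t) \<le> 3 * Y" if t: "l \<le> t" "t \<le> r" "\<bar>wig t\<bar> \<le> Y" for t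
    proof -
      have "cmod (\<xi> - gam t) \<le> \<bar>Re \<xi> - t\<bar> + \<bar>Im \<xi> - wig t\<bar>"
        using cmod_le[of "\<xi> - gam t"] by simp
      also have "\<dots> \<le> X + 2 * Y"
        using \<open>\<xi> \<in> cbox a1 a3\<close> t by (auto simp: in_cbox_complex_iff a1_def a3_def X_def abs_le_iff)
      finally show ?thesis using XY by linarith
    qed
    then have "cmod (\<xi> - gam a) \<le> 3 * Y" "cmod (\<xi> - gam b) \<le> 3 * Y" using a b tb by auto
    then have "cmod (\<xi> - gam a) * cmod (\<xi> - gam b) \<le> (3 * Y) * (3 * Y)" using tb by (intro mult_mono) auto
    then have "(cmod (\<xi> - gam a) * cmod (\<xi> - gam b))\<^sup>2 \<le> ((3 * Y) * (3 * Y))\<^sup>2" by (intro power_mono) auto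
    then show ?thesis by (simp add: h_def norm_power norm_mult power2_eq_square power4_eq_xxxx)
  qed
  \<comment> \<open>On the wave the values of \<open>F\<close> mean nothing, but the contour meets
    it only where \<open>h\<close> vanishes.\<close>
  define g where "g z = h z * F z" for z
  have gC: "g z = h z * cm_integral \<mu> (\<lambda>\<xi>. 1 / (\<xi> - z))" if "z \<in> path_image (rectpath a1 a3)" for z
  proof (cases "z \<in> wave")
    case True
    then show ?thesis using cross[OF True that] by (auto simp: g_def h_def)
  qed (simp add: g_def rep)
  define S where "S = (\<Sum>j<4. measure (part_measure \<mu> j) (cbox a1 a3))"
  have "cmod (rect_int a1 a3 g) \<le> 2 * pi * (81 * Y ^ 4) * S"
    unfolding S_def
    by (rule rect_pairing_bound[OF \<mu> s _ le hh C crossing h_cbox _ gC])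
       (use closed_wave tb in auto)
  also have "\<dots> \<le> 650 * Y ^ 4 * S"
  proof -
    have "0 \<le> S" unfolding S_def by (intro sum_nonneg) simp
    then have "0 \<le> Y ^ 4 * S" by simp
    moreover have "2 * pi * 81 \<le> 650" using pi_less_4 by simp
    ultimately have "(2 * pi * 81) * (Y ^ 4 * S) \<le> 650 * (Y ^ 4 * S)" by (intro mult_right_mono) auto
    then show ?thesis by (simp add: mult_ac)
  qed
  finally have upper_bd: "cmod (rect_int a1 a3 g) \<le> 650 * Y ^ 4 * S" .
  have F_right: "cmod (F (Complex r y) - c) \<le> 1/500" if "\<bar>y\<bar> \<le> Y" for y
  proof -
    have "l ^ 7 \<le> r ^ 7" using tb by (intro power_mono) auto
    moreover have ar: "\<bar>r\<bar> = r" using tb(1,2) by linarith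
    ultimately have "\<bar>y\<bar> \<le> \<bar>r\<bar> ^ 7 / 2" using that l7 by simp
    then have "cmod (F (Complex r y) - c) \<le> 1600 * \<bar>r\<bar> powr (1/4)"
      using tb(1,2,6) sm(1) ar by (intro valley) auto
    then show ?thesis using sm(2) unfolding ar by linarith
  qed
  \<comment> \<open>The reflection of the peak at \<open>l\<close> is a valley at
    \<open>- l\<close>, and \<open>F\<close> is odd.\<close>
  have F_left: "cmod (F (Complex l y) + c) \<le> 1/500" if y: "\<bar>y\<bar> \<le> Y" for y
  proof -
    have "cmod (F (Complex (- l) (- y)) - c) \<le> 1600 * \<bar>- l\<bar> powr (1/4)"
      using tb sm y l7 by (intro valley) auto
    also have "\<dots> \<le> 1600 * r powr (1/4)" using tb by (intro mult_left_mono powr_mono2) auto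
    finally have *: "cmod (F (Complex (- l) (- y)) - c) \<le> 1/500" using sm by linarith
    have "Complex l y \<notin> wave" using y tb l7 by (auto simp: mem_wave)
    then have "F (- Complex l y) = - F (Complex l y)" by (rule F_odd)
    moreover have "- Complex l y = Complex (- l) (- y)" by (simp add: complex_eq_iff)
    ultimately have "F (Complex (- l) (- y)) - c = - (F (Complex l y) + c)" by simp
    then show ?thesis using * by (simp only: norm_minus_cancel)
  qed
  have hside: "h (Complex x y) = (Complex (x - a) (y + Y) * Complex (x - b) (y - Y))\<^sup>2" for x y
    using a b by (simp add: h_def gam_def complex_diff)
  have est: "cmod (h (Complex x y) * F (Complex x y) - d * of_real ((Y\<^sup>2 - y\<^sup>2)\<^sup>2)) \<le> Y ^ 4 / 5"
    if x: "x = l \<or> x = r" and y: "\<bar>y\<bar> \<le> Y" and d: "cmod d = 1" "cmod (F (Complex x y) - d) \<le> 1/500" for x y d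
  proof -
    have px: "\<bar>x - a\<bar> \<le> X" "\<bar>x - b\<bar> \<le> X" using x a b by (auto simp: X_def)
    note q = quartic_near_side[OF X0 XY px y, folded hside]
    have "h (Complex x y) * F (Complex x y) - d * of_real ((Y\<^sup>2 - y\<^sup>2)\<^sup>2)
      = h (Complex x y) * (F (Complex x y) - d) + d * (h (Complex x y) - of_real ((Y\<^sup>2 - y\<^sup>2)\<^sup>2))"
      by (simp add: algebra_simps)
    also have "cmod \<dots> \<le> cmod (h (Complex x y)) * cmod (F (Complex x y) - d) + cmod d * cmod (h (Complex x y) - of_real ((Y\<^sup>2 - y\<^sup>2)\<^sup>2))"
      unfolding norm_mult[symmetric] by (rule norm_triangle_ineq)
    also have "\<dots> \<le> (36 * Y ^ 4) * (1/500) + 1 * (35 * X * Y ^ 3)"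
      using q d by (intro add_mono mult_mono) auto
    also have "35 * X * Y ^ 3 \<le> 35 * (Y / 500) * Y ^ 3"
      using X500 tb(4) by (intro mult_right_mono mult_left_mono) auto
    also have "\<dots> = 35 / 500 * Y ^ 4" by (simp add: power4_eq_xxxx power3_eq_cube)
    finally show ?thesis using zero_le_power[of Y 4] tb by linarith
  qed
  have avoid: "continuous_on T g" if "T \<inter> wave = {}" for T
    unfolding g_def
    by (intro continuous_on_mult holomorphic_on_imp_continuous_on holomorphic_on_subset[OF hh]
        holomorphic_on_subset[OF F_holo]) (use that in auto)
  have nw: "closed_segment (Complex x y1) (Complex x y2) \<inter> wave = {}"
    if x: "x = l \<or> x = r" and y: "\<bar>y1\<bar> \<le> Y" "\<bar>y2\<bar> \<le> Y" for x y1 y2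
  proof (rule ccontr)
    assume "closed_segment (Complex x y1) (Complex x y2) \<inter> wave \<noteq> {}"
    then obtain z where z: "z \<in> closed_segment (Complex x y1) (Complex x y2)" "z \<in> wave" by blast
    then have zx: "Re z = x" and zY: "\<bar>Im z\<bar> \<le> Y"
      using y by (auto simp: closed_segment_same_Re closed_segment_eq_real_ivl split: if_splits)
    have lr: "l ^ 7 \<le> r ^ 7" "0 < l ^ 7" using tb(1,2) by (auto intro!: power_mono)
    have "Im z = wig x" using z(2) zx by (simp add: mem_wave)
    then have "Im z = l ^ 7 \<or> Im z = - (r ^ 7)" using x tb(5,6) by metis
    then show False using zY l7 lr by linarith
  qed
  define Q :: complex where "Q = of_real (8 / 15 * Y ^ 4)"
  have y\<tau>: "\<bar>Y * (2 * \<tau> - 1)\<bar> \<le> Y" if "0 \<le> \<tau>" "\<tau> \<le> 1" for \<tau>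
  proof -
    have "\<bar>Y * (2 * \<tau> - 1)\<bar> \<le> Y * 1" unfolding abs_mult using that tb by (intro mult_mono) auto
    then show ?thesis by simp
  qed
  have right: "cmod (side_int (Complex r (- Y)) (Complex r Y) g - 2 * \<i> * of_real Y * (c * Q)) \<le> 2 * Y * (Y ^ 4 / 5)"
  proof -
    have "cmod (side_int (Complex r (- Y)) (Complex r Y) g -
       (Complex r Y - Complex r (- Y)) * (LINT \<tau>:{0..1}|lborel. c * of_real ((Y\<^sup>2 - (Y * (2 * \<tau> - 1))\<^sup>2)\<^sup>2)))
       \<le> cmod (Complex r Y - Complex r (- Y)) * (Y ^ 4 / 5)"
    proof (rule side_int_approx)
      show "continuous_on (closed_segment (Complex r (- Y)) (Complex r Y)) g"
        using tb by (intro avoid nw) auto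
      show "cmod (g (linepath (Complex r (- Y)) (Complex r Y) \<tau>) - c * of_real ((Y\<^sup>2 - (Y * (2 * \<tau> - 1))\<^sup>2)\<^sup>2)) \<le> Y ^ 4 / 5"
        if "0 \<le> \<tau>" "\<tau> \<le> 1" for \<tau>
        unfolding linepath_vertical g_def using y\<tau>[OF that] by (intro est F_right c1) auto
    qed (use tb in \<open>auto intro!: continuous_intros\<close>)
    moreover have "Complex r Y - Complex r (- Y) = 2 * \<i> * of_real Y" by (simp add: complex_eq_iff)
    moreover have "cmod (2 * \<i> * of_real Y) = 2 * Y" using tb by (simp add: norm_mult)
    ultimately show ?thesis unfolding set_integral_quartic Q_def by simp
  qed
  \<comment> \<open>The side is traversed downwards and \<open>F\<close> is near \<open>- c\<close>;
    the two signs cancel, so the main term is that of the right side.\<close>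
  have left: "cmod (side_int (Complex l Y) (Complex l (- Y)) g - 2 * \<i> * of_real Y * (c * Q)) \<le> 2 * Y * (Y ^ 4 / 5)"
  proof -
    have "cmod (side_int (Complex l Y) (Complex l (- Y)) g -
       (Complex l (- Y) - Complex l Y) * (LINT \<tau>:{0..1}|lborel. (- c) * of_real ((Y\<^sup>2 - (Y * (2 * \<tau> - 1))\<^sup>2)\<^sup>2)))
       \<le> cmod (Complex l (- Y) - Complex l Y) * (Y ^ 4 / 5)"
    proof (rule side_int_approx)
      show "continuous_on (closed_segment (Complex l Y) (Complex l (- Y))) g"
        using tb by (intro avoid nw) auto
      show "cmod (g (linepath (Complex l Y) (Complex l (- Y)) \<tau>) - (- c) * of_real ((Y\<^sup>2 - (Y * (2 * \<tau> - 1))\<^sup>2)\<^sup>2)) \<le> Y ^ 4 / 5"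
        if "0 \<le> \<tau>" "\<tau> \<le> 1" for \<tau>
      proof -
        have "(Y * (2 * \<tau> - 1))\<^sup>2 = (- (Y * (2 * \<tau> - 1)))\<^sup>2" by simp
        then show ?thesis
          unfolding linepath_vertical' g_def
          using y\<tau>[OF that] est[of l "- (Y * (2 * \<tau> - 1))" "- c"] F_left[of "- (Y * (2 * \<tau> - 1))"] c1
          by simp
      qed
    qed (use tb in \<open>auto intro!: continuous_intros\<close>)
    moreover have "Complex l (- Y) - Complex l Y = - (2 * \<i> * of_real Y)" by (simp add: complex_eq_iff)
    moreover have "cmod (- (2 * \<i> * of_real Y)) = 2 * Y" using tb by (simp add: norm_mult)
    ultimately show ?thesis unfolding set_integral_quartic Q_def by simp
  qed
  have horiz: "cmod (side_int p q g) \<le> X * (81 * Y ^ 4)"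
    if pq: "cmod (q - p) = X" "closed_segment p q \<subseteq> path_image (rectpath a1 a3)" for p q
    unfolding pq(1)[symmetric]
  proof (rule side_int_bound)
    fix z assume z: "z \<in> closed_segment p q"
    then have zc: "z \<in> path_image (rectpath a1 a3)" using pq by blast
    show "cmod (g z) \<le> 81 * Y ^ 4"
    proof (cases "z \<in> wave")
      case True
      then show ?thesis using cross[OF True zc] tb by (auto simp: g_def h_def)
    next
      case False
      have "cmod (g z) \<le> (81 * Y ^ 4) * 1"
        unfolding g_def norm_mult using h_cbox sub zc F_lt_1[OF False] tb
        by (intro mult_mono) (auto intro: less_imp_le)
      then show ?thesis by simp
    qed
  qed (use tb in simp)
  have bot: "cmod (side_int a1 (Complex r (- Y)) g) \<le> X * (81 * Y ^ 4)"
    using tb rectpath_sides[OF le] by (intro horiz) (auto simp: a1_def a3_def X_def cmod_def)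
  have top: "cmod (side_int a3 (Complex l Y) g) \<le> X * (81 * Y ^ 4)"
    using tb rectpath_sides[OF le] by (intro horiz) (auto simp: a1_def a3_def X_def cmod_def)
  have split: "rect_int a1 a3 g = side_int a1 (Complex r (- Y)) g + side_int (Complex r (- Y)) (Complex r Y) g
     + side_int a3 (Complex l Y) g + side_int (Complex l Y) (Complex l (- Y)) g"
    by (simp add: rect_int_def a1_def a3_def)
  have XY5: "X * (81 * Y ^ 4) \<le> Y / 500 * (81 * Y ^ 4)"
    using X500 tb(4) by (intro mult_right_mono) auto
  have Y5: "Y * Y ^ 4 = Y ^ 5" by (simp add: eval_nat_numeral)
  \<comment> \<open>The budget in units of \<open>Y^5\<close>: the main terms give 32/15, the errors
    on the vertical sides cost 4/5 and the horizontal sides 81/250. More than 1 remains.\<close>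
  have "cmod (4 * \<i> * of_real Y * (c * Q)) = 32 / 15 * Y ^ 5"
    using c1 tb by (simp add: norm_mult Q_def Y5[symmetric] norm_divide norm_power)
  moreover have "cmod (4 * \<i> * of_real Y * (c * Q)) \<le> cmod (rect_int a1 a3 g) +
      (cmod (side_int (Complex r (- Y)) (Complex r Y) g - 2 * \<i> * of_real Y * (c * Q)) +
       cmod (side_int (Complex l Y) (Complex l (- Y)) g - 2 * \<i> * of_real Y * (c * Q)) +
       cmod (side_int a1 (Complex r (- Y)) g) + cmod (side_int a3 (Complex l Y) g))"
  proof -
    have id: "4 * \<i> * of_real Y * (c * Q) = rect_int a1 a3 g -
      ((side_int (Complex r (- Y)) (Complex r Y) g - 2 * \<i> * of_real Y * (c * Q)) +
       (side_int (Complex l Y) (Complex l (- Y)) g - 2 * \<i> * of_real Y * (c * Q)) +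
       side_int a1 (Complex r (- Y)) g + side_int a3 (Complex l Y) g)"
      unfolding split by (simp add: algebra_simps)
    show ?thesis
      by (subst id) (intro order_trans[OF norm_triangle_ineq4] add_mono order_refl order_trans[OF norm_triangle_ineq])
  qed
  ultimately have "32 / 15 * Y ^ 5 \<le> cmod (rect_int a1 a3 g) + (2 * (2 * Y * (Y ^ 4 / 5)) + 2 * (Y / 500 * (81 * Y ^ 4)))"
    using right left bot top XY5 by linarith
  also have "2 * (2 * Y * (Y ^ 4 / 5)) + 2 * (Y / 500 * (81 * Y ^ 4)) = 281/250 * Y ^ 5"
    unfolding Y5[symmetric] by (simp add: algebra_simps)
  finally have "32 / 15 * Y ^ 5 \<le> cmod (rect_int a1 a3 g) + 281/250 * Y ^ 5" .
  moreover have "0 < Y ^ 5" using tb by simp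
  ultimately have "Y ^ 5 \<le> cmod (rect_int a1 a3 g)" by linarith
  also note upper_bd
  finally have "Y ^ 4 * Y \<le> Y ^ 4 * (650 * S)" by (simp add: Y5[symmetric] mult_ac)
  moreover have "0 < Y ^ 4" using tb by simp
  ultimately have "Y \<le> 650 * S" by (simp only: mult_le_cancel_left_pos)
  then show ?thesis by (simp add: S_def a1_def a3_def l_def r_def Y_def)
qed

text \<open>The rectangles around the teeth are disjoint, and by \<open>tooth_mass\<close> a representing measure
  would give them total mass at least a multiple of the divergent sum of the heights.\<close>

lemma F_not_cauchy_transform:
  assumes \<mu>: "complex_borel_measure \<mu>" and s: "supported_on \<mu> wave"
    and rep: "\<And>z. z \<notin> wave \<Longrightarrow> F z = cm_integral \<mu> (\<lambda>\<xi>. 1 / (\<xi> - z))"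
  shows False
proof -
  obtain c where c: "cmod c = 1"
    "\<And>x y. 0 < \<bar>x\<bar> \<Longrightarrow> \<bar>x\<bar> \<le> 1/2 \<Longrightarrow> wig x = - (\<bar>x\<bar> ^ 7) \<Longrightarrow> \<bar>y\<bar> \<le> \<bar>x\<bar> ^ 7 / 2 \<Longrightarrow>
       cmod (F (Complex x y) - c) \<le> 1600 * \<bar>x\<bar> powr (1/4)"
    by (rule F_in_valleys) (rule that)
  define box where "box m = cbox (Complex (tooth_left m) (- tooth_height m)) (Complex (tooth_right m) (tooth_height m))" for m
  define u where "u m = 2 * real m - 1/2" for m
  have u_lim: "filterlim u at_top sequentially"
  proof -
    have "filterlim (\<lambda>m. - 1/2 + 2 * real m) at_top sequentially"
      by (intro filterlim_tendsto_add_at_top[OF tendsto_const]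
          filterlim_tendsto_pos_mult_at_top[OF tendsto_const _ filterlim_real_sequentially]) auto
    moreover have "u = (\<lambda>m. - 1/2 + 2 * real m)" by (simp add: u_def fun_eq_iff)
    ultimately show ?thesis by (simp only:)
  qed
  have lim: "(\<lambda>m. K * u m powr q) \<longlonglongrightarrow> 0" if "q < 0" for K q
    using tendsto_mult[OF tendsto_const tendsto_neg_powr[OF that u_lim], of K] by simp
  have ev1: "\<forall>\<^sub>F m in sequentially. tooth_right m \<le> 1/2"
  proof -
    have "\<forall>\<^sub>F m in sequentially. 1 * u m powr (-1/8) < 1/2"
      by (rule order_tendstoD(2)[OF lim]) auto
    then show ?thesis by eventually_elim (simp add: tooth_right_def node_def u_def)
  qed
  have ev2: "\<forall>\<^sub>F m in sequentially. 1600 * tooth_right m powr (1/4) \<le> 1/500"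
  proof -
    have "\<forall>\<^sub>F m in sequentially. 1600 * u m powr (-1/32) < 1/500"
      by (rule order_tendstoD(2)[OF lim]) auto
    then show ?thesis by eventually_elim (simp add: tooth_right_def node_def u_def powr_powr)
  qed
  have ev3: "\<forall>\<^sub>F m in sequentially. tooth_right m - tooth_left m \<le> tooth_height m / 500"
  proof -
    have "\<forall>\<^sub>F m in sequentially. 750 * u m powr (-1/4) < 1"
      by (rule order_tendstoD(2)[OF lim]) auto
    then show ?thesis using eventually_gt_at_top[of 0]
  proof eventually_elim
    case (elim m)
    have m: "1 \<le> m" "1 \<le> real m" using elim by auto
    note tb = tooth_bounds[OF m(1)]
    define l where "l = tooth_left m"
    define r where "r = tooth_right m"
    have um: "1 \<le> u m" using m by (simp add: u_def)
    have l8: "l ^ 8 = 1 / (u m + 1)" and r8: "r ^ 8 = 1 / u m"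
      using um by (simp_all add: l_def r_def tooth_left_def tooth_right_def node_pow_8 u_def)
    have lr: "0 < l" "l \<le> r" using tb by (auto simp: l_def r_def)
    \<comment> \<open>Bernoulli's inequality for \<open>(r / l)^8\<close> passes from the eighth
      powers, which are explicit, to the width \<open>r - l\<close>.\<close>
    have "l ^ 7 * (8 * (r - l)) \<le> r ^ 8 - l ^ 8"
    proof -
      have "1 + real 8 * ((r - l) / l) \<le> (1 + (r - l) / l) ^ 8"
        using lr by (intro Bernoulli_inequality) (auto simp: field_simps)
      also have "1 + (r - l) / l = r / l" using lr by (simp add: field_simps)
      finally have "l ^ 8 * (1 + 8 * ((r - l) / l)) \<le> l ^ 8 * (r / l) ^ 8"
        using lr by (intro mult_left_mono) auto
      also have "l ^ 8 * (r / l) ^ 8 = r ^ 8" using lr by (simp add: power_divide)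
      also have "l ^ 8 * (1 + 8 * ((r - l) / l)) = l ^ 8 + l ^ 7 * (8 * (r - l))"
        using lr by (simp add: field_simps eval_nat_numeral)
      finally show ?thesis by linarith
    qed
    also have "r ^ 8 - l ^ 8 = 1 / (u m * (u m + 1))"
      using um by (simp add: l8 r8 field_simps)
    finally have 1: "l ^ 7 * (8 * (r - l)) \<le> 1 / (u m * (u m + 1))" .
    \<comment> \<open>As \<open>l^14\<close> is \<open>(u m + 1) powr (- 7/4)\<close>, the quotient
      \<open>(r - l) / l^7\<close> is of order \<open>u m powr (- 1/4)\<close>. A violation would
      give \<open>(2 * u m) powr (1/4) \<le> 500\<close>, against the choice of \<open>m\<close>
      with \<open>750 * u m powr (- 1/4) < 1\<close>.\<close>
    have "r - l \<le> l ^ 7 / 1000"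
    proof (rule ccontr)
      assume "\<not> ?thesis"
      then have "l ^ 7 * (8 * (l ^ 7 / 1000)) \<le> l ^ 7 * (8 * (r - l))"
        using lr by (intro mult_left_mono) auto
      also note 1
      finally have "l ^ 14 * 8 \<le> 1000 / (u m * (u m + 1))" by (simp add: power_add[symmetric] flip: power_add)
      then have A: "l ^ 14 * 8 * (u m * (u m + 1)) \<le> 1000" using um by (simp add: pos_le_divide_eq)
      have B: "l ^ 14 = (u m + 1) powr (- 7/4)"
      proof -
        have "2 * real m + 1/2 = u m + 1" by (simp add: u_def)
        then have lu: "l = (u m + 1) powr (-1/8)" by (simp only: l_def tooth_left_def node_def)
        have "l ^ 14 = ((u m + 1) powr (-1/8)) powr (real 14)"
          unfolding lu by (rule powr_realpow[symmetric]) (use um in simp)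
        then show ?thesis unfolding powr_powr by simp
      qed
      have "(2 * u m) powr (- 7/4) * 8 * (u m * u m) \<le> (u m + 1) powr (- 7/4) * 8 * (u m * (u m + 1))"
        using um by (intro mult_mono powr_mono2' mult_nonneg_nonneg) auto
      also note A[unfolded B]
      finally have "(2 * u m) powr (- 7/4) * 8 * (u m * u m) \<le> 1000" .
      moreover have "(2 * u m) powr (- 7/4) * 4 * (u m * u m) = (2 * u m) powr (1/4)"
      proof -
        have "(2 * u m) powr (1/4) = (2 * u m) powr (- 7/4) * (2 * u m) powr 2"
          using powr_add[of "2 * u m" "- 7/4" 2] by simp
        then show ?thesis using um by (simp add: power2_eq_square)
      qed
      ultimately have a: "(2 * u m) powr (1/4) \<le> 500" by linarith
      have "u m powr (1/4) \<le> (2 * u m) powr (1/4)" using um by (intro powr_mono2) auto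
      then have "u m powr (1/4) \<le> 500" using a by linarith
      moreover have "750 * u m powr (- 1/4) < 1" using elim(1) by simp
      then have "750 < u m powr (1/4)" using um by (simp add: powr_minus field_simps)
      ultimately show False by linarith
    qed
    then show ?case by (simp add: l_def r_def tooth_height_def)
  qed
  qed
  define S where "S m = (\<Sum>j<4. measure (part_measure \<mu> j) (box m))" for m
  have ev: "\<forall>\<^sub>F m in sequentially. tooth_height m \<le> 650 * S m"
    using ev1 ev2 ev3 eventually_ge_at_top[of 1]
  proof eventually_elim
    case (elim m)
    then show ?case
      unfolding S_def box_def using c(2) by (intro tooth_mass[OF \<mu> s rep c(1)]) auto
  qed
  \<comment> \<open>Distinct teeth occupy disjoint phase intervals from 2m - 1/2 to 2m + 1/2. The
    numbering starts at 1 because tooth 0 would reach a negative phase.\<close>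
  have disj: "disjoint_family (\<lambda>m. box (Suc m))"
  proof -
    have "box (Suc i) \<inter> box (Suc j) = {}" if "i < j" for i j
    proof -
      have "real i + 1 \<le> real j" using that by linarith
      then have "tooth_right (Suc j) < tooth_left (Suc i)"
        unfolding tooth_right_def tooth_left_def by (intro node_antimono) auto
      then show ?thesis unfolding box_def by (force simp: in_cbox_complex_iff)
    qed
    then show ?thesis
      unfolding disjoint_family_on_def by (metis inf_commute linorder_neqE_nat)
  qed
  have "summable (\<lambda>m. measure (part_measure \<mu> j) (box (Suc m)))" for j
  proof -
    interpret finite_measure "part_measure \<mu> j" by (rule finite_part_measure[OF \<mu>])
    show ?thesis
      by (rule sums_summable, rule finite_measure_UNION[OF _ disj]) (auto simp: box_def)
  qed
  then have "summable (\<lambda>m. S (Suc m))" unfolding S_def by (intro summable_sum)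
  then have "summable (\<lambda>m. 650 * S m)" by (subst (asm) summable_Suc_iff) (rule summable_mult)
  moreover have "\<forall>\<^sub>F m in sequentially. norm (1 / 6 * inverse (real m)) \<le> 650 * S m"
    using ev eventually_ge_at_top[of 1]
  proof eventually_elim
    case (elim m)
    have m: "1 \<le> real m" using elim by simp
    \<comment> \<open>The height is \<open>v powr (-7/8) / 2\<close>, which is at least
      \<open>1 / (2 * v)\<close> and so at least \<open>1 / (6 * m)\<close>: the harmonic series is
      a minorant.\<close>
    define v where "v = 2 * real m + 1/2"
    have v: "1 \<le> v" "v \<le> 3 * real m" using m by (auto simp: v_def)
    have "1 / 6 * inverse (real m) = 1 / (2 * (3 * real m))" by (simp add: field_simps)
    also have "\<dots> \<le> 1 / (2 * v)" using v by (intro divide_left_mono) auto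
    also have "\<dots> = v powr (-1) / 2" using v by (simp add: powr_minus_divide)
    also have "\<dots> \<le> v powr (-7/8) / 2" using v by (intro divide_right_mono powr_mono) auto
    also have "v powr (-7/8) = (v powr (-1/8)) powr (real 7)" unfolding powr_powr by simp
    also have "\<dots> = tooth_left m ^ 7"
      by (subst powr_realpow) (use v in \<open>auto simp: tooth_left_def node_def v_def\<close>)
    finally show ?case using elim m by (simp add: tooth_height_def)
  qed
  ultimately have "summable (\<lambda>m. 1 / 6 * inverse (real m))"
    by (rule summable_comparison_test_ev[rotated])
  then have "summable (\<lambda>m. 6 * (1 / 6 * inverse (real m)))" by (rule summable_mult)
  then have "summable (\<lambda>m. inverse (real m))" by simp
  then show False using not_summable_harmonic[where 'a = real] by simp
qed

end

section \<open>The wave on the Riemann sphere\<close>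

lemma
  fixes h :: "complex \<Rightarrow> complex"
  assumes M: "finite_measure M" "sets M = sets borel" "AE \<xi> in M. \<xi> \<in> wave"
    and h: "h \<in> borel_measurable borel" "\<And>\<xi>. \<xi> \<in> wave \<Longrightarrow> cmod (h \<xi>) \<le> B"
  shows integrable_on_wave: "integrable M h"
    and integral_on_wave_bound: "cmod (integral\<^sup>L M h) \<le> B * measure M UNIV"
proof -
  interpret finite_measure M by fact
  have B: "AE \<xi> in M. norm (h \<xi>) \<le> B" using M(3) h(2) by auto
  show i: "integrable M h"
    using h(1) by (intro integrable_const_bound[OF B]) (simp add: measurable_cong_sets[OF M(2) refl])
  have "cmod (integral\<^sup>L M h) \<le> integral\<^sup>L M (\<lambda>\<xi>. cmod (h \<xi>))" by (rule integral_norm_bound)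
  also have "\<dots> \<le> integral\<^sup>L M (\<lambda>\<xi>. B)"
    by (rule integral_mono_AE) (use i B in auto)
  finally show "cmod (integral\<^sup>L M h) \<le> B * measure M UNIV"
    using sets_eq_imp_space_eq[OF M(2)] by (simp add: mult.commute)
qed

lemma infdist_wave_pos: "z \<notin> wave \<Longrightarrow> 0 < infdist z wave"
  using zero_in_wave closed_wave infdist_pos_not_in_closed by blast

lemma kernel_bound:
  assumes "z \<notin> wave" "\<xi> \<in> wave"
  shows "infdist z wave \<le> cmod (\<xi> - z)" "cmod (1 / (\<xi> - z)) \<le> 1 / infdist z wave"
proof -
  show d: "infdist z wave \<le> cmod (\<xi> - z)"
    using infdist_le[OF assms(2), of z] by (simp add: dist_norm norm_minus_commute)
  show "cmod (1 / (\<xi> - z)) \<le> 1 / infdist z wave"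
    using d infdist_wave_pos[OF assms(1)] by (simp add: norm_divide frac_le)
qed

text \<open>The difference quotient minus the expected derivative is the integral of
  \<open>(y - z) / ((\<xi> - y) * (\<xi> - z)^2)\<close>, which is \<open>O(|y - z|)\<close> as both
  factors below stay away from 0. At infinity
  \<open>z / (\<xi> - z) + 1 = \<xi> / (\<xi> - z)\<close> tends to 0; the kernel behaves like
  \<open>-1 / z\<close>, hence the minus sign.\<close>

lemma
  assumes M: "finite_measure M" "sets M = sets borel" "AE \<xi> in M. \<xi> \<in> wave"
  shows cauchy_integral_holomorphic: "(\<lambda>z. \<integral>\<xi>. 1 / (\<xi> - z) \<partial>M) holomorphic_on - wave"
    and cauchy_integral_at_infinity:
      "((\<lambda>z. z * (\<integral>\<xi>. 1 / (\<xi> - z) \<partial>M)) \<longlongrightarrow> - of_real (measure M wave)) at_infinity"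
proof -
  note bound = integral_on_wave_bound[OF M] and int = integrable_on_wave[OF M]
  have intk: "integrable M (\<lambda>\<xi>. 1 / (\<xi> - z))" if "z \<notin> wave" for z
    by (rule int) (use kernel_bound(2)[OF that] in auto)
  show "(\<lambda>z. \<integral>\<xi>. 1 / (\<xi> - z) \<partial>M) holomorphic_on - wave"
    unfolding holomorphic_on_open[OF open_Compl[OF closed_wave]]
  proof (intro ballI exI)
    fix z assume "z \<in> - wave"
    then have z: "z \<notin> wave" by simp
    define d where "d = infdist z wave"
    have d0: "0 < d" using infdist_wave_pos[OF z] by (simp add: d_def)
    have dk: "d \<le> cmod (\<xi> - z)" if "\<xi> \<in> wave" for \<xi>
      using kernel_bound(1)[OF z that] by (simp add: d_def)
    have intk2: "integrable M (\<lambda>\<xi>. 1 / (\<xi> - z)\<^sup>2)"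
    proof (rule int)
      show "cmod (1 / (\<xi> - z)\<^sup>2) \<le> 1 / d\<^sup>2" if "\<xi> \<in> wave" for \<xi>
        using dk[OF that] d0 by (simp add: norm_divide norm_power frac_le power_mono)
    qed auto
    show "((\<lambda>z. \<integral>\<xi>. 1 / (\<xi> - z) \<partial>M) has_field_derivative (\<integral>\<xi>. 1 / (\<xi> - z)\<^sup>2 \<partial>M)) (at z)"
      unfolding has_field_derivative_iff
    proof (rule LIM_zero_cancel, rule Lim_null_comparison)
      have "\<forall>\<^sub>F y in at z. dist y z < d / 2"
        using d0 by (intro eventually_at_ball'[of "d/2" z UNIV, THEN eventually_mono]) (auto simp: dist_commute)
      then show "\<forall>\<^sub>F y in at z. norm (((\<integral>\<xi>. 1 / (\<xi> - y) \<partial>M) - (\<integral>\<xi>. 1 / (\<xi> - z) \<partial>M)) / (y - z) - (\<integral>\<xi>. 1 / (\<xi> - z)\<^sup>2 \<partial>M))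
         \<le> (2 / d ^ 3 * measure M UNIV) * cmod (y - z)"
        using eventually_neq_at_within[of z z UNIV]
      proof eventually_elim
        case (elim y)
        have yd: "d / 2 \<le> cmod (\<xi> - y)" if "\<xi> \<in> wave" for \<xi>
          using dk[OF that] elim(1) norm_triangle_ineq[of "\<xi> - y" "y - z"] by (simp add: dist_norm)
        have y: "y \<notin> wave" using yd[of y] d0 by auto
        have "((\<integral>\<xi>. 1 / (\<xi> - y) \<partial>M) - (\<integral>\<xi>. 1 / (\<xi> - z) \<partial>M)) / (y - z) - (\<integral>\<xi>. 1 / (\<xi> - z)\<^sup>2 \<partial>M)
           = (\<integral>\<xi>. (1 / (\<xi> - y) - 1 / (\<xi> - z)) / (y - z) - 1 / (\<xi> - z)\<^sup>2 \<partial>M)"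
          using intk[OF y] intk[OF z] intk2 by simp
        also have "cmod \<dots> \<le> (2 / d ^ 3 * cmod (y - z)) * measure M UNIV"
        proof (rule bound)
          fix \<xi> assume \<xi>: "\<xi> \<in> wave"
          have nz: "\<xi> - y \<noteq> 0" "\<xi> - z \<noteq> 0" "y - z \<noteq> 0" using \<xi> y z elim by auto
          have "(1 / (\<xi> - y) - 1 / (\<xi> - z)) / (y - z) - 1 / (\<xi> - z)\<^sup>2 = (y - z) / ((\<xi> - y) * (\<xi> - z)\<^sup>2)"
          proof -
            have "(1 / a - 1 / b) / (b - a) - 1 / b\<^sup>2 = (b - a) / (a * b\<^sup>2)" if "a \<noteq> 0" "b \<noteq> 0" "b - a \<noteq> 0" for a b :: complex
              using that by (simp add: divide_simps power2_eq_square)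
            from this[of "\<xi> - y" "\<xi> - z"] nz show ?thesis by simp
          qed
          also have "cmod \<dots> = cmod (y - z) / (cmod (\<xi> - y) * (cmod (\<xi> - z))\<^sup>2)"
            by (simp add: norm_divide norm_mult norm_power)
          also have "\<dots> \<le> cmod (y - z) / (d / 2 * d\<^sup>2)"
            using yd[OF \<xi>] dk[OF \<xi>] d0 by (intro divide_left_mono mult_mono power_mono mult_pos_pos) auto
          also have "\<dots> = 2 / d ^ 3 * cmod (y - z)" using d0 by (simp add: power2_eq_square power3_eq_cube mult_ac)
          finally show "cmod ((1 / (\<xi> - y) - 1 / (\<xi> - z)) / (y - z) - 1 / (\<xi> - z)\<^sup>2) \<le> 2 / d ^ 3 * cmod (y - z)" .
        qed measurable
        finally show ?case by (simp add: mult_ac)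
      qed
      have "((\<lambda>y. (2 / d ^ 3 * measure M UNIV) * cmod (y - z)) \<longlongrightarrow> (2 / d ^ 3 * measure M UNIV) * cmod (z - z)) (at z)"
        by (intro tendsto_intros)
      then show "((\<lambda>y. (2 / d ^ 3 * measure M UNIV) * cmod (y - z)) \<longlongrightarrow> 0) (at z)" by simp
    qed
  qed
  show "((\<lambda>z. z * (\<integral>\<xi>. 1 / (\<xi> - z) \<partial>M)) \<longlongrightarrow> - of_real (measure M wave)) at_infinity"
  proof (rule LIM_zero_cancel, rule Lim_null_comparison)
    interpret finite_measure M by fact
    have sp: "space M = UNIV" using sets_eq_imp_space_eq[OF M(2)] by simp
    have mw: "measure M wave = measure M UNIV"
      by (rule finite_measure_eq_AE) (use M closed_wave in auto)
    have "\<forall>\<^sub>F z in at_infinity. 4 \<le> cmod (z :: complex)"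
      unfolding eventually_at_infinity by blast
    then show "\<forall>\<^sub>F z in at_infinity. norm (z * (\<integral>\<xi>. 1 / (\<xi> - z) \<partial>M) - - of_real (measure M wave)) \<le> (4 * measure M UNIV) * cmod (1 / z)"
    proof eventually_elim
      case (elim z)
      have zw: "z \<notin> wave" using cmod_wave_le[of z] elim by auto
      have "z * (\<integral>\<xi>. 1 / (\<xi> - z) \<partial>M) - - of_real (measure M wave) = (\<integral>\<xi>. z * (1 / (\<xi> - z)) + 1 \<partial>M)"
        using intk[OF zw] by (simp add: mw sp scaleR_conv_of_real del: times_divide_eq_right)
      also have "cmod \<dots> \<le> (4 * cmod (1 / z)) * measure M UNIV"
      proof (rule bound)
        fix \<xi> assume \<xi>: "\<xi> \<in> wave"
        have x2: "cmod \<xi> \<le> 2" by (rule cmod_wave_le[OF \<xi>])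
        have "cmod z - cmod \<xi> \<le> cmod (\<xi> - z)" by (metis norm_minus_commute norm_triangle_ineq2)
        then have g: "cmod z / 2 \<le> cmod (\<xi> - z)" using x2 elim by linarith
        have "\<xi> - z \<noteq> 0" using \<xi> zw by auto
        then have "z * (1 / (\<xi> - z)) + 1 = \<xi> / (\<xi> - z)" by (simp add: field_simps)
        also have "cmod \<dots> \<le> 2 / (cmod z / 2)"
          unfolding norm_divide using x2 g elim by (intro frac_le) auto
        finally show "cmod (z * (1 / (\<xi> - z)) + 1) \<le> 4 * cmod (1 / z)" by (simp add: norm_divide)
      qed measurable
      finally show ?case by (simp add: mult_ac)
    qed
    have "((\<lambda>z. (4 * measure M UNIV) * cmod (1 / z)) \<longlongrightarrow> (4 * measure M UNIV) * cmod 0) at_infinity"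
      by (intro tendsto_intros tendsto_divide_0[OF tendsto_const] filterlim_ident)
    then show "((\<lambda>z. (4 * measure M UNIV) * cmod (1 / z)) \<longlongrightarrow> 0) at_infinity" by simp
  qed
qed

section \<open>The notions on the sphere expressed in the two charts\<close>

lemma sphere_compl_wave: "sphere_compl wave = insert None (Some ` (- wave))"
  by (auto simp: sphere_compl_def riemann_sphere_def)

lemma Some_vimage_sphere_compl: "Some -` sphere_compl wave = - wave"
  by (auto simp: sphere_compl_wave)

lemma chart_inf_vimage_sphere_compl: "chart_inf -` sphere_compl wave = inv_dom"
  by (auto simp: sphere_compl_wave chart_inf_def inv_dom_def)

text \<open>A compact set and the wave together never cover the plane, so infinity is in the closure
  of the connected finite part.\<close>

lemma connectedin_sphere_compl_wave: "connectedin riemann_sphere (sphere_compl wave)"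
proof (rule connectedin_intermediate_closure_of)
  show c: "connectedin riemann_sphere (Some ` (- wave))"
    unfolding riemann_sphere_def
    by (rule connectedin_continuous_map_image[OF continuous_map_Some]) (simp add: connected_compl_wave)
  show "Some ` (- wave) \<subseteq> sphere_compl wave" by (auto simp: sphere_compl_wave)
  have "\<exists>y. y \<in> Some ` (- wave) \<and> y \<in> T" if T: "None \<in> T" "openin riemann_sphere T" for T
  proof -
    obtain C where C: "compact C" "T = insert None (Some ` (UNIV - C))"
      using T unfolding riemann_sphere_def openin_Alexandroff_compactification by auto
    have "wave \<union> C \<noteq> UNIV"
      using C(1) compact_wave compact_imp_bounded bounded_Un not_bounded_UNIV by metis
    then obtain z where "z \<notin> wave" "z \<notin> C" by blast
    then show ?thesis using C(2) by (intro exI[of _ "Some z"]) auto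
  qed
  then have "None \<in> riemann_sphere closure_of (Some ` (- wave))"
    unfolding in_closure_of by (auto simp: riemann_sphere_def)
  moreover have "Some ` (- wave) \<subseteq> riemann_sphere closure_of (Some ` (- wave))"
    by (rule closure_of_subset) (auto simp: riemann_sphere_def)
  ultimately show "sphere_compl wave \<subseteq> riemann_sphere closure_of (Some ` (- wave))"
    by (simp add: sphere_compl_wave)
qed

lemma outer_component_wave: "outer_component wave = sphere_compl wave"
proof -
  have "connected_space (subtopology riemann_sphere (sphere_compl wave))"
    using connectedin_sphere_compl_wave by (simp add: connectedin_def)
  moreover have "topspace (subtopology riemann_sphere (sphere_compl wave)) = sphere_compl wave"
    by (auto simp: sphere_compl_def)
  ultimately show ?thesis
    unfolding outer_component_def connected_space_connected_component_set
    by (auto simp: sphere_compl_wave)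
qed

text \<open>With \<open>z = 1 / w\<close> the expression in the limit is the difference quotient at
  0 in the chart at infinity.\<close>

lemma deriv_inf_eq:
  assumes K: "(\<lambda>w. g (chart_inf w)) holomorphic_on inv_dom"
  shows "((\<lambda>z. z * (g (Some z) - g None)) \<longlongrightarrow> deriv (\<lambda>w. g (chart_inf w)) 0) at_infinity"
    and "deriv_inf g = deriv (\<lambda>w. g (chart_inf w)) 0"
proof -
  let ?K = "\<lambda>w. g (chart_inf w)"
  have "(?K has_field_derivative deriv ?K 0) (at 0)"
    by (rule holomorphic_derivI[OF K open_inv_dom zero_in_inv_dom])
  then have "((\<lambda>w. (?K w - ?K 0) / (w - 0)) \<longlongrightarrow> deriv ?K 0) (at 0)"
    by (simp only: has_field_derivative_iff)
  moreover have "\<forall>\<^sub>F w in at 0. (?K w - ?K 0) / (w - 0) = ((\<lambda>z. z * (g (Some z) - g None)) \<circ> inverse) w"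
    using eventually_neq_at_within[of 0 0 UNIV]
    by eventually_elim (simp add: chart_inf_def divide_inverse mult.commute)
  ultimately have "(((\<lambda>z. z * (g (Some z) - g None)) \<circ> inverse) \<longlongrightarrow> deriv ?K 0) (at 0)"
    by (rule Lim_transform_eventually)
  then show t: "((\<lambda>z. z * (g (Some z) - g None)) \<longlongrightarrow> deriv ?K 0) at_infinity"
    by (simp only: lim_at_infinity_0)
  then show "deriv_inf g = deriv ?K 0"
    unfolding deriv_inf_def by (intro tendsto_Lim) (auto simp: trivial_limit_at_infinity)
qed

text \<open>Since \<open>z\<close> times the transform has a limit at infinity, the transform tends
  to 0 in the chart at infinity and the singularity at 0 is removable. The same limit is the
  derivative.\<close>

lemma
  assumes \<mu>: "complex_borel_measure \<mu>" and s: "supported_on \<mu> wave"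
  shows cauchy_transform_holomorphic: "sphere_holomorphic_on (cauchy_transform \<mu>) (sphere_compl wave)"
    and deriv_inf_cauchy_transform: "deriv_inf (cauchy_transform \<mu>) = - \<mu> wave"
proof -
  have wb: "wave \<in> sets borel" using closed_wave by simp
  note M = finite_part_measure[OF \<mu>] sets_part_measure AE_part_measure[OF \<mu> s wb]
  have ct: "cauchy_transform \<mu> (Some z) = (\<Sum>j<4. \<i> ^ j * (\<integral>\<xi>. 1 / (\<xi> - z) \<partial>part_measure \<mu> j))" for z
    by (simp add: cauchy_transform_def cm_integral_eq_part_measures)
  have hol: "(\<lambda>z. cauchy_transform \<mu> (Some z)) holomorphic_on - wave"
    unfolding ct by (intro holomorphic_intros cauchy_integral_holomorphic M)
  have "((\<lambda>z. \<Sum>j<4. \<i> ^ j * (z * (\<integral>\<xi>. 1 / (\<xi> - z) \<partial>part_measure \<mu> j))) \<longlongrightarrow>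
      (\<Sum>j<4. \<i> ^ j * - of_real (measure (part_measure \<mu> j) wave))) at_infinity"
    by (intro tendsto_sum tendsto_mult tendsto_const cauchy_integral_at_infinity M)
  then have lim: "((\<lambda>z. z * cauchy_transform \<mu> (Some z)) \<longlongrightarrow> - \<mu> wave) at_infinity"
    unfolding ct charge_eq_part_measures[OF \<mu> wb] by (simp add: sum_distrib_left sum_negf mult.left_commute)
  define K where "K w = cauchy_transform \<mu> (chart_inf w)" for w
  have K0: "K 0 = 0" by (simp add: K_def chart_inf_def cauchy_transform_def)
  have Kw: "K w = cauchy_transform \<mu> (Some (1 / w))" if "w \<noteq> 0" for w
    using that by (simp add: K_def chart_inf_def)
  have Khol: "K holomorphic_on inv_dom - {0}"
  proof (rule holomorphic_transform)
    show "(\<lambda>w. cauchy_transform \<mu> (Some (1 / w))) holomorphic_on inv_dom - {0}"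
      by (rule holomorphic_on_comp[OF hol]) (auto simp: inv_dom_def intro!: holomorphic_intros)
  qed (simp add: Kw)
  have "(K \<longlongrightarrow> 0) (at 0)"
  proof -
    have "((\<lambda>z. (z * cauchy_transform \<mu> (Some z)) * (1 / z)) \<longlongrightarrow> - \<mu> wave * 0) at_infinity"
      by (intro tendsto_mult lim tendsto_divide_0[OF tendsto_const] filterlim_ident)
    then have "(((\<lambda>z. (z * cauchy_transform \<mu> (Some z)) * (1 / z)) \<circ> inverse) \<longlongrightarrow> 0) (at 0)"
      by (simp add: lim_at_infinity_0)
    then show ?thesis
      by (rule Lim_transform_eventually)
         (use eventually_neq_at_within[of 0 0 UNIV] in eventually_elim, simp add: Kw inverse_eq_divide)
  qed
  then have "isCont K 0" by (simp add: isCont_def K0)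
  moreover have "isCont K w" if "w \<in> inv_dom" "w \<noteq> 0" for w
    using holomorphic_on_imp_continuous_on[OF Khol] that open_inv_dom
    by (simp add: continuous_on_eq_continuous_at open_delete)
  ultimately have "continuous_on inv_dom K"
    by (metis continuous_at_imp_continuous_on)
  then have "K holomorphic_on inv_dom"
    by (rule no_isolated_singularity[OF _ Khol open_inv_dom]) simp
  then have K: "(\<lambda>w. cauchy_transform \<mu> (chart_inf w)) holomorphic_on inv_dom" by (simp add: K_def[abs_def])
  then show "sphere_holomorphic_on (cauchy_transform \<mu>) (sphere_compl wave)"
    unfolding sphere_holomorphic_on_def Some_vimage_sphere_compl chart_inf_vimage_sphere_compl
    using hol by simp
  have "((\<lambda>z. z * (cauchy_transform \<mu> (Some z) - cauchy_transform \<mu> None)) \<longlongrightarrow> - \<mu> wave) at_infinity"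
    using lim by (simp add: cauchy_transform_def)
  then show "deriv_inf (cauchy_transform \<mu>) = - \<mu> wave"
    unfolding deriv_inf_def by (intro tendsto_Lim) (auto simp: trivial_limit_at_infinity)
qed

context wave_map
begin

definition ahl :: "complex option \<Rightarrow> complex" where
  "ahl p = (case p of None \<Rightarrow> 0 | Some z \<Rightarrow> F z)"

lemma ahl_chart_inf: "ahl (chart_inf w) = k w"
  by (simp add: ahl_def chart_inf_def F_def k_0)

lemma ahl_extremal:
  "ahl \<in> H_inf (sphere_compl wave)" "p \<in> sphere_compl wave \<Longrightarrow> cmod (ahl p) \<le> 1"
  "deriv_inf ahl = of_real \<kappa>"
proof -
  show b: "cmod (ahl p) \<le> 1" if "p \<in> sphere_compl wave" for p
    using that F_lt_1 by (auto simp: sphere_compl_wave ahl_def less_imp_le)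
  have "sphere_holomorphic_on ahl (sphere_compl wave)"
    unfolding sphere_holomorphic_on_def Some_vimage_sphere_compl chart_inf_vimage_sphere_compl
    using F_holo k_holo by (simp add: ahl_chart_inf) (simp add: ahl_def)
  moreover have "bounded (ahl ` sphere_compl wave)"
    using b by (auto simp: bounded_iff)
  ultimately show "ahl \<in> H_inf (sphere_compl wave)" by (simp add: H_inf_def)
  show "deriv_inf ahl = of_real \<kappa>"
    using deriv_inf_eq(2)[of ahl] k_holo by (simp add: ahl_chart_inf deriv_k_0)
qed

lemma
  assumes g: "g \<in> H_inf (sphere_compl wave)" "\<And>p. p \<in> sphere_compl wave \<Longrightarrow> cmod (g p) \<le> 1"
  shows deriv_inf_le: "cmod (deriv_inf g) \<le> \<kappa>"
    and deriv_inf_unique: "deriv_inf g = of_real \<kappa> \<Longrightarrow> p \<in> sphere_compl wave \<Longrightarrow> g p = ahl p"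
proof -
  have K: "(\<lambda>w. g (chart_inf w)) holomorphic_on inv_dom"
    using g(1) by (simp add: H_inf_def sphere_holomorphic_on_def chart_inf_vimage_sphere_compl)
  have K1: "cmod (g (chart_inf u)) \<le> 1" if "u \<in> inv_dom" for u
    using g(2)[of "chart_inf u"] that by (simp flip: chart_inf_vimage_sphere_compl)
  show "cmod (deriv_inf g) \<le> \<kappa>"
    unfolding deriv_inf_eq(2)[OF K] by (rule extremal_le[OF K K1])
  assume d: "deriv_inf g = of_real \<kappa>" and p: "p \<in> sphere_compl wave"
  obtain u where u: "p = chart_inf u" "u \<in> inv_dom"
  proof (cases p)
    case None
    then show ?thesis using that[of 0] zero_in_inv_dom by (simp add: chart_inf_def)
  next
    case (Some z)
    then have z: "z \<notin> wave" using p by (auto simp: sphere_compl_wave)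
    then have "z \<noteq> 0" using zero_in_wave by auto
    then show ?thesis using that[of "1 / z"] Some inverse_in_inv_dom[OF z] by (simp add: chart_inf_def)
  qed
  show "g p = ahl p"
    using extremal_unique[OF K K1 _ u(2)] d deriv_inf_eq(2)[OF K] by (simp add: u(1) ahl_chart_inf)
qed

lemma analytic_capacity_wave: "analytic_capacity wave = \<kappa>"
  unfolding analytic_capacity_def outer_component_wave
proof (rule cSup_eq_maximum)
  show "\<kappa> \<in> {cmod (deriv_inf f) |f. f \<in> H_inf (sphere_compl wave) \<and> (\<forall>p\<in>sphere_compl wave. cmod (f p) \<le> 1)}"
    using ahl_extremal kappa_pos by (intro CollectI exI[of _ ahl]) auto
qed (use deriv_inf_le in blast)

lemma is_ahlfors_function_ahl: "is_ahlfors_function wave ahl"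
  unfolding is_ahlfors_function_def ahlfors_extremal_def outer_component_wave analytic_capacity_wave
  using ahl_extremal deriv_inf_unique by blast

lemma ahl_not_cauchy_transform:
  "\<not> (\<exists>\<mu>. complex_borel_measure \<mu> \<and> supported_on \<mu> wave \<and>
        (\<forall>p\<in>sphere_compl wave. ahl p = cauchy_transform \<mu> p))"
proof clarify
  fix \<mu> assume \<mu>: "complex_borel_measure \<mu>" "supported_on \<mu> wave"
    and eq: "\<forall>p\<in>sphere_compl wave. ahl p = cauchy_transform \<mu> p"
  have "F z = cm_integral \<mu> (\<lambda>\<xi>. 1 / (\<xi> - z))" if "z \<notin> wave" for z
    using bspec[OF eq, of "Some z"] that by (simp add: sphere_compl_wave ahl_def cauchy_transform_def)
  then show False by (rule F_not_cauchy_transform[OF \<mu>])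
qed

lemma charge_le_kappa:
  assumes \<mu>: "complex_borel_measure \<mu>" "supported_on \<mu> wave"
    and le: "\<forall>p\<in>sphere_compl wave. cmod (cauchy_transform \<mu> p) \<le> 1"
  shows "cmod (\<mu> wave) \<le> \<kappa>"
proof -
  have "bounded (cauchy_transform \<mu> ` sphere_compl wave)"
    using le by (auto simp: bounded_iff)
  then have "cauchy_transform \<mu> \<in> H_inf (sphere_compl wave)"
    using cauchy_transform_holomorphic[OF \<mu>] by (simp add: H_inf_def)
  then have "cmod (deriv_inf (cauchy_transform \<mu>)) \<le> \<kappa>"
    by (rule deriv_inf_le) (use le in blast)
  then show ?thesis by (simp add: deriv_inf_cauchy_transform[OF \<mu>])
qed

end

section \<open>Boundary values and primitives\<close>

definition dgam :: "real \<Rightarrow> complex" where "dgam t = Complex 1 (dwig t)"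

lemma gam_vector_derivative: "t \<noteq> 0 \<Longrightarrow> (gam has_vector_derivative dgam t) (at t)"
  using DERIV_wig[of t]
  unfolding gam_def[abs_def] dgam_def Complex_eq has_real_derivative_iff_has_vector_derivative
  by (auto intro!: derivative_eq_intros simp: has_vector_derivative_def scaleR_conv_of_real algebra_simps)

lemma dwig_measurable [measurable]: "dwig \<in> borel_measurable borel"
  unfolding dwig_def[abs_def] by measurable

lemma dgam_measurable [measurable]: "dgam \<in> borel_measurable borel"
  unfolding dgam_def[abs_def] Complex_eq by measurable

text \<open>The derivative of the phase dominates, with \<open>8 * pi < 32\<close>; the bounds are
  \<open>32 + 7 = 39\<close> and one more for the real part. The jump of the damped function has to
  absorb this growth.\<close>

lemma cmod_dgam_le: "0 < \<bar>t\<bar> \<Longrightarrow> \<bar>t\<bar> \<le> 1 \<Longrightarrow> cmod (dgam t) \<le> 40 / t\<^sup>2"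
  and abs_dwig_le: "0 < \<bar>t\<bar> \<Longrightarrow> \<bar>t\<bar> \<le> 1 \<Longrightarrow> \<bar>dwig t\<bar> \<le> 39 / t\<^sup>2"
proof -
  show d: "\<bar>dwig t\<bar> \<le> 39 / t\<^sup>2" if t: "0 < \<bar>t\<bar>" "\<bar>t\<bar> \<le> 1" for t
  proof -
    have t2: "0 < t\<^sup>2" "t\<^sup>2 \<le> 1" using t by (auto simp: abs_square_le_1)
    have "\<bar>t\<bar> ^ 6 \<le> 1" using t by (intro power_le_one) auto
    then have "\<bar>7 * t ^ 6 * sin (pi / t ^ 8)\<bar> \<le> 7 * 1"
      unfolding abs_mult power_abs by (intro mult_mono[of _ 7 _ 1, simplified]) (auto intro: mult_mono)
    also have "\<dots> \<le> 7 / t\<^sup>2" using t2 by (simp add: field_simps)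
    finally have 1: "\<bar>7 * t ^ 6 * sin (pi / t ^ 8)\<bar> \<le> 7 / t\<^sup>2" .
    have "\<bar>8 * pi * cos (pi / t ^ 8) / t\<^sup>2\<bar> = \<bar>8 * pi * cos (pi / t ^ 8)\<bar> / t\<^sup>2" by simp
    also have "\<bar>8 * pi * cos (pi / t ^ 8)\<bar> \<le> 32 * 1"
      unfolding abs_mult using pi_less_4 by (intro mult_mono) auto
    then have "\<bar>8 * pi * cos (pi / t ^ 8)\<bar> / t\<^sup>2 \<le> 32 / t\<^sup>2" using t2 by (intro divide_right_mono) auto
    finally have 2: "\<bar>8 * pi * cos (pi / t ^ 8) / t\<^sup>2\<bar> \<le> 32 / t\<^sup>2" .
    show ?thesis
      using 1 2 abs_triangle_ineq4[of "7 * t ^ 6 * sin (pi / t ^ 8)" "8 * pi * cos (pi / t ^ 8) / t\<^sup>2"]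
      unfolding dwig_def by (simp add: add_divide_distrib[symmetric])
  qed
  show "cmod (dgam t) \<le> 40 / t\<^sup>2" if t: "0 < \<bar>t\<bar>" "\<bar>t\<bar> \<le> 1" for t
  proof -
    have "0 < t\<^sup>2" "t\<^sup>2 \<le> 1" using t by (auto simp: abs_square_le_1)
    then have "1 \<le> 1 / t\<^sup>2" by simp
    moreover have "cmod (dgam t) \<le> 1 + \<bar>dwig t\<bar>" using cmod_le[of "dgam t"] by (simp add: dgam_def)
    ultimately show ?thesis using d[OF t] by (simp add: add_divide_distrib[symmetric])
  qed
qed

lemma continuous_on_dgam: "0 \<notin> S \<Longrightarrow> continuous_on S dgam"
  unfolding dgam_def[abs_def] dwig_def[abs_def] by (intro continuous_intros) auto

lemma gam_add_up: "0 < s \<Longrightarrow> gam t + \<i> * of_real s \<in> upper"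
  by (simp add: upper_def)

lemma wig_local_Lipschitz:
  assumes t: "0 < \<bar>t\<bar>" "\<bar>t\<bar> \<le> 1"
  obtains K where "0 < K" "\<And>x. \<bar>x - t\<bar> \<le> \<bar>t\<bar> / 2 \<Longrightarrow> \<bar>x\<bar> \<le> 1 \<Longrightarrow> \<bar>wig x - wig t\<bar> \<le> K * \<bar>x - t\<bar>"
proof
  show "0 < 156 / t\<^sup>2" using t by simp
  fix x assume x: "\<bar>x - t\<bar> \<le> \<bar>t\<bar> / 2" "\<bar>x\<bar> \<le> 1"
  have "norm (wig x - wig t) \<le> 156 / t\<^sup>2 * norm (x - t)"
  proof (rule field_differentiable_bound[of "closed_segment x t"])
    fix y assume "y \<in> closed_segment x t"
    then have y: "\<bar>y - t\<bar> \<le> \<bar>x - t\<bar>" "\<bar>y\<bar> \<le> 1"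
      using x t by (auto simp: closed_segment_eq_real_ivl abs_le_iff split: if_splits)
    then have yt: "\<bar>t\<bar> / 2 \<le> \<bar>y\<bar>" using x by linarith
    then have y0: "0 < \<bar>y\<bar>" using t by linarith
    then show "(wig has_field_derivative dwig y) (at y within closed_segment x t)"
      using DERIV_wig[of y] has_field_derivative_at_within by auto
    have "(\<bar>t\<bar> / 2)\<^sup>2 \<le> \<bar>y\<bar>\<^sup>2" using yt t by (intro power_mono) auto
    then have "39 / y\<^sup>2 \<le> 39 / (t\<^sup>2 / 4)" using t y0 by (intro frac_le) (auto simp: power_divide)
    then show "norm (dwig y) \<le> 156 / t\<^sup>2" using abs_dwig_le[OF y0 y(2)] by simp
  qed auto
  then show "\<bar>wig x - wig t\<bar> \<le> 156 / t\<^sup>2 * \<bar>x - t\<bar>" by simp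
qed

text \<open>Away from 0 the wave is a Lipschitz graph, so a cone stands above each of its points.
  The constants depend on \<open>t\<close>, which is enough for the existence of pointwise
  limits.\<close>

lemma ball_disjoint_wave_local:
  assumes t: "0 < \<bar>t\<bar>" "\<bar>t\<bar> \<le> 1"
  obtains A \<eta> where "0 < A" "0 < \<eta>"
    "\<And>y. 0 < y \<Longrightarrow> y \<le> \<eta> \<Longrightarrow> ball (gam t + \<i> * of_real y) (y / A) \<inter> wave = {}"
proof -
  obtain K where K: "0 < K" "\<And>x. \<bar>x - t\<bar> \<le> \<bar>t\<bar> / 2 \<Longrightarrow> \<bar>x\<bar> \<le> 1 \<Longrightarrow> \<bar>wig x - wig t\<bar> \<le> K * \<bar>x - t\<bar>"
    using wig_local_Lipschitz[OF t] by blast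
  show thesis
  proof (rule that[of "K + 1" "\<bar>t\<bar> / 2"])
    fix y assume y: "0 < y" "y \<le> \<bar>t\<bar> / 2"
    show "ball (gam t + \<i> * of_real y) (y / (K + 1)) \<inter> wave = {}"
    proof (rule ccontr)
      assume "ball (gam t + \<i> * of_real y) (y / (K + 1)) \<inter> wave \<noteq> {}"
      then obtain p where p: "dist (gam t + \<i> * of_real y) p < y / (K + 1)" "p \<in> wave" by auto
      have re: "\<bar>Re p - t\<bar> < y / (K + 1)" and im: "\<bar>Im p - (wig t + y)\<bar> < y / (K + 1)"
        using abs_Re_le_cmod[of "p - (gam t + \<i> * of_real y)"] abs_Im_le_cmod[of "p - (gam t + \<i> * of_real y)"] p(1)
        by (auto simp: dist_norm norm_minus_commute)
      have "y / (K + 1) \<le> y" using K y by (simp add: divide_le_eq)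
      then have "\<bar>wig (Re p) - wig t\<bar> \<le> K * \<bar>Re p - t\<bar>"
        using re y p(2) by (intro K(2)) (auto simp: mem_wave)
      also have "\<dots> \<le> K * (y / (K + 1))" using re K by (intro mult_left_mono) auto
      finally have "\<bar>wig (Re p) - wig t\<bar> \<le> K * (y / (K + 1))" .
      moreover have "Im p = wig (Re p)" using p(2) by (simp add: mem_wave)
      moreover have "K * (y / (K + 1)) + y / (K + 1) = (K + 1) * (y / (K + 1))"
        by (simp only: distrib_right mult_1)
      moreover have "(K + 1) * (y / (K + 1)) = y" using K(1) by simp
      ultimately show False using im by linarith
    qed
  qed (use K t in auto)
qed

context wave_map
begin

text \<open>The cone makes the clearance proportional to the height, so the vertical estimate yields
  a Cauchy sequence.\<close>

lemma F_boundary_limit: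
  assumes t: "0 < \<bar>t\<bar>" "\<bar>t\<bar> \<le> 1"
  shows "convergent (\<lambda>n. F (gam t + \<i> * of_real (1 / real (n + 2))))"
proof -
  obtain A \<eta> where A: "0 < A" "0 < \<eta>"
    "\<And>y. 0 < y \<Longrightarrow> y \<le> \<eta> \<Longrightarrow> ball (gam t + \<i> * of_real y) (y / A) \<inter> wave = {}"
    using ball_disjoint_wave_local[OF t] by blast
  have "\<forall>\<^sub>F n in sequentially. 1 / real (n + 2) < \<eta>"
    using LIMSEQ_ignore_initial_segment[OF lim_inverse_n, of 2] A(2)
    by (intro order_tendstoD(2)) (simp_all add: inverse_eq_divide)
  then obtain N where N: "\<And>n. N \<le> n \<Longrightarrow> 1 / real (n + 2) < \<eta>"
    unfolding eventually_sequentially by blast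
  have "Cauchy (\<lambda>n. F (gam t + \<i> * of_real (1 / real (n + 2))))"
  proof (rule Cauchy_quarter[of N _ "20 * A powr (3/4)"])
    fix m n assume mn: "N \<le> m" "m \<le> n"
    have "cmod (F (gam t + \<i> * of_real (1 / real (m + 2))) - F (gam t + \<i> * of_real (1 / real (n + 2))))
       \<le> 20 * A powr (3/4) * (1 / real (m + 2)) powr (1/4)"
    proof (rule F_vertical_general[OF _ _ A(1)])
      fix y assume y: "1 / real (n + 2) \<le> y" "y \<le> 1 / real (m + 2)"
      have "0 < 1 / real (n + 2)" by simp
      then have "0 < y" using y(1) by linarith
      then show "ball (gam t + \<i> * of_real y) (y / A) \<inter> wave = {}"
        using y N[OF mn(1)] by (intro A(3)) linarith+
    qed (use mn in \<open>auto intro: divide_left_mono\<close>)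
    then show "cmod (F (gam t + \<i> * of_real (1 / real (n + 2))) - F (gam t + \<i> * of_real (1 / real (m + 2))))
       \<le> 20 * A powr (3/4) * (1 / real (m + 2)) powr (1/4)"
      by (simp only: norm_minus_commute)
  qed
  then show ?thesis by (simp add: Cauchy_convergent_iff)
qed

text \<open>The representation by principal logarithms extends to the wave itself: for
  \<open>0 < |t| < 1\<close> the point \<open>gam t\<close> is on no vertical line through 0 or
  \<open>p'\<close>, so the arguments avoid the branch cut.\<close>

lemma quotient_boundary_limit:
  assumes p': "p' = 1 \<or> p' = -1" and L: "L holomorphic_on inv_dom" "L 0 = 0"
    and eL: "\<And>u. u \<in> inv_dom \<Longrightarrow> exp (L u) = (1 - 0 * u) / (1 - p' * u)"
    and t: "0 < \<bar>t\<bar>" "\<bar>t\<bar> < 1"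
  shows "convergent (\<lambda>n. L (1 / (gam t + \<i> * of_real (1 / real (n + 2)))))"
proof -
  have p'w: "p' \<in> wave" using p' one_in_wave minus_one_in_wave by auto
  have lim: "(\<lambda>n. gam t + \<i> * of_real (1 / real (n + 2))) \<longlonglongrightarrow> gam t + \<i> * of_real 0"
  proof (intro tendsto_intros)
    show "(\<lambda>n. 1 / real (n + 2)) \<longlonglongrightarrow> 0"
      using LIMSEQ_ignore_initial_segment[OF lim_inverse_n, of 2] by (simp add: inverse_eq_divide)
  qed
  have "(\<lambda>n. Ln (- \<i> * (gam t + \<i> * of_real (1 / real (n + 2)) - 0)) - Ln (- \<i> * (gam t + \<i> * of_real (1 / real (n + 2)) - p')))
    \<longlonglongrightarrow> Ln (- \<i> * (gam t + \<i> * of_real 0 - 0)) - Ln (- \<i> * (gam t + \<i> * of_real 0 - p'))"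
  proof (intro tendsto_diff tendsto_Ln tendsto_mult tendsto_const lim)
    show "- \<i> * (gam t + \<i> * of_real 0 - 0) \<notin> \<real>\<^sub>\<le>\<^sub>0" "- \<i> * (gam t + \<i> * of_real 0 - p') \<notin> \<real>\<^sub>\<le>\<^sub>0"
      using t p' by (auto simp: complex_nonpos_Reals_iff)
  qed
  moreover have "Ln (- \<i> * (gam t + \<i> * of_real (1 / real (n + 2)) - 0)) - Ln (- \<i> * (gam t + \<i> * of_real (1 / real (n + 2)) - p'))
      = L (1 / (gam t + \<i> * of_real (1 / real (n + 2))))" for n
    by (rule log_quotient_upper[OF zero_in_wave p'w L eL, symmetric]) (assumption, rule gam_add_up, simp)
  ultimately show ?thesis unfolding convergent_def by auto
qed

end

section \<open>Primitives above the wave\<close>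

lemma segment_primitive_bound:
  assumes "\<And>z. z \<in> closed_segment x y \<Longrightarrow> (G has_field_derivative \<phi> z) (at z)"
    and "\<And>z. z \<in> closed_segment x y \<Longrightarrow> cmod (\<phi> z) \<le> B"
  shows "cmod (G x - G y) \<le> B * cmod (x - y)"
proof (rule field_differentiable_bound[of "closed_segment x y" G \<phi>])
  show "(G has_field_derivative \<phi> z) (at z within closed_segment x y)" if "z \<in> closed_segment x y" for z
    by (rule has_field_derivative_at_within[OF assms(1)[OF that]])
qed (use assms in auto)

text \<open>It is instantiated with a function and with its reflection, so that the lower side of
  the wave is handled above it. Primitives allow the oscillations near 0 to be bypassed: an
  increment depends only on the end points.\<close>

locale upper_primitive =
  fixes \<phi> G :: "complex \<Rightarrow> complex" and B \<eta> :: real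
  assumes G: "\<And>z. z \<in> upper \<Longrightarrow> (G has_field_derivative \<phi> z) (at z)"
    and bound: "\<And>z. z \<in> upper \<Longrightarrow> infdist z wave < \<eta> \<Longrightarrow> cmod (\<phi> z) \<le> B"
    and eta: "0 < \<eta>"
begin

lemma bound_near: "z \<in> upper \<Longrightarrow> p \<in> wave \<Longrightarrow> cmod (z - p) < \<eta> \<Longrightarrow> cmod (\<phi> z) \<le> B"
  using infdist_le[of p wave z] bound[of z] by (simp add: dist_norm)

text \<open>A slanted segment in \<open>upper\<close> leads from a point over the end of the arc to
  the real axis beyond it, where the primitives of the two sides can be compared.\<close>

lemma primitive_at_end:
  assumes s: "0 < s" "2 * s < \<eta>" and e: "e = 1 \<or> e = (- 1 :: real)"
  shows "cmod (G (gam e + \<i> * of_real s) - G (of_real (e * (1 + s)))) \<le> 2 * B * s"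
proof -
  have g: "gam e = of_real e" using e gam_minus[of 1] by auto
  have seg: "z \<in> upper \<and> cmod (z - of_real e) < \<eta>"
    if "z \<in> closed_segment (gam e + \<i> * of_real s) (of_real (e * (1 + s)))" for z
  proof -
    have "\<exists>v. 0 \<le> v \<and> v \<le> 1 \<and> z = (1 - v) *\<^sub>R (gam e + \<i> * of_real s) + v *\<^sub>R of_real (e * (1 + s))"
      using that by (simp only: in_segment)
    then obtain v where v': "0 \<le> v \<and> v \<le> 1 \<and> z = (1 - v) *\<^sub>R (gam e + \<i> * of_real s) + v *\<^sub>R of_real (e * (1 + s))" ..
    note v = v'[THEN conjunct1] v'[THEN conjunct2, THEN conjunct1] v'[THEN conjunct2, THEN conjunct2]
    have re: "Re z = e + v * (e * s)" and im: "Im z = (1 - v) * s"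
      unfolding v(3) by (simp_all add: g algebra_simps)
    have "\<bar>Re z\<bar> = 1 + v * s" using e
    proof
      assume "e = 1"
      then show ?thesis using re v(1) s by simp
    next
      assume "e = - 1"
      then have "Re z = - (1 + v * s)" using re by simp
      then show ?thesis using v(1) s by (simp only: abs_minus_cancel) simp
    qed
    then have "z \<in> upper"
      using im v(1) s re e by (cases "v = 0") (auto simp: upper_def mult_le_0_iff)
    moreover have "cmod (z - of_real e) \<le> \<bar>v * (e * s)\<bar> + \<bar>(1 - v) * s\<bar>"
      using cmod_le[of "z - of_real e"] re im by simp
    moreover have "\<bar>v * (e * s)\<bar> + \<bar>(1 - v) * s\<bar> = s" using e v(1,2) s by (auto simp: abs_mult algebra_simps)
    ultimately show ?thesis using s by auto
  qed
  have ew: "of_real e \<in> wave" using e one_in_wave minus_one_in_wave by auto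
  have B0: "0 \<le> B"
    by (rule order_trans[OF norm_ge_zero bound_near[OF _ ew, of "gam e + \<i> * of_real s"]])
       (use seg[of "gam e + \<i> * of_real s"] in auto)
  have 1: "cmod (G (gam e + \<i> * of_real s) - G (of_real (e * (1 + s)))) \<le> B * cmod ((gam e + \<i> * of_real s) - of_real (e * (1 + s)))"
    by (rule segment_primitive_bound) (use seg G bound_near ew in blast)+
  have "cmod ((gam e + \<i> * of_real s) - of_real (e * (1 + s))) \<le> \<bar>- e * s\<bar> + \<bar>s\<bar>"
    using cmod_le[of "(gam e + \<i> * of_real s) - of_real (e * (1 + s))"] by (simp add: g algebra_simps)
  also have "\<dots> = 2 * s" using e s by auto
  finally have "B * cmod ((gam e + \<i> * of_real s) - of_real (e * (1 + s))) \<le> B * (2 * s)"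
    using B0 by (rule mult_left_mono)
  then show ?thesis using 1 by linarith
qed

text \<open>The path rises to height \<open>2 * \<epsilon>\<close>, crosses and descends. It has
  length at most \<open>3 * \<epsilon> + 2 * \<epsilon> + 3 * \<epsilon>\<close>, however long the
  wave below it is.\<close>

lemma primitive_across_0:
  assumes s: "0 < s" "s \<le> \<epsilon>" and e: "\<epsilon> \<le> 1/2" "4 * \<epsilon> < \<eta>"
  shows "cmod (G (gam \<epsilon> + \<i> * of_real s) - G (gam (- \<epsilon>) + \<i> * of_real s)) \<le> 8 * B * \<epsilon>"
proof -
  have e0: "0 < \<epsilon>" using s by linarith
  have wg: "\<bar>wig x\<bar> \<le> \<epsilon>" if "\<bar>x\<bar> \<le> \<epsilon>" for x
  proof -
    have "\<bar>wig x\<bar> \<le> \<bar>x\<bar> ^ 7" by (rule abs_wig_le)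
    also have "\<dots> \<le> \<bar>x\<bar> ^ 1" using that e by (intro power_decreasing) auto
    finally show ?thesis using that by simp
  qed
  have near: "cmod (\<phi> z) \<le> B" if "z \<in> upper" "\<bar>Re z\<bar> \<le> \<epsilon>" "\<bar>Im z\<bar> \<le> 2 * \<epsilon>" for z
    using cmod_le[of z] that e e0 by (intro bound_near[OF _ zero_in_wave]) auto
  have vert: "cmod (G (gam x + \<i> * of_real s) - G (Complex x (2 * \<epsilon>))) \<le> B * (3 * \<epsilon>)" if x: "\<bar>x\<bar> \<le> \<epsilon>" for x
  proof -
    have eq: "gam x + \<i> * of_real s = Complex x (wig x + s)" by (simp add: complex_eq_iff)
    have seg: "z \<in> upper \<and> \<bar>Re z\<bar> \<le> \<epsilon> \<and> \<bar>Im z\<bar> \<le> 2 * \<epsilon>"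
      if "z \<in> closed_segment (Complex x (wig x + s)) (Complex x (2 * \<epsilon>))" for z
    proof -
      have "Re z = x" "wig x + s \<le> Im z" "Im z \<le> 2 * \<epsilon>"
        using that wg[OF x] s by (auto simp: closed_segment_same_Re closed_segment_eq_real_ivl split: if_splits)
      then show ?thesis using wg[OF x] s x by (auto simp: upper_def abs_le_iff)
    qed
    have "cmod (G (Complex x (wig x + s)) - G (Complex x (2 * \<epsilon>))) \<le> B * cmod (Complex x (wig x + s) - Complex x (2 * \<epsilon>))"
      by (rule segment_primitive_bound) (use seg G near in blast)+
    also have "cmod (Complex x (wig x + s) - Complex x (2 * \<epsilon>)) = \<bar>wig x + s - 2 * \<epsilon>\<bar>" by (simp add: cmod_def)
    also have "B * \<bar>wig x + s - 2 * \<epsilon>\<bar> \<le> B * (3 * \<epsilon>)"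
    proof (rule mult_left_mono)
      show "\<bar>wig x + s - 2 * \<epsilon>\<bar> \<le> 3 * \<epsilon>" using wg[OF x] s by linarith
      show "0 \<le> B"
        by (rule order_trans[OF norm_ge_zero near[of "Complex x (2 * \<epsilon>)"]])
           (use seg[of "Complex x (2 * \<epsilon>)"] in auto)
    qed
    finally show ?thesis unfolding eq .
  qed
  have seg: "z \<in> upper \<and> \<bar>Re z\<bar> \<le> \<epsilon> \<and> \<bar>Im z\<bar> \<le> 2 * \<epsilon>"
    if "z \<in> closed_segment (Complex \<epsilon> (2 * \<epsilon>)) (Complex (- \<epsilon>) (2 * \<epsilon>))" for z
  proof -
    have "Im z = 2 * \<epsilon>" "\<bar>Re z\<bar> \<le> \<epsilon>"
      using that e0 by (auto simp: closed_segment_same_Im closed_segment_eq_real_ivl split: if_splits)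
    then show ?thesis using wg[of "Re z"] e0 by (auto simp: upper_def)
  qed
  have "cmod (G (Complex \<epsilon> (2 * \<epsilon>)) - G (Complex (- \<epsilon>) (2 * \<epsilon>))) \<le> B * cmod (Complex \<epsilon> (2 * \<epsilon>) - Complex (- \<epsilon>) (2 * \<epsilon>))"
    by (rule segment_primitive_bound) (use seg G near in blast)+
  also have "cmod (Complex \<epsilon> (2 * \<epsilon>) - Complex (- \<epsilon>) (2 * \<epsilon>)) = 2 * \<epsilon>"
  proof -
    have "Complex \<epsilon> (2 * \<epsilon>) - Complex (- \<epsilon>) (2 * \<epsilon>) = of_real (2 * \<epsilon>)" by (simp add: complex_eq_iff)
    then show ?thesis using e0 by (simp add: norm_mult)
  qed
  finally have h: "cmod (G (Complex \<epsilon> (2 * \<epsilon>)) - G (Complex (- \<epsilon>) (2 * \<epsilon>))) \<le> B * (2 * \<epsilon>)" .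
  have "cmod (G (gam \<epsilon> + \<i> * of_real s) - G (gam (- \<epsilon>) + \<i> * of_real s)) \<le>
     cmod (G (gam \<epsilon> + \<i> * of_real s) - G (Complex \<epsilon> (2 * \<epsilon>))) + cmod (G (Complex \<epsilon> (2 * \<epsilon>)) - G (Complex (- \<epsilon>) (2 * \<epsilon>)))
     + cmod (G (gam (- \<epsilon>) + \<i> * of_real s) - G (Complex (- \<epsilon>) (2 * \<epsilon>)))"
    by norm
  then show ?thesis using vert[of \<epsilon>] vert[of "- \<epsilon>"] h e0 by simp
qed

text \<open>Along large upper semicircles \<open>G\<close> behaves like \<open>- a * Ln (- \<i> * z)\<close>.\<close>

lemma primitive_semicircle:
  assumes asym: "\<And>z. z \<in> upper \<Longrightarrow> R0 \<le> cmod z \<Longrightarrow> cmod (\<phi> z + a / z) \<le> C / (cmod z)\<^sup>2" and R0: "2 \<le> R0"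
  shows "((\<lambda>R. G (- of_real R) - G (of_real R)) \<longlongrightarrow> - \<i> * pi * a) at_top"
proof (rule LIM_zero_cancel, rule Lim_null_comparison)
  have "((\<lambda>R::real. C * pi * inverse R) \<longlongrightarrow> C * pi * 0) at_top"
    by (intro tendsto_mult tendsto_const tendsto_inverse_0_at_top filterlim_ident)
  then show "((\<lambda>R::real. C * pi * inverse R) \<longlongrightarrow> 0) at_top" by simp
  show "\<forall>\<^sub>F R in at_top. norm (G (- of_real R) - G (of_real R) - - \<i> * pi * a) \<le> C * pi * inverse R"
    using eventually_gt_at_top[of R0]
  proof eventually_elim
    case (elim R)
    have R: "2 < R" using elim R0 by simp
    \<comment> \<open>Its derivative is \<open>\<phi> z + a / z\<close>, of size at most
      \<open>C / R^2\<close> on a semicircle of length \<open>pi * R\<close>.\<close>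
    define H where "H z = G z + a * Ln (- \<i> * z)" for z
    define c where "c \<theta> = of_real R * cis \<theta>" for \<theta>
    have c: "c \<theta> \<in> upper" "cmod (c \<theta>) = R" "- \<i> * c \<theta> \<notin> \<real>\<^sub>\<le>\<^sub>0" "c \<theta> \<noteq> 0" if "0 \<le> \<theta>" "\<theta> \<le> pi" for \<theta>
    proof -
      show n: "cmod (c \<theta>) = R" using R by (simp add: c_def norm_mult)
      then show nz: "c \<theta> \<noteq> 0" using R by auto
      have im: "0 \<le> Im (c \<theta>)" using that R sin_ge_zero[of \<theta>] by (simp add: c_def)
      show "- \<i> * c \<theta> \<notin> \<real>\<^sub>\<le>\<^sub>0"
        using im nz by (auto simp: complex_nonpos_Reals_iff complex_eq_iff)
      show "c \<theta> \<in> upper"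
      proof (cases "\<bar>Re (c \<theta>)\<bar> \<le> 1")
        case True
        then have "1 < Im (c \<theta>)" using cmod_le[of "c \<theta>"] n R im by linarith
        then show ?thesis using halfplane_subset_upper by blast
      qed (simp add: upper_def)
    qed
    have dH: "(H has_field_derivative \<phi> z + a / z) (at z)" if "z \<in> upper" "- \<i> * z \<notin> \<real>\<^sub>\<le>\<^sub>0" "z \<noteq> 0" for z
    proof -
      have "((\<lambda>z. Ln (- \<i> * z)) has_field_derivative inverse (- \<i> * z) * (- \<i>)) (at z)"
        by (rule DERIV_chain2[of Ln _ "\<lambda>z. - \<i> * z"])
          (use has_field_derivative_Ln[OF that(2)] in \<open>auto intro!: derivative_eq_intros\<close>)
      then have "((\<lambda>z. Ln (- \<i> * z)) has_field_derivative 1 / z) (at z)"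
        using that(3) by (simp add: field_simps)
      from DERIV_add[OF G[OF that(1)] DERIV_cmult[OF this, of a]]
      show ?thesis by (simp add: H_def[abs_def])
    qed
    have hv: "((\<lambda>\<theta>. H (c \<theta>)) has_vector_derivative (\<i> * c \<theta>) * (\<phi> (c \<theta>) + a / c \<theta>)) (at \<theta>)" if "0 \<le> \<theta>" "\<theta> \<le> pi" for \<theta>
    proof -
      have "(c has_vector_derivative \<i> * c \<theta>) (at \<theta>)"
      proof -
        have "((\<lambda>\<theta>. \<i> * of_real \<theta>) has_vector_derivative \<i>) (at \<theta>)"
          by (auto intro!: derivative_eq_intros simp: has_vector_derivative_def scaleR_conv_of_real)
        from field_vector_diff_chain_at[OF this DERIV_exp]
        have "((\<lambda>\<theta>. exp (\<i> * of_real \<theta>)) has_vector_derivative \<i> * exp (\<i> * of_real \<theta>)) (at \<theta>)"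
          by (simp add: o_def)
        from has_vector_derivative_mult_right[OF this, of "of_real R"]
        show ?thesis unfolding c_def[abs_def] cis_conv_exp by (simp add: mult.left_commute)
      qed
      from field_vector_diff_chain_at[OF this dH[OF c(1,3,4)[OF that]]]
      show ?thesis by (simp add: o_def)
    qed
    have "norm (H (c pi) - H (c 0)) \<le> C * inverse R * pi - C * inverse R * 0"
    proof (rule differentiable_bound_general)
      show "continuous_on {0..pi} (\<lambda>\<theta>. H (c \<theta>))"
        by (rule continuous_on_vector_derivative, rule has_vector_derivative_at_within, rule hv) auto
      show "((\<lambda>\<theta>. H (c \<theta>)) has_vector_derivative (\<i> * c \<theta>) * (\<phi> (c \<theta>) + a / c \<theta>)) (at \<theta>)" if "0 < \<theta>" "\<theta> < pi" for \<theta>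
        using hv that by simp
      show "((\<lambda>\<theta>. C * inverse R * \<theta>) has_vector_derivative C * inverse R) (at \<theta>)" for \<theta>
        unfolding has_real_derivative_iff_has_vector_derivative[symmetric] by (auto intro!: derivative_eq_intros)
      show "norm ((\<i> * c \<theta>) * (\<phi> (c \<theta>) + a / c \<theta>)) \<le> C * inverse R" if "0 < \<theta>" "\<theta> < pi" for \<theta>
      proof -
        have "norm (\<phi> (c \<theta>) + a / c \<theta>) \<le> C / R\<^sup>2"
          using asym[OF c(1), of \<theta>] c(2)[of \<theta>] that elim by simp
        then have "R * norm (\<phi> (c \<theta>) + a / c \<theta>) \<le> R * (C / R\<^sup>2)" using R by (intro mult_left_mono) auto
        also have "\<dots> = C * inverse R" using R by (simp add: power2_eq_square field_simps)
        finally show ?thesis using c(2)[of \<theta>] that by (simp add: norm_mult)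
      qed
    qed (auto intro!: continuous_intros)
    moreover have "c pi = - of_real R" "c 0 = of_real R" by (simp_all add: c_def)
    moreover have "H (- of_real R) - H (of_real R) = G (- of_real R) - G (of_real R) - - \<i> * pi * a"
    proof -
      have l: "Ln (- \<i> * - of_real R) = ln R + \<i> * pi / 2" "Ln (- \<i> * of_real R) = ln R - \<i> * pi / 2"
        using R Ln_times_of_real[of R \<i>] Ln_times_of_real[of R "- \<i>"]
        by (simp_all add: mult.commute Ln_of_real)
      show ?thesis unfolding H_def l by (simp add: algebra_simps)
    qed
    ultimately show ?case by (simp add: mult_ac)
  qed
qed

end

section \<open>The damped Ahlfors function\<close>

text \<open>Multiplying \<open>F\<close> by \<open>(s / (s + \<delta>)) ^ 8\<close>, where \<open>s\<close> is the fourth root of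
  \<open>z / (z - 1)\<close>, makes the jump across the wave integrable with respect to arc length.\<close>

locale damped_map = wave_map +
  fixes L :: "complex \<Rightarrow> complex" and \<delta> :: real
  assumes L_holo: "L holomorphic_on inv_dom" and L_0: "L 0 = 0"
    and exp_L: "\<And>u. u \<in> inv_dom \<Longrightarrow> exp (L u) = (1 - 0 * u) / (1 - 1 * u)"
    and Im_L: "\<And>u. u \<in> inv_dom \<Longrightarrow> \<bar>Im (L u)\<bar> \<le> 2 * pi"
    and delta_pos: "0 < \<delta>"
begin

text \<open>The damping factor as a function of the logarithm \<open>w\<close>, whose fourth root is
  \<open>exp (w / 4)\<close>; limits of the logarithm then give limits of the factor.\<close>

definition q :: "complex \<Rightarrow> complex" where "q w = (exp (w / 4) / (exp (w / 4) + of_real \<delta>)) ^ 8"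
definition kq :: "complex \<Rightarrow> complex" where "kq u = k u * q (L u)"
definition \<Phi> :: "complex \<Rightarrow> complex" where "\<Phi> z = kq (1 / z)"

lemma Re_root: "u \<in> inv_dom \<Longrightarrow> 0 \<le> Re (exp (L u / 4))"
proof -
  assume u: "u \<in> inv_dom"
  have "0 \<le> cos (Im (L u) / 4)" using Im_L[OF u] by (intro cos_ge_zero) auto
  then show ?thesis by (simp add: Re_exp)
qed

lemma root_nonzero: "u \<in> inv_dom \<Longrightarrow> exp (L u / 4) + of_real \<delta> \<noteq> 0"
  using Re_root[of u] delta_pos by (auto simp: complex_eq_iff)

text \<open>As the root \<open>s\<close> has nonnegative real part, \<open>|s + \<delta>|\<close> is
  at least \<open>|s|\<close> and at least \<open>\<delta>\<close>. The second bound uses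
  \<open>s^4 = 1 / (1 - u) = z / (z - 1)\<close>, so \<open>s^8\<close> vanishes to second order at
  \<open>z = 0\<close>.\<close>

lemma q_bounds:
  assumes u: "u \<in> inv_dom"
  shows "cmod (q (L u)) \<le> 1" "cmod (q (L u)) \<le> (cmod (1 / (1 - u)))\<^sup>2 / \<delta> ^ 8"
proof -
  define s where "s = exp (L u / 4)"
  have re: "0 \<le> Re s" using Re_root[OF u] by (simp add: s_def)
  have "(cmod s)\<^sup>2 \<le> (cmod (s + of_real \<delta>))\<^sup>2"
    using re delta_pos unfolding cmod_power2 by (simp add: power2_eq_square algebra_simps)
  then have 1: "cmod s \<le> cmod (s + of_real \<delta>)" by (rule power2_le_imp_le) simp
  have 2: "\<delta> \<le> cmod (s + of_real \<delta>)"
    using complex_Re_le_cmod[of "s + of_real \<delta>"] re by simp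
  have q: "cmod (q (L u)) = (cmod s / cmod (s + of_real \<delta>)) ^ 8"
    by (simp add: q_def s_def norm_power norm_divide)
  show "cmod (q (L u)) \<le> 1"
    unfolding q using 1 2 delta_pos by (intro power_le_one) (auto simp: divide_le_eq_1)
  have "cmod (q (L u)) \<le> (cmod s / \<delta>) ^ 8"
  proof -
    have "0 < cmod (s + of_real \<delta>)" using 2 delta_pos by linarith
    then show ?thesis
      unfolding q using 2 delta_pos by (intro power_mono divide_left_mono mult_pos_pos) auto
  qed
  also have "\<dots> = (cmod (s ^ 4))\<^sup>2 / \<delta> ^ 8" by (simp add: power_divide norm_power flip: power_mult)
  also have "s ^ 4 = 1 / (1 - u)"
    using exp_L[OF u] by (simp add: s_def flip: exp_of_nat_mult)
  finally show "cmod (q (L u)) \<le> (cmod (1 / (1 - u)))\<^sup>2 / \<delta> ^ 8" .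
qed

lemma kq_holo: "kq holomorphic_on inv_dom"
  unfolding kq_def[abs_def] q_def
  using root_nonzero by (intro holomorphic_intros k_holo L_holo) auto

lemma kq_le_1: "u \<in> inv_dom \<Longrightarrow> cmod (kq u) \<le> 1"
  unfolding kq_def norm_mult using k_inv[of u] q_bounds(1)[of u] by (intro mult_le_one) (auto simp: less_imp_le)

lemma kq_0: "kq 0 = 0"
  by (simp add: kq_def k_0)

lemma deriv_kq_0: "deriv kq 0 = of_real (\<kappa> / (1 + \<delta>) ^ 8)"
proof -
  have "(\<lambda>u. q (L u)) holomorphic_on inv_dom"
    unfolding q_def using root_nonzero by (intro holomorphic_intros L_holo) auto
  then have "((\<lambda>u. q (L u)) has_field_derivative deriv (\<lambda>u. q (L u)) 0) (at 0)"
    by (rule holomorphic_derivI[OF _ open_inv_dom zero_in_inv_dom])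
  from DERIV_mult[OF holomorphic_derivI[OF k_holo open_inv_dom zero_in_inv_dom] this]
  have "(kq has_field_derivative of_real \<kappa> * q (L 0)) (at 0)"
    by (simp add: kq_def[abs_def] k_0 deriv_k_0)
  then have "deriv kq 0 = of_real \<kappa> * q (L 0)" by (rule DERIV_imp_deriv)
  then show ?thesis by (simp add: L_0 q_def power_divide)
qed

lemma \<Phi>_holo: "\<Phi> holomorphic_on - wave"
  unfolding \<Phi>_def[abs_def]
  by (rule holomorphic_on_comp[OF kq_holo])
     (use zero_in_wave in \<open>auto simp: inverse_in_inv_dom intro!: holomorphic_intros\<close>)

lemma \<Phi>_le_1: "z \<notin> wave \<Longrightarrow> cmod (\<Phi> z) \<le> 1"
  unfolding \<Phi>_def by (rule kq_le_1[OF inverse_in_inv_dom])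

lemma \<Phi>_le:
  assumes z: "z \<notin> wave" shows "cmod (\<Phi> z) \<le> (cmod z / cmod (z - 1))\<^sup>2 / \<delta> ^ 8"
proof -
  note u = inverse_in_inv_dom[OF z]
  have z0: "z \<noteq> 0" using z zero_in_wave by auto
  have "cmod (\<Phi> z) \<le> 1 * cmod (q (L (1 / z)))"
    unfolding \<Phi>_def kq_def norm_mult using k_inv[OF u] by (intro mult_right_mono) (auto simp: less_imp_le)
  also have "\<dots> \<le> (cmod (1 / (1 - 1 / z)))\<^sup>2 / \<delta> ^ 8" using q_bounds(2)[OF u] by simp
  also have "1 / (1 - 1 / z) = z / (z - 1)" using z0 by (simp add: divide_simps)
  finally show ?thesis by (simp add: norm_divide)
qed

lemma \<Phi>_decay: obtains C where "0 \<le> C" "\<And>z. 4 \<le> cmod z \<Longrightarrow> cmod (\<Phi> z) \<le> C / cmod z"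
proof -
  have cb: "cball 0 (1/4) \<subseteq> inv_dom"
  proof
    fix u :: complex assume u: "u \<in> cball 0 (1/4)"
    show "u \<in> inv_dom"
    proof (rule ccontr)
      assume "u \<notin> inv_dom"
      then have w: "u \<noteq> 0" "1 / u \<in> wave" by (auto simp: inv_dom_def)
      have "1 / cmod u \<le> 2" using cmod_wave_le[OF w(2)] by (simp add: norm_divide)
      then show False using u w(1) by (simp add: divide_le_eq)
    qed
  qed
  have "continuous_on (cball 0 (1/4)) (deriv kq)"
    by (rule holomorphic_on_imp_continuous_on, rule holomorphic_on_subset[OF holomorphic_deriv[OF kq_holo open_inv_dom] cb])
  then have "bounded (deriv kq ` cball 0 (1/4))" by (intro compact_imp_bounded compact_continuous_image) auto
  then obtain C where "\<forall>x \<in> deriv kq ` cball 0 (1/4). cmod x \<le> C"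
    unfolding bounded_iff by (elim exE)
  then have C: "cmod (deriv kq u) \<le> C" if "u \<in> cball 0 (1/4)" for u
    using that by blast
  show thesis
  proof (rule that)
    show "0 \<le> C" by (rule order_trans[OF norm_ge_zero C[of 0]]) simp
    fix z :: complex assume z: "4 \<le> cmod z"
    then have "0 < cmod z" by linarith
    then have "1 / cmod z \<le> 1 / 4" using z by (intro frac_le) auto
    then have zi: "1 / z \<in> cball 0 (1/4)" by (simp only: mem_cball dist_0_norm norm_divide norm_one)
    have "cmod (kq (1 / z) - kq 0) \<le> C * cmod (1 / z - 0)"
    proof (rule field_differentiable_bound[of "cball 0 (1/4)" kq "deriv kq"])
      fix u :: complex assume u: "u \<in> cball 0 (1/4)"
      then have "u \<in> inv_dom" using cb by blast
      then show "(kq has_field_derivative deriv kq u) (at u within cball 0 (1/4))"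
        by (rule has_field_derivative_at_within[OF holomorphic_derivI[OF kq_holo open_inv_dom]])
    qed (use C zi in simp_all)
    then show "cmod (\<Phi> z) \<le> C / cmod z" by (simp add: \<Phi>_def kq_0 norm_divide)
  qed
qed

section \<open>Boundary values of the damped function and their jump\<close>

definition step :: "nat \<Rightarrow> real" where "step n = 1 / real (n + 2)"

lemma step_pos: "0 < step n" and step_lim: "step \<longlonglongrightarrow> 0"
  using LIMSEQ_ignore_initial_segment[OF lim_inverse_n, of 2]
  by (simp_all add: step_def[abs_def] inverse_eq_divide)

text \<open>Boundary values from above and below; the latter are taken through the reflection
  \<open>z \<mapsto> - z\<close>, so that only the upper side of the wave has to be considered.\<close>

definition up :: "nat \<Rightarrow> real \<Rightarrow> complex" where "up n t = \<Phi> (gam t + \<i> * of_real (step n))"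
definition dn :: "nat \<Rightarrow> real \<Rightarrow> complex" where "dn n t = \<Phi> (- (gam (- t) + \<i> * of_real (step n)))"

lemma graph_notin_wave: "gam t + \<i> * of_real (step n) \<notin> wave"
  using gam_add_up[OF step_pos] upper_Un_lower by blast

lemma graph_notin_wave': "- (gam t + \<i> * of_real (step n)) \<notin> wave"
  using graph_notin_wave by (simp only: uminus_mem_wave not_False_eq_True)

text \<open>The limit of the root still has nonnegative real part, so the denominator of
  \<open>q\<close> stays away from 0 and the limits of \<open>F\<close> and of the logarithm
  combine. From below, \<open>k\<close> is odd and \<open>L (- u)\<close> is a logarithm of the same
  kind with \<open>p' = -1\<close>.\<close>

lemma convergent_up_dn:
  assumes t: "0 < \<bar>t\<bar>" "\<bar>t\<bar> < 1"
  shows "convergent (\<lambda>n. up n t)" "convergent (\<lambda>n. dn n t)"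
proof -
  have comb: "convergent (\<lambda>n. f n * q (l n))"
    if f: "convergent f" and l: "convergent l" and im: "\<And>n. 0 \<le> Re (exp (l n / 4))" for f l :: "nat \<Rightarrow> complex"
  proof -
    obtain a where a: "l \<longlonglongrightarrow> a" using l unfolding convergent_def by blast
    obtain b where b: "f \<longlonglongrightarrow> b" using f unfolding convergent_def by blast
    have e: "(\<lambda>n. exp (l n / 4)) \<longlonglongrightarrow> exp (a / 4)" by (intro tendsto_intros a) simp
    then have "(\<lambda>n. Re (exp (l n / 4))) \<longlonglongrightarrow> Re (exp (a / 4))" by (rule tendsto_Re)
    then have "0 \<le> Re (exp (a / 4))" by (rule LIMSEQ_le_const) (use im in auto)
    then have "exp (a / 4) + of_real \<delta> \<noteq> 0" using delta_pos by (auto simp: complex_eq_iff)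
    then have "(\<lambda>n. f n * q (l n)) \<longlonglongrightarrow> b * q a"
      unfolding q_def by (intro tendsto_intros e b)
    then show ?thesis unfolding convergent_def by blast
  qed
  show "convergent (\<lambda>n. up n t)"
  proof -
    have "convergent (\<lambda>n. F (gam t + \<i> * of_real (step n)) * q (L (1 / (gam t + \<i> * of_real (step n)))))"
    proof (rule comb)
      show "convergent (\<lambda>n. F (gam t + \<i> * of_real (step n)))"
        unfolding step_def using t by (intro F_boundary_limit) auto
      show "convergent (\<lambda>n. L (1 / (gam t + \<i> * of_real (step n))))"
        unfolding step_def by (rule quotient_boundary_limit[OF _ L_holo L_0 exp_L t]) auto
    qed (rule Re_root[OF inverse_in_inv_dom[OF graph_notin_wave]])
    then show ?thesis by (simp add: up_def \<Phi>_def kq_def F_def)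
  qed
  show "convergent (\<lambda>n. dn n t)"
  proof -
    have L': "(\<lambda>u. L (- u)) holomorphic_on inv_dom"
      by (rule holomorphic_on_comp[OF L_holo]) (auto simp: uminus_mem_inv_dom intro!: holomorphic_intros)
    have m: "1 / - (gam (- t) + \<i> * of_real (step n)) = - (1 / (gam (- t) + \<i> * of_real (step n)))" for n
      by (rule minus_divide_right[symmetric])
    have "convergent (\<lambda>n. (- F (gam (- t) + \<i> * of_real (step n))) * q (L (- (1 / (gam (- t) + \<i> * of_real (step n))))))"
    proof (rule comb)
      show "convergent (\<lambda>n. - F (gam (- t) + \<i> * of_real (step n)))"
        unfolding step_def convergent_minus_iff[symmetric] using t by (intro F_boundary_limit) auto
      show "convergent (\<lambda>n. L (- (1 / (gam (- t) + \<i> * of_real (step n)))))"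
        unfolding step_def
        by (rule quotient_boundary_limit[where p' = "-1" and L = "\<lambda>u. L (- u)", OF _ L'])
           (use exp_L uminus_mem_inv_dom t in \<open>auto simp: L_0\<close>)
      show "0 \<le> Re (exp (L (- (1 / (gam (- t) + \<i> * of_real (step n)))) / 4))" for n
        by (rule Re_root) (simp only: uminus_mem_inv_dom inverse_in_inv_dom[OF graph_notin_wave])
    qed
    moreover have "dn n t = (- F (gam (- t) + \<i> * of_real (step n))) * q (L (- (1 / (gam (- t) + \<i> * of_real (step n)))))" for n
      unfolding dn_def \<Phi>_def kq_def m k_odd[OF inverse_in_inv_dom[OF graph_notin_wave]] F_def ..
    ultimately show ?thesis by simp
  qed
qed

text \<open>\<open>lim\<close> is meaningful where \<open>convergent_up_dn\<close> applies; the
  remaining point \<open>t = 0\<close> is a null set.\<close>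

definition jump :: "real \<Rightarrow> complex" where
  "jump t = indicator {-1<..<1} t * (lim (\<lambda>n. up n t) - lim (\<lambda>n. dn n t))"

lemma up_dn_measurable [measurable]: "up n \<in> borel_measurable borel" "dn n \<in> borel_measurable borel"
proof -
  have c: "continuous_on (- wave) \<Phi>" by (rule holomorphic_on_imp_continuous_on[OF \<Phi>_holo])
  show "up n \<in> borel_measurable borel"
    unfolding up_def
    by (intro borel_measurable_continuous_onI continuous_on_compose2[OF c])
       (use graph_notin_wave in \<open>auto intro!: continuous_intros continuous_on_gam\<close>)
  show "dn n \<in> borel_measurable borel"
    unfolding dn_def
    by (intro borel_measurable_continuous_onI continuous_on_compose2[OF c])
       (use graph_notin_wave' in \<open>auto intro!: continuous_intros continuous_on_compose2[OF continuous_on_gam[of UNIV]]\<close>)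
qed

lemma jump_measurable [measurable]: "jump \<in> borel_measurable borel"
  unfolding jump_def by measurable

lemma jump_LIMSEQ:
  assumes "0 < \<bar>t\<bar>" "\<bar>t\<bar> < 1" shows "(\<lambda>n. up n t - dn n t) \<longlonglongrightarrow> jump t"
proof -
  have "jump t = lim (\<lambda>n. up n t) - lim (\<lambda>n. dn n t)"
    using assms(2) by (simp add: jump_def abs_less_iff)
  then show ?thesis
    using convergent_up_dn[OF assms] by (simp only: convergent_LIMSEQ_iff tendsto_diff)
qed

lemma up_dn_le_1: "cmod (up n t) \<le> 1" "cmod (dn n t) \<le> 1"
  unfolding up_def dn_def using \<Phi>_le_1 graph_notin_wave graph_notin_wave' by auto

lemma jump_le_2:
  assumes "0 < \<bar>t\<bar>" "\<bar>t\<bar> < 1" shows "cmod (jump t) \<le> 2"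
proof (rule LIMSEQ_le_const2[OF tendsto_norm[OF jump_LIMSEQ[OF assms]]], intro exI allI impI)
  show "cmod (up n t - dn n t) \<le> 2" for n
    using norm_triangle_ineq4[of "up n t" "dn n t"] up_dn_le_1[of n t] by linarith
qed

text \<open>The bound \<open>\<Phi>_le\<close> passes to the limit from both sides of the wave, and
  each side gives \<open>16 * t^2 / \<delta>^8\<close> since \<open>|gam t| \<le> 2 * |t|\<close>
  and \<open>|gam t - 1| \<ge> 1/2\<close>.\<close>

lemma jump_le_square:
  assumes t: "0 < \<bar>t\<bar>" "\<bar>t\<bar> \<le> 1/2" shows "cmod (jump t) \<le> 32 * t\<^sup>2 / \<delta> ^ 8"
proof -
  have t1: "\<bar>t\<bar> < 1" using t by linarith
  have 1: "(\<lambda>n. gam t + \<i> * of_real (step n)) \<longlonglongrightarrow> gam t + \<i> * of_real 0"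
    and 2: "(\<lambda>n. - (gam (- t) + \<i> * of_real (step n))) \<longlonglongrightarrow> - (gam (- t) + \<i> * of_real 0)"
    by (intro tendsto_intros step_lim)+
  define b where "b z = (cmod z / cmod (z - 1))\<^sup>2 / \<delta> ^ 8" for z
  have g1: "1/2 \<le> cmod (gam t - 1)"
    using abs_Re_le_cmod[of "gam t - 1"] t by (simp add: abs_if split: if_splits)
  then have nz: "gam t \<noteq> 1" by auto
  have "\<bar>wig t\<bar> \<le> \<bar>t\<bar>"
  proof -
    have "\<bar>wig t\<bar> \<le> \<bar>t\<bar> ^ 7" by (rule abs_wig_le)
    also have "\<dots> \<le> \<bar>t\<bar> ^ 1" using t by (intro power_decreasing) auto
    finally show ?thesis by simp
  qed
  then have g2: "cmod (gam t) \<le> 2 * \<bar>t\<bar>" using cmod_le[of "gam t"] by simp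
  have "cmod (gam t) / cmod (gam t - 1) \<le> (2 * \<bar>t\<bar>) / (1/2)"
    using g1 g2 by (intro frac_le) auto
  then have "(cmod (gam t) / cmod (gam t - 1))\<^sup>2 \<le> ((2 * \<bar>t\<bar>) / (1/2))\<^sup>2" by (intro power_mono) auto
  then have bb: "b (gam t) \<le> 16 * t\<^sup>2 / \<delta> ^ 8"
    unfolding b_def using delta_pos by (intro divide_right_mono) (auto simp: power_mult_distrib)
  have "cmod (jump t) \<le> b (gam t) + b (gam t)"
  proof (rule LIMSEQ_le[OF tendsto_norm[OF jump_LIMSEQ[OF t(1) t1]]])
    have "(\<lambda>n. b (gam t + \<i> * of_real (step n)) + b (- (gam (- t) + \<i> * of_real (step n)))) \<longlonglongrightarrow>
       b (gam t + \<i> * of_real 0) + b (- (gam (- t) + \<i> * of_real 0))"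
      unfolding b_def using nz delta_pos
      by (intro tendsto_intros 1 2) (auto simp: gam_minus)
    then show "(\<lambda>n. b (gam t + \<i> * of_real (step n)) + b (- (gam (- t) + \<i> * of_real (step n)))) \<longlonglongrightarrow> b (gam t) + b (gam t)"
      by (simp add: gam_minus)
    show "\<exists>N. \<forall>n\<ge>N. cmod (up n t - dn n t) \<le> b (gam t + \<i> * of_real (step n)) + b (- (gam (- t) + \<i> * of_real (step n)))"
    proof (intro exI allI impI order_trans[OF norm_triangle_ineq4] add_mono)
      show "cmod (up n t) \<le> b (gam t + \<i> * of_real (step n))" for n
        unfolding up_def b_def by (rule \<Phi>_le[OF graph_notin_wave])
      show "cmod (dn n t) \<le> b (- (gam (- t) + \<i> * of_real (step n)))" for n
        unfolding dn_def b_def by (rule \<Phi>_le[OF graph_notin_wave'])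
    qed
  qed
  then show ?thesis using bb by linarith
qed

text \<open>The density of the Plemelj formula: the jump times \<open>dz / (2 * pi * \<i>)\<close>,
  pulled back to the parameter interval.\<close>

definition dens :: "real \<Rightarrow> complex" where "dens t = jump t * dgam t / (2 * pi * \<i>)"

lemma dens_measurable [measurable]: "dens \<in> borel_measurable borel"
  unfolding dens_def by measurable

lemma jump_eq_0: "1 \<le> \<bar>t\<bar> \<Longrightarrow> jump t = 0"
  by (auto simp: jump_def indicator_def abs_if split: if_splits)

lemma jump_dgam_bound:
  obtains K where "\<And>t. t \<noteq> 0 \<Longrightarrow> cmod (jump t * dgam t) \<le> K * indicator {-1..1} t"
proof
  define K where "K = max (32 / \<delta> ^ 8 * 40) (2 * (40 / (1/4)))"
  fix t :: real assume t: "t \<noteq> 0"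
  show "cmod (jump t * dgam t) \<le> K * indicator {-1..1} t"
  proof (cases "\<bar>t\<bar> < 1")
    case True
    have t0: "0 < \<bar>t\<bar>" "\<bar>t\<bar> \<le> 1" using t True by auto
    have "cmod (jump t * dgam t) \<le> K"
    proof (cases "\<bar>t\<bar> \<le> 1/2")
      case True
      have "cmod (jump t) * cmod (dgam t) \<le> (32 * t\<^sup>2 / \<delta> ^ 8) * (40 / t\<^sup>2)"
        using jump_le_square[OF t0(1) True] cmod_dgam_le[OF t0] delta_pos by (intro mult_mono) auto
      also have "\<dots> = 32 / \<delta> ^ 8 * 40" using t by simp
      finally show ?thesis by (simp add: K_def norm_mult)
    next
      case False
      then have "(1/2)\<^sup>2 \<le> \<bar>t\<bar>\<^sup>2" by (intro power_mono) auto
      then have "40 / t\<^sup>2 \<le> 40 / (1/4)" by (intro divide_left_mono) (auto simp: power2_eq_square)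
      then have "cmod (jump t) * cmod (dgam t) \<le> 2 * (40 / (1/4))"
        using jump_le_2[OF t0(1) \<open>\<bar>t\<bar> < 1\<close>] cmod_dgam_le[OF t0] by (intro mult_mono) auto
      then show ?thesis by (simp add: K_def norm_mult)
    qed
    then show ?thesis using t0 by (simp add: indicator_def abs_le_iff)
  next
    case False
    have "0 \<le> K" by (simp add: K_def)
    then show ?thesis using False by (simp add: jump_eq_0)
  qed
qed

end

section \<open>Integrals of jumps across the wave\<close>

lemma upper_has_primitive:
  assumes "\<phi> holomorphic_on upper"
  shows "\<exists>G. \<forall>z\<in>upper. (G has_field_derivative \<phi> z) (at z)"
  using simply_connected_upper assms unfolding simply_connected_eq_global_primitive[OF open_upper] by blast

lemma infdist_uminus_wave: "infdist (- z) wave = infdist z wave"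
proof -
  have "infdist (- z) wave \<le> infdist z wave" for z
  proof -
    obtain p where p: "p \<in> wave" "infdist z wave = dist z p"
      using infdist_attains_inf[OF closed_wave] zero_in_wave by blast
    have "infdist (- z) wave \<le> dist (- z) (- p)" by (rule infdist_le) (simp add: uminus_mem_wave p)
    then show ?thesis using p by (simp add: dist_norm norm_minus_commute)
  qed
  from this[of z] this[of "- z"] show ?thesis by simp
qed

text \<open>\<open>G1 z + G2 (- z)\<close>, a primitive of \<open>\<psi>\<close> above minus one below the wave, is constant to the
  right of the wave and constant to its left. The difference of the two constants is computed once
  along the wave, as the integral of the jump, and once along a large circle.\<close>

locale wave_jump =
  fixes \<psi> :: "complex \<Rightarrow> complex" and J :: "real \<Rightarrow> complex" and s :: "nat \<Rightarrow> real"
    and B \<eta> K C R0 :: real and a :: complex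
  assumes holo: "\<psi> holomorphic_on - wave"
    and bound: "\<And>z. z \<notin> wave \<Longrightarrow> infdist z wave < \<eta> \<Longrightarrow> cmod (\<psi> z) \<le> B" and eta: "0 < \<eta>"
    and s_pos: "\<And>n. 0 < s n" and s_lim: "s \<longlonglongrightarrow> 0"
    and J_measurable [measurable]: "J \<in> borel_measurable borel"
    and J_lim: "\<And>t. 0 < \<bar>t\<bar> \<Longrightarrow> \<bar>t\<bar> < 1 \<Longrightarrow>
      (\<lambda>n. \<psi> (gam t + \<i> * of_real (s n)) - \<psi> (gam t - \<i> * of_real (s n))) \<longlonglongrightarrow> J t"
    and J_bound: "\<And>t. t \<noteq> 0 \<Longrightarrow> cmod (J t * dgam t) \<le> K * indicator {-1..1} t"
    and asym: "\<And>z. R0 \<le> cmod z \<Longrightarrow> cmod (\<psi> z + a / z) \<le> C / (cmod z)\<^sup>2" and R0: "2 \<le> R0"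
begin

definition G1 :: "complex \<Rightarrow> complex" where
  "G1 = (SOME G. \<forall>z\<in>upper. (G has_field_derivative \<psi> z) (at z))"
definition G2 :: "complex \<Rightarrow> complex" where
  "G2 = (SOME G. \<forall>z\<in>upper. (G has_field_derivative \<psi> (- z)) (at z))"

lemma upper_notin_wave: "z \<in> upper \<Longrightarrow> z \<notin> wave" "z \<in> upper \<Longrightarrow> - z \<notin> wave"
  using upper_Un_lower by (auto simp: uminus_mem_wave)

lemma holo_upper: "\<psi> holomorphic_on upper" "(\<lambda>z. \<psi> (- z)) holomorphic_on upper"
proof -
  show "\<psi> holomorphic_on upper" by (rule holomorphic_on_subset[OF holo]) (use upper_notin_wave in auto)
  show "(\<lambda>z. \<psi> (- z)) holomorphic_on upper"
    by (rule holomorphic_on_comp[OF holo]) (use upper_notin_wave in \<open>auto intro!: holomorphic_intros\<close>)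
qed

lemma G1_derivative: "z \<in> upper \<Longrightarrow> (G1 has_field_derivative \<psi> z) (at z)"
  using someI_ex[OF upper_has_primitive[OF holo_upper(1)]] unfolding G1_def by blast

lemma G2_derivative: "z \<in> upper \<Longrightarrow> (G2 has_field_derivative \<psi> (- z)) (at z)"
  using someI_ex[OF upper_has_primitive[OF holo_upper(2)]] unfolding G2_def by blast

sublocale p1: upper_primitive \<psi> G1 B \<eta>
  by unfold_locales
     (use G1_derivative bound upper_notin_wave eta in auto)

sublocale p2: upper_primitive "\<lambda>z. \<psi> (- z)" G2 B \<eta>
proof
  show "(G2 has_field_derivative \<psi> (- z)) (at z)" if "z \<in> upper" for z by (rule G2_derivative[OF that])
  show "cmod (\<psi> (- z)) \<le> B" if "z \<in> upper" "infdist z wave < \<eta>" for z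
    using that bound[of "- z"] upper_notin_wave(2)[of z] by (simp add: infdist_uminus_wave)
qed (rule eta)

definition d :: "nat \<Rightarrow> real \<Rightarrow> complex" where
  "d n t = (\<psi> (gam t + \<i> * of_real (s n)) - \<psi> (gam t - \<i> * of_real (s n))) * dgam t"
definition D :: "nat \<Rightarrow> real \<Rightarrow> complex" where
  "D n t = G1 (gam t + \<i> * of_real (s n)) + G2 (- gam t + \<i> * of_real (s n))"

lemma in_upper: "gam t + \<i> * of_real (s n) \<in> upper" "- gam t + \<i> * of_real (s n) \<in> upper"
  using gam_add_up[OF s_pos, of t] gam_add_up[OF s_pos, of "- t"] by (simp_all add: gam_minus)

lemma notin_wave: "gam t + \<i> * of_real (s n) \<notin> wave" "gam t - \<i> * of_real (s n) \<notin> wave"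
  using upper_notin_wave(1)[OF in_upper(1)] upper_notin_wave(2)[OF in_upper(2), of t n] by simp_all

text \<open>\<open>D n\<close> is a primitive of \<open>d n\<close>: the lower point
  \<open>gam t - \<i> * s n\<close> is minus the argument of \<open>G2\<close>, and its derivative
  brings the minus sign of the jump. The interval avoids 0, near which \<open>dgam\<close> is
  unbounded.\<close>

lemma d_integral:
  fixes l r :: real
  assumes ab: "l \<le> r" "0 \<notin> {l..r}"
  shows "set_integrable lborel {l..r} (d n)" "(LINT t:{l..r}|lborel. d n t) = D n r - D n l"
proof -
  have "continuous_on {l..r} (d n)"
    unfolding d_def[abs_def]
  proof (intro continuous_on_mult continuous_on_diff continuous_on_dgam ab)
    have cw: "continuous_on (- wave) \<psi>" by (rule holomorphic_on_imp_continuous_on[OF holo])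
    show "continuous_on {l..r} (\<lambda>t. \<psi> (gam t + \<i> * of_real (s n)))"
      by (rule continuous_on_compose2[OF cw])
         (use notin_wave in \<open>auto intro!: continuous_intros continuous_on_gam\<close>)
    show "continuous_on {l..r} (\<lambda>t. \<psi> (gam t - \<i> * of_real (s n)))"
      by (rule continuous_on_compose2[OF cw])
         (use notin_wave in \<open>auto intro!: continuous_intros continuous_on_gam\<close>)
  qed
  then show i: "set_integrable lborel {l..r} (d n)" by (rule borel_integrable_atLeastAtMost')
  have "(d n has_integral D n r - D n l) {l..r}"
  proof (rule fundamental_theorem_of_calculus[OF ab(1)])
    fix t assume t: "t \<in> {l..r}"
    then have t0: "t \<noteq> 0" using ab by auto
    have 1: "((\<lambda>t. gam t + \<i> * of_real (s n)) has_vector_derivative dgam t) (at t)"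
      and 2: "((\<lambda>t. - gam t + \<i> * of_real (s n)) has_vector_derivative - dgam t) (at t)"
      using gam_vector_derivative[OF t0] by (auto intro!: derivative_eq_intros)
    have m: "- (- gam t + \<i> * of_real (s n)) = gam t - \<i> * of_real (s n)" by simp
    have "((\<lambda>t. D n t) has_vector_derivative
        dgam t * \<psi> (gam t + \<i> * of_real (s n)) + - dgam t * \<psi> (gam t - \<i> * of_real (s n))) (at t)"
      unfolding D_def
      using has_vector_derivative_add[OF field_vector_diff_chain_at[OF 1 G1_derivative[OF in_upper(1)]]
        field_vector_diff_chain_at[OF 2 G2_derivative[OF in_upper(2)]]]
      unfolding m by (simp add: o_def)
    also have "dgam t * \<psi> (gam t + \<i> * of_real (s n)) + - dgam t * \<psi> (gam t - \<i> * of_real (s n)) = d n t"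
      by (simp add: d_def algebra_simps)
    finally show "(D n has_vector_derivative d n t) (at t within {l..r})"
      by (rule has_vector_derivative_at_within)
  qed
  then show "(LINT t:{l..r}|lborel. d n t) = D n r - D n l"
    using set_borel_integral_eq_integral[OF i] by (simp add: integral_unique)
qed

lemma halfplane_constant:
  obtains c c' where "\<And>x. 1 < Re x \<Longrightarrow> G1 x + G2 (- x) = c" "\<And>x. 1 < Re x \<Longrightarrow> G1 (- x) + G2 x = c'"
proof -
  have u: "x \<in> upper" "- x \<in> upper" if "1 < Re x" for x using that by (auto simp: upper_def)
  have cv: "convex {x. 1 < Re x}" by (rule convex_halfspace_Re_gt)
  have n: "((\<lambda>x. - x) has_field_derivative - 1) (at x)" for x :: complex
    by (auto intro!: derivative_eq_intros)
  have "\<exists>c. \<forall>x\<in>{x. 1 < Re x}. G1 x + G2 (- x) = c"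
  proof (rule has_field_derivative_zero_constant[OF cv])
    fix x :: complex assume "x \<in> {x. 1 < Re x}"
    then have x: "1 < Re x" by simp
    have "((\<lambda>x. G1 x + G2 (- x)) has_field_derivative \<psi> x + \<psi> (- (- x)) * - 1) (at x)"
      by (intro DERIV_add G1_derivative DERIV_chain2[OF _ n] G2_derivative u x)
    then show "((\<lambda>x. G1 x + G2 (- x)) has_field_derivative 0) (at x within {x. 1 < Re x})"
      by (simp add: has_field_derivative_at_within)
  qed
  moreover have "\<exists>c. \<forall>x\<in>{x. 1 < Re x}. G1 (- x) + G2 x = c"
  proof (rule has_field_derivative_zero_constant[OF cv])
    fix x :: complex assume "x \<in> {x. 1 < Re x}"
    then have x: "1 < Re x" by simp
    have "((\<lambda>x. G1 (- x) + G2 x) has_field_derivative \<psi> (- x) * - 1 + \<psi> (- x)) (at x)"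
      by (intro DERIV_add G2_derivative DERIV_chain2[OF _ n] G1_derivative u x)
    then show "((\<lambda>x. G1 (- x) + G2 x) has_field_derivative 0) (at x within {x. 1 < Re x})"
      by (simp add: has_field_derivative_at_within)
  qed
  ultimately show thesis using that by fastforce
qed

lemma halfplane_constants_diff:
  assumes c: "\<And>x. 1 < Re x \<Longrightarrow> G1 x + G2 (- x) = c" "\<And>x. 1 < Re x \<Longrightarrow> G1 (- x) + G2 x = c'"
  shows "c - c' = 2 * pi * \<i> * a"
proof -
  have 1: "((\<lambda>R. G1 (- of_real R) - G1 (of_real R)) \<longlongrightarrow> - \<i> * pi * a) at_top"
    by (rule p1.primitive_semicircle[OF _ R0]) (rule asym)
  have 2: "((\<lambda>R. G2 (- of_real R) - G2 (of_real R)) \<longlongrightarrow> - \<i> * pi * - a) at_top"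
  proof (rule p2.primitive_semicircle[OF _ R0])
    fix z :: complex assume "R0 \<le> cmod z"
    then show "cmod (\<psi> (- z) + - a / z) \<le> C / (cmod z)\<^sup>2" using asym[of "- z"] by simp
  qed
  have "((\<lambda>R::real. c' - c) \<longlongrightarrow> - \<i> * pi * a - - \<i> * pi * - a) at_top"
  proof (rule Lim_transform_eventually[OF tendsto_diff[OF 1 2]])
    show "\<forall>\<^sub>F R in at_top. G1 (- of_real R) - G1 (of_real R) - (G2 (- of_real R) - G2 (of_real R)) = c' - c"
      using eventually_gt_at_top[of 1]
    proof eventually_elim
      case (elim R)
      then show ?case using c(1)[of "of_real R"] c(2)[of "of_real R"] by (simp add: algebra_simps)
    qed
  qed
  from tendsto_unique[OF _ tendsto_const this]
  have "c' - c = - \<i> * pi * a - - \<i> * pi * - a" by (simp only: trivial_limit_at_top_linorder not_False_eq_True)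
  then show ?thesis by (simp add: algebra_simps)
qed

abbreviation cut :: "real \<Rightarrow> real set" where "cut \<epsilon> \<equiv> {-1..-\<epsilon>} \<union> {\<epsilon>..1}"

lemma AE_interior_cut:
  assumes "0 < \<epsilon>" shows "AE t in lborel. t \<in> cut \<epsilon> \<longrightarrow> 0 < \<bar>t\<bar> \<and> \<bar>t\<bar> < 1"
  using AE_lborel_singleton[of 1] AE_lborel_singleton[of "-1"]
proof eventually_elim
  case (elim t)
  then show ?case using assms by auto
qed

text \<open>For fixed \<open>\<epsilon>\<close> the factor \<open>dgam\<close> is at most
  \<open>40 / \<epsilon>^2\<close> on the cut interval, and \<open>\<psi>\<close> is at most
  \<open>B\<close> once \<open>s n < \<eta>\<close>, so dominated convergence applies.\<close>

lemma cut_integral_LIMSEQ: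
  assumes e: "0 < \<epsilon>"
  shows "(\<lambda>n. LINT t:cut \<epsilon>|lborel. d n t) \<longlonglongrightarrow> (LINT t:cut \<epsilon>|lborel. J t * dgam t)"
proof -
  have "\<forall>\<^sub>F n in sequentially. s n < \<eta>" using s_lim eta by (rule order_tendstoD(2))
  then obtain N where N: "\<And>n. N \<le> n \<Longrightarrow> s n < \<eta>" unfolding eventually_sequentially by blast
  have [measurable]: "d n \<in> borel_measurable borel" for n
  proof -
    have cw: "continuous_on (- wave) \<psi>" by (rule holomorphic_on_imp_continuous_on[OF holo])
    have [measurable]: "(\<lambda>t. \<psi> (gam t + \<i> * of_real (s n))) \<in> borel_measurable borel"
      "(\<lambda>t. \<psi> (gam t - \<i> * of_real (s n))) \<in> borel_measurable borel"
      by (intro borel_measurable_continuous_onI continuous_on_compose2[OF cw];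
          use notin_wave in \<open>auto intro!: continuous_intros continuous_on_gam\<close>)+
    show ?thesis unfolding d_def[abs_def] by measurable
  qed
  have "(\<lambda>n. LINT t:cut \<epsilon>|lborel. d (n + N) t) \<longlonglongrightarrow> (LINT t:cut \<epsilon>|lborel. J t * dgam t)"
    unfolding set_lebesgue_integral_def
  proof (rule integral_dominated_convergence[where w = "\<lambda>t. 2 * B * (40 / \<epsilon>\<^sup>2) * indicator {-1..1} t"])
    show "integrable lborel (\<lambda>t. 2 * B * (40 / \<epsilon>\<^sup>2) * indicator {-1..1::real} t)" by simp
    show "AE t in lborel. (\<lambda>n. indicator (cut \<epsilon>) t *\<^sub>R d (n + N) t) \<longlonglongrightarrow> indicator (cut \<epsilon>) t *\<^sub>R (J t * dgam t)"
      using AE_interior_cut[OF e]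
    proof eventually_elim
      case (elim t)
      show ?case
      proof (cases "t \<in> cut \<epsilon>")
        case True
        have "(\<lambda>n. d n t) \<longlonglongrightarrow> J t * dgam t"
          unfolding d_def using elim True by (intro tendsto_mult tendsto_const J_lim) auto
        then show ?thesis by (intro tendsto_scaleR tendsto_const LIMSEQ_ignore_initial_segment)
      qed simp
    qed
    show "AE t in lborel. norm (indicator (cut \<epsilon>) t *\<^sub>R d (n + N) t) \<le> 2 * B * (40 / \<epsilon>\<^sup>2) * indicator {-1..1} t" for n
      using AE_interior_cut[OF e]
    proof eventually_elim
      case (elim t)
      have near: "infdist p wave < \<eta>" if "t \<in> cut \<epsilon>" "cmod (p - gam t) = s (n + N)" for p
      proof -
        have "gam t \<in> wave" using that(1) e by (auto simp: mem_wave)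
        then have "infdist p wave \<le> dist p (gam t)" by (rule infdist_le)
        then show ?thesis using that(2) N[of "n + N"] by (simp add: dist_norm)
      qed
      have nrm: "cmod (gam t + \<i> * of_real (s (n + N)) - gam t) = s (n + N)"
        "cmod (gam t - \<i> * of_real (s (n + N)) - gam t) = s (n + N)"
        using s_pos[of "n + N"] by (simp_all add: norm_mult)
      show ?case
      proof (cases "t \<in> cut \<epsilon>")
        case True
        have t: "\<epsilon> \<le> \<bar>t\<bar>" "\<bar>t\<bar> \<le> 1" using True e by auto
        have b: "cmod (\<psi> (gam t + \<i> * of_real (s (n + N)))) \<le> B" "cmod (\<psi> (gam t - \<i> * of_real (s (n + N)))) \<le> B"
          by (intro bound notin_wave near[OF True] nrm)+
        then have 1: "cmod (\<psi> (gam t + \<i> * of_real (s (n + N))) - \<psi> (gam t - \<i> * of_real (s (n + N)))) \<le> 2 * B"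
          by (intro order_trans[OF norm_triangle_ineq4]) linarith
        have "\<epsilon>\<^sup>2 \<le> \<bar>t\<bar>\<^sup>2" using t e by (intro power_mono) auto
        then have "40 / t\<^sup>2 \<le> 40 / \<epsilon>\<^sup>2" using e by (intro frac_le) auto
        then have 2: "cmod (dgam t) \<le> 40 / \<epsilon>\<^sup>2" using cmod_dgam_le[of t] t e by linarith
        have "cmod (d (n + N) t) \<le> 2 * B * (40 / \<epsilon>\<^sup>2)"
          unfolding d_def norm_mult using 1 2 order_trans[OF norm_ge_zero b(1)] by (intro mult_mono) auto
        then show ?thesis using True t by (auto simp: indicator_def)
      next
        case False
        have "0 \<le> B"
        proof (rule order_trans[OF norm_ge_zero bound[OF notin_wave(1)]])
          have "infdist (gam 0 + \<i> * of_real (s N)) wave \<le> dist (gam 0 + \<i> * of_real (s N)) 0"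
            by (rule infdist_le[OF zero_in_wave])
          then show "infdist (gam 0 + \<i> * of_real (s N)) wave < \<eta>"
            using N[of N] s_pos[of N] by (simp add: norm_mult)
        qed
        then show ?thesis using False by (simp add: indicator_def)
      qed
    qed
  qed measurable
  then show ?thesis by (rule LIMSEQ_offset)
qed

text \<open>Up to six errors the integral telescopes to the difference of the constants: four end
  corrections of size \<open>2 * B * s n\<close>, which vanish as \<open>n\<close> grows, and two
  bridges over 0 of size \<open>8 * B * \<epsilon>\<close>.\<close>

lemma cut_integral_bound:
  assumes e: "0 < \<epsilon>" "\<epsilon> \<le> 1/2" "4 * \<epsilon> < \<eta>"
    and c: "\<And>x. 1 < Re x \<Longrightarrow> G1 x + G2 (- x) = c" "\<And>x. 1 < Re x \<Longrightarrow> G1 (- x) + G2 x = c'"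
  shows "cmod ((LINT t:cut \<epsilon>|lborel. J t * dgam t) - (c - c')) \<le> 16 * B * \<epsilon>"
proof (rule LIMSEQ_le[OF tendsto_norm[OF tendsto_diff[OF cut_integral_LIMSEQ[OF e(1)] tendsto_const]]])
  have "(\<lambda>n. 8 * B * s n + 16 * B * \<epsilon>) \<longlonglongrightarrow> 8 * B * 0 + 16 * B * \<epsilon>" by (intro tendsto_intros s_lim)
  then show "(\<lambda>n. 8 * B * s n + 16 * B * \<epsilon>) \<longlonglongrightarrow> 16 * B * \<epsilon>" by simp
  have "\<forall>\<^sub>F n in sequentially. s n < min (\<eta> / 2) \<epsilon>"
    using s_lim by (rule order_tendstoD(2)) (use eta e in auto)
  then obtain N where N: "\<And>n. N \<le> n \<Longrightarrow> s n < min (\<eta> / 2) \<epsilon>" unfolding eventually_sequentially by blast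
  show "\<exists>N. \<forall>n\<ge>N. cmod ((LINT t:cut \<epsilon>|lborel. d n t) - (c - c')) \<le> 8 * B * s n + 16 * B * \<epsilon>"
  proof (intro exI allI impI)
    fix n assume "N \<le> n"
    from N[OF this] have sn: "2 * s n < \<eta>" "s n \<le> \<epsilon>" by auto
    have "(LINT t:cut \<epsilon>|lborel. d n t) = (LINT t:{-1..-\<epsilon>}|lborel. d n t) + (LINT t:{\<epsilon>..1}|lborel. d n t)"
      by (rule set_integral_Un) (use e in \<open>auto intro!: d_integral(1)\<close>)
    also have "\<dots> = (D n (- \<epsilon>) - D n (- 1)) + (D n 1 - D n \<epsilon>)"
      using e by (subst (1 2) d_integral(2)) auto
    finally have I: "(LINT t:cut \<epsilon>|lborel. d n t) = (D n (- \<epsilon>) - D n (- 1)) + (D n 1 - D n \<epsilon>)" .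
    have g1: "- gam (- 1) = gam 1" "- gam 1 = gam (- 1)" "- gam \<epsilon> = gam (- \<epsilon>)" "- gam (- \<epsilon>) = gam \<epsilon>"
      by (simp_all add: gam_minus)
    have e1: "of_real (1 * (1 + s n)) = (of_real (1 + s n) :: complex)"
      "of_real (- 1 * (1 + s n)) = - (of_real (1 + s n) :: complex)" by simp_all
    have re: "1 < Re (of_real (1 + s n))" using s_pos[of n] by simp
    note end1 = p1.primitive_at_end[OF s_pos sn(1), of 1] p1.primitive_at_end[OF s_pos sn(1), of "- 1"]
    note end2 = p2.primitive_at_end[OF s_pos sn(1), of 1] p2.primitive_at_end[OF s_pos sn(1), of "- 1"]
    note a1 = p1.primitive_across_0[OF s_pos sn(2) e(2,3)] and a2 = p2.primitive_across_0[OF s_pos sn(2) e(2,3)]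
    define u1 u2 u3 u4 where "u1 = G1 (gam 1 + \<i> * of_real (s n)) - G1 (of_real (1 + s n))"
      and "u2 = G1 (gam (- 1) + \<i> * of_real (s n)) - G1 (- of_real (1 + s n))"
      and "u3 = G2 (gam 1 + \<i> * of_real (s n)) - G2 (of_real (1 + s n))"
      and "u4 = G2 (gam (- 1) + \<i> * of_real (s n)) - G2 (- of_real (1 + s n))"
    define u5 u6 where "u5 = G1 (gam \<epsilon> + \<i> * of_real (s n)) - G1 (gam (- \<epsilon>) + \<i> * of_real (s n))"
      and "u6 = G2 (gam \<epsilon> + \<i> * of_real (s n)) - G2 (gam (- \<epsilon>) + \<i> * of_real (s n))"
    have b: "cmod u1 \<le> 2 * B * s n" "cmod u2 \<le> 2 * B * s n" "cmod u3 \<le> 2 * B * s n" "cmod u4 \<le> 2 * B * s n"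
      "cmod u5 \<le> 8 * B * \<epsilon>" "cmod u6 \<le> 8 * B * \<epsilon>"
      using end1 end2 a1 a2 unfolding u1_def u2_def u3_def u4_def u5_def u6_def e1 by simp_all
    have "(LINT t:cut \<epsilon>|lborel. d n t) - (c - c') = u1 + u4 - u2 - u3 - u5 + u6"
      unfolding I D_def g1 c(1)[OF re, symmetric] c(2)[OF re, symmetric] u1_def u2_def u3_def u4_def u5_def u6_def
      by (simp add: algebra_simps)
    also have "cmod \<dots> \<le> cmod u1 + cmod u4 + cmod u2 + cmod u3 + cmod u5 + cmod u6"
      by (intro order_trans[OF norm_triangle_ineq] order_trans[OF norm_triangle_ineq4] add_mono order_refl)
    finally show "cmod ((LINT t:cut \<epsilon>|lborel. d n t) - (c - c')) \<le> 8 * B * s n + 16 * B * \<epsilon>"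
      using b by linarith
  qed
qed

lemma jump_integral: "(LINT t|lborel. J t * dgam t) = 2 * pi * \<i> * a"
proof -
  obtain c c' where c: "\<And>x. 1 < Re x \<Longrightarrow> G1 x + G2 (- x) = c" "\<And>x. 1 < Re x \<Longrightarrow> G1 (- x) + G2 x = c'"
    by (rule halfplane_constant) (rule that)
  \<comment> \<open>The null sequence \<open>s\<close> also serves as the sequence of cut sizes; the
    integrable majorant is the one from \<open>J_bound\<close>.\<close>
  have lim: "(\<lambda>m. LINT t:cut (s m)|lborel. J t * dgam t) \<longlonglongrightarrow> (LINT t|lborel. J t * dgam t)"
    unfolding set_lebesgue_integral_def
  proof (rule integral_dominated_convergence[where w = "\<lambda>t. K * indicator {-1..1} t"])
    show "AE t in lborel. (\<lambda>m. indicator (cut (s m)) t *\<^sub>R (J t * dgam t)) \<longlonglongrightarrow> J t * dgam t"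
      using AE_lborel_singleton[of 0]
    proof eventually_elim
      case (elim t)
      show ?case
      proof (cases "\<bar>t\<bar> \<le> 1")
        case True
        have "\<forall>\<^sub>F m in sequentially. s m < \<bar>t\<bar>" using s_lim by (rule order_tendstoD(2)) (use elim in simp)
        then have "\<forall>\<^sub>F m in sequentially. indicator (cut (s m)) t *\<^sub>R (J t * dgam t) = J t * dgam t"
        proof eventually_elim
          case (elim m)
          then have "t \<in> cut (s m)" using True by auto
          then show ?case by simp
        qed
        then show ?thesis by (rule tendsto_eventually)
      next
        case False
        then have "indicator {-1..1} t = (0 :: real)" by (auto simp: indicator_def)
        then have z: "J t * dgam t = 0" using J_bound[OF elim] by (simp only: mult_zero_right norm_le_zero_iff)
        show ?thesis unfolding z by simp
      qed
    qed
    show "AE t in lborel. norm (indicator (cut (s m)) t *\<^sub>R (J t * dgam t)) \<le> K * indicator {-1..1} t" for m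
      using AE_lborel_singleton[of 0]
    proof eventually_elim
      case (elim t)
      have "norm (indicator (cut (s m)) t *\<^sub>R (J t * dgam t)) \<le> cmod (J t * dgam t)"
        by (simp add: indicator_def)
      then show ?case using J_bound[OF elim] by (rule order_trans)
    qed
  qed simp_all
  have "(\<lambda>m. cmod ((LINT t:cut (s m)|lborel. J t * dgam t) - (c - c'))) \<longlonglongrightarrow> 0"
  proof (rule tendsto_sandwich[OF _ _ tendsto_const])
    have "(\<lambda>m. 16 * B * s m) \<longlonglongrightarrow> 16 * B * 0" by (intro tendsto_intros s_lim)
    then show "(\<lambda>m. 16 * B * s m) \<longlonglongrightarrow> 0" by simp
    have "\<forall>\<^sub>F m in sequentially. s m < min (1/2) (\<eta> / 4)"
      using s_lim by (rule order_tendstoD(2)) (use eta in auto)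
    then show "\<forall>\<^sub>F m in sequentially. cmod ((LINT t:cut (s m)|lborel. J t * dgam t) - (c - c')) \<le> 16 * B * s m"
    proof eventually_elim
      case (elim m)
      then show ?case by (intro cut_integral_bound s_pos c) auto
    qed
  qed simp
  moreover have "(\<lambda>m. cmod ((LINT t:cut (s m)|lborel. J t * dgam t) - (c - c')))
     \<longlonglongrightarrow> cmod ((LINT t|lborel. J t * dgam t) - (c - c'))"
    by (intro tendsto_intros lim)
  ultimately have "cmod ((LINT t|lborel. J t * dgam t) - (c - c')) = 0"
    using LIMSEQ_unique by blast
  then show ?thesis using halfplane_constants_diff[OF c] by simp
qed

end

section \<open>The Cauchy capacity of the wave\<close>

context damped_map
begin

lemma dn_eq: "dn n t = \<Phi> (gam t - \<i> * of_real (step n))"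
  by (simp add: dn_def gam_minus)

text \<open>The difference quotient of \<open>\<Phi>\<close> at \<open>z\<close> is chosen because
  it has no pole at \<open>z\<close>, its jump is that of \<open>\<Phi>\<close> divided by
  \<open>gam t - z\<close>, and at infinity it behaves like \<open>- \<Phi> z / \<zeta>\<close>.
  Thus \<open>jump_integral\<close> with \<open>a = \<Phi> z\<close> becomes a Cauchy formula for
  \<open>\<Phi> z\<close>.\<close>

lemma difference_quotient_bounds:
  assumes z: "z \<notin> wave"
  defines "\<psi> \<equiv> \<lambda>\<zeta>. if \<zeta> = z then deriv \<Phi> z else (\<Phi> \<zeta> - \<Phi> z) / (\<zeta> - z)"
  shows "0 < infdist z wave"
    and "\<psi> holomorphic_on - wave"
    and "\<And>\<zeta>. \<zeta> \<notin> wave \<Longrightarrow> infdist \<zeta> wave < infdist z wave / 2 \<Longrightarrow> cmod (\<psi> \<zeta>) \<le> 4 / infdist z wave"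
    and "0 < \<bar>t\<bar> \<Longrightarrow> \<bar>t\<bar> < 1 \<Longrightarrow>
      (\<lambda>n. \<psi> (gam t + \<i> * of_real (step n)) - \<psi> (gam t - \<i> * of_real (step n))) \<longlonglongrightarrow> jump t / (gam t - z)"
proof -
  have op: "open (- wave)" using closed_wave by blast
  show d: "0 < infdist z wave"
    by (rule infdist_wave_pos[OF z])
  show "\<psi> holomorphic_on - wave"
    unfolding \<psi>_def by (rule pole_lemma[OF \<Phi>_holo]) (use z op in \<open>simp add: interior_open\<close>)
  show "cmod (\<psi> \<zeta>) \<le> 4 / infdist z wave" if \<zeta>: "\<zeta> \<notin> wave" "infdist \<zeta> wave < infdist z wave / 2" for \<zeta>
  proof -
    have "infdist z wave \<le> infdist \<zeta> wave + dist z \<zeta>" by (rule infdist_triangle)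
    then have ge: "infdist z wave / 2 \<le> cmod (\<zeta> - z)" using \<zeta>(2) by (simp add: dist_norm norm_minus_commute)
    then have "\<zeta> \<noteq> z" using d by auto
    then have "cmod (\<psi> \<zeta>) = cmod (\<Phi> \<zeta> - \<Phi> z) / cmod (\<zeta> - z)" by (simp add: \<psi>_def norm_divide)
    also have "\<dots> \<le> 2 / (infdist z wave / 2)"
    proof (rule frac_le)
      show "cmod (\<Phi> \<zeta> - \<Phi> z) \<le> 2"
        using norm_triangle_ineq4[of "\<Phi> \<zeta>" "\<Phi> z"] \<Phi>_le_1[OF \<zeta>(1)] \<Phi>_le_1[OF z] by linarith
    qed (use d ge in auto)
    finally show ?thesis by simp
  qed
  show "(\<lambda>n. \<psi> (gam t + \<i> * of_real (step n)) - \<psi> (gam t - \<i> * of_real (step n))) \<longlonglongrightarrow> jump t / (gam t - z)"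
    if t: "0 < \<bar>t\<bar>" "\<bar>t\<bar> < 1"
  proof -
    obtain U where U: "(\<lambda>n. up n t) \<longlonglongrightarrow> U" using convergent_up_dn(1)[OF t] unfolding convergent_def by blast
    obtain W where W: "(\<lambda>n. dn n t) \<longlonglongrightarrow> W" using convergent_up_dn(2)[OF t] unfolding convergent_def by blast
    have "gam t \<in> wave" using t by (simp add: mem_wave)
    then have gz: "gam t \<noteq> z" using z by auto
    have p: "(\<lambda>n. gam t + \<i> * of_real (step n)) \<longlonglongrightarrow> gam t" "(\<lambda>n. gam t - \<i> * of_real (step n)) \<longlonglongrightarrow> gam t"
      using tendsto_add[OF tendsto_const tendsto_mult[OF tendsto_const tendsto_of_real[OF step_lim]], of "gam t" \<i>]
        tendsto_diff[OF tendsto_const tendsto_mult[OF tendsto_const tendsto_of_real[OF step_lim]], of "gam t" \<i>]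
      by simp_all
    have "(\<lambda>n. (up n t - \<Phi> z) / (gam t + \<i> * of_real (step n) - z) - (dn n t - \<Phi> z) / (gam t - \<i> * of_real (step n) - z))
      \<longlonglongrightarrow> (U - \<Phi> z) / (gam t - z) - (W - \<Phi> z) / (gam t - z)"
      by (intro tendsto_diff tendsto_divide tendsto_const U W p) (use gz in auto)
    also have "(U - \<Phi> z) / (gam t - z) - (W - \<Phi> z) / (gam t - z) = jump t / (gam t - z)"
      using LIMSEQ_unique[OF jump_LIMSEQ[OF t] tendsto_diff[OF U W]] by (simp add: diff_divide_distrib)
    finally have L: "(\<lambda>n. (up n t - \<Phi> z) / (gam t + \<i> * of_real (step n) - z) - (dn n t - \<Phi> z) / (gam t - \<i> * of_real (step n) - z))
      \<longlonglongrightarrow> jump t / (gam t - z)" .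
    show ?thesis
    proof (rule Lim_transform_eventually[OF L])
      show "\<forall>\<^sub>F n in sequentially. (up n t - \<Phi> z) / (gam t + \<i> * of_real (step n) - z) - (dn n t - \<Phi> z) / (gam t - \<i> * of_real (step n) - z)
        = \<psi> (gam t + \<i> * of_real (step n)) - \<psi> (gam t - \<i> * of_real (step n))"
        using tendsto_imp_eventually_ne[OF p(1) gz] tendsto_imp_eventually_ne[OF p(2) gz]
      proof eventually_elim
        case (elim n)
        then show ?case by (simp add: \<psi>_def up_def dn_eq)
      qed
    qed
  qed
qed

lemma difference_quotient_decay:
  obtains C where "\<And>\<zeta>. 4 + 2 * cmod z \<le> cmod \<zeta> \<Longrightarrow>
    cmod ((if \<zeta> = z then deriv \<Phi> z else (\<Phi> \<zeta> - \<Phi> z) / (\<zeta> - z)) + \<Phi> z / \<zeta>) \<le> C / (cmod \<zeta>)\<^sup>2"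
proof -
  obtain C where C: "0 \<le> C" "\<And>z. 4 \<le> cmod z \<Longrightarrow> cmod (\<Phi> z) \<le> C / cmod z" by (rule \<Phi>_decay) (rule that)
  define C' where "C' = C + cmod (\<Phi> z * z)"
  have C': "0 \<le> C'" using C by (simp add: C'_def)
  show thesis
  proof (rule that)
    fix \<zeta> assume \<zeta>: "4 + 2 * cmod z \<le> cmod \<zeta>"
    then have big: "4 \<le> cmod \<zeta>" "cmod z \<le> cmod \<zeta> / 2" using norm_ge_zero[of z] by linarith+
    have nz: "\<zeta> \<noteq> 0" using big by auto
    have ne: "\<zeta> \<noteq> z" using big by auto
    have ge: "cmod \<zeta> / 2 \<le> cmod (\<zeta> - z)" using norm_triangle_ineq2[of \<zeta> z] big by linarith
    have eq: "(\<Phi> \<zeta> - \<Phi> z) / (\<zeta> - z) + \<Phi> z / \<zeta> = (\<Phi> \<zeta> * \<zeta> - \<Phi> z * z) / (\<zeta> * (\<zeta> - z))"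
      using nz ne by (simp add: divide_simps) (simp add: algebra_simps)
    have "cmod (\<Phi> \<zeta>) * cmod \<zeta> \<le> C" using C(2)[OF big(1)] nz by (simp add: le_divide_eq)
    then have 1: "cmod (\<Phi> \<zeta> * \<zeta> - \<Phi> z * z) \<le> C'"
      using norm_triangle_ineq4[of "\<Phi> \<zeta> * \<zeta>" "\<Phi> z * z"] by (simp add: C'_def norm_mult)
    have "cmod ((\<Phi> \<zeta> - \<Phi> z) / (\<zeta> - z) + \<Phi> z / \<zeta>) = cmod (\<Phi> \<zeta> * \<zeta> - \<Phi> z * z) / (cmod \<zeta> * cmod (\<zeta> - z))"
      unfolding eq by (simp add: norm_divide norm_mult)
    also have "\<dots> \<le> C' / (cmod \<zeta> * (cmod \<zeta> / 2))"
      by (intro frac_le C' 1 mult_left_mono ge) (use nz in auto)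
    also have "\<dots> = (2 * C') / (cmod \<zeta>)\<^sup>2" by (simp add: power2_eq_square)
    finally show "cmod ((if \<zeta> = z then deriv \<Phi> z else (\<Phi> \<zeta> - \<Phi> z) / (\<zeta> - z)) + \<Phi> z / \<zeta>) \<le> (2 * C') / (cmod \<zeta>)\<^sup>2"
      using ne by simp
  qed
qed

lemma dens_integral:
  assumes z: "z \<notin> wave"
  shows "(LINT t|lborel. dens t * (1 / (gam t - z))) = \<Phi> z"
proof -
  let ?\<psi> = "\<lambda>\<zeta>. if \<zeta> = z then deriv \<Phi> z else (\<Phi> \<zeta> - \<Phi> z) / (\<zeta> - z)"
  note b = difference_quotient_bounds[OF z]
  obtain C where C: "\<And>\<zeta>. 4 + 2 * cmod z \<le> cmod \<zeta> \<Longrightarrow> cmod (?\<psi> \<zeta> + \<Phi> z / \<zeta>) \<le> C / (cmod \<zeta>)\<^sup>2"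
    by (rule difference_quotient_decay[of z]) (rule that)
  obtain K where K: "\<And>t. t \<noteq> 0 \<Longrightarrow> cmod (jump t * dgam t) \<le> K * indicator {-1..1} t"
    by (rule jump_dgam_bound) (rule that)
  interpret j: wave_jump ?\<psi> "\<lambda>t. jump t / (gam t - z)" step "4 / infdist z wave" "infdist z wave / 2"
    "K / infdist z wave" C "4 + 2 * cmod z" "\<Phi> z"
  proof
    show "cmod (jump t / (gam t - z) * dgam t) \<le> K / infdist z wave * indicator {-1..1} t" if t: "t \<noteq> 0" for t
    proof (cases "\<bar>t\<bar> \<le> 1")
      case True
      then have "gam t \<in> wave" by (auto simp: mem_wave)
      then have ge: "infdist z wave \<le> cmod (gam t - z)"
        using infdist_le[of "gam t" wave z] by (simp add: dist_norm norm_minus_commute)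
      have Kt: "cmod (jump t * dgam t) \<le> K" using K[OF t] True by (simp add: indicator_def abs_le_iff)
      have "cmod (jump t * dgam t) / cmod (gam t - z) \<le> K / infdist z wave"
        by (rule frac_le[OF order_trans[OF norm_ge_zero Kt] Kt b(1) ge])
      then show ?thesis using True by (simp add: norm_divide norm_mult indicator_def abs_le_iff)
    next
      case False
      then have 0: "jump t = 0" by (simp add: jump_eq_0)
      have "indicator {-1..1} t = (0 :: real)" using False by (auto simp: indicator_def)
      then show ?thesis unfolding 0 by simp
    qed
    show "(\<lambda>t. jump t / (gam t - z)) \<in> borel_measurable borel" by measurable
  qed (use b C step_pos step_lim in auto)
  have "(LINT t|lborel. dens t * (1 / (gam t - z))) = (LINT t|lborel. (jump t / (gam t - z) * dgam t) / (2 * pi * \<i>))"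
    by (intro Bochner_Integration.integral_cong) (simp_all add: dens_def mult_ac)
  also have "\<dots> = (LINT t|lborel. jump t / (gam t - z) * dgam t) / (2 * pi * \<i>)" by (rule integral_divide_zero)
  also have "\<dots> = \<Phi> z" unfolding j.jump_integral by simp
  finally show ?thesis .
qed

lemma integrable_dens: "integrable lborel dens"
proof -
  obtain K where K: "\<And>t. t \<noteq> 0 \<Longrightarrow> cmod (jump t * dgam t) \<le> K * indicator {-1..1} t"
    by (rule jump_dgam_bound) (rule that)
  have "integrable lborel (\<lambda>t. jump t * dgam t)"
  proof (rule Bochner_Integration.integrable_bound)
    show "integrable lborel (\<lambda>t. K * indicator {-1..1::real} t)" by simp
    show "AE t in lborel. norm (jump t * dgam t) \<le> norm (K * indicator {-1..1} t)"
      using AE_lborel_singleton[of 0]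
    proof eventually_elim
      case (elim t)
      then show ?case using K[of t] by (intro order_trans[OF K]) auto
    qed
  qed simp
  then show ?thesis unfolding dens_def[abs_def] by (rule integrable_divide_zero)
qed

definition charge :: "complex set \<Rightarrow> complex" where
  "charge A = (LINT t|lborel. dens t * indicator A (gam t))"

lemma charge_measure: "complex_borel_measure charge"
  unfolding charge_def[abs_def] by (rule complex_borel_measure_curve[OF integrable_dens gam_measurable])

lemma charge_supported: "supported_on charge wave"
  unfolding supported_on_def
proof (intro ballI impI)
  fix A :: "complex set" assume A: "A \<inter> wave = {}"
  have 0: "dens t * indicator A (gam t) = 0" for t
  proof (cases "\<bar>t\<bar> < 1")
    case True
    then have "gam t \<in> wave" by (simp add: mem_wave)
    then have "gam t \<notin> A" using A by blast
    then show ?thesis by simp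
  next
    case False
    then show ?thesis by (simp add: dens_def jump_eq_0)
  qed
  show "charge A = 0" unfolding charge_def 0 by simp
qed

lemma cauchy_transform_charge:
  assumes z: "z \<notin> wave" shows "cauchy_transform charge (Some z) = \<Phi> z"
proof -
  \<comment> \<open>\<open>cm_integral_curve\<close> asks for a bounded integrand, so the kernel is
    cut off away from the wave, which carries the charge.\<close>
  define h where "h \<xi> = indicator wave \<xi> * (1 / (\<xi> - z))" for \<xi>
  have wb [measurable]: "wave \<in> sets borel" using closed_wave by simp
  have hm: "h \<in> borel_measurable borel" unfolding h_def[abs_def] by measurable
  have hb: "cmod (h \<xi>) \<le> 1 / infdist z wave" for \<xi>
  proof (cases "\<xi> \<in> wave")
    case True
    then have "infdist z wave \<le> cmod (\<xi> - z)"
      using infdist_le[of \<xi> wave z] by (simp add: dist_norm norm_minus_commute)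
    then show ?thesis using True difference_quotient_bounds(1)[OF z]
      by (simp add: h_def norm_divide divide_left_mono frac_le)
  next
    case False
    then show ?thesis by (simp add: h_def infdist_nonneg)
  qed
  have "cauchy_transform charge (Some z) = cm_integral charge (\<lambda>\<xi>. 1 / (\<xi> - z))"
    by (simp add: cauchy_transform_def)
  also have "\<dots> = cm_integral charge h"
    by (rule cm_integral_cong[OF charge_measure charge_supported wb _ hm]) (simp_all add: h_def)
  also have "\<dots> = (LINT t|lborel. dens t * h (gam t))"
    unfolding charge_def[abs_def] by (rule cm_integral_curve[OF integrable_dens gam_measurable hm hb])
  also have "\<dots> = (LINT t|lborel. dens t * (1 / (gam t - z)))"
  proof (intro Bochner_Integration.integral_cong refl)
    show "dens t * h (gam t) = dens t * (1 / (gam t - z))" for t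
    proof (cases "\<bar>t\<bar> < 1")
      case True
      then have "gam t \<in> wave" by (simp add: mem_wave)
      then show ?thesis by (simp add: h_def)
    qed (simp add: dens_def jump_eq_0)
  qed
  finally show ?thesis using dens_integral[OF z] by simp
qed

lemma cauchy_transform_charge_le: "p \<in> sphere_compl wave \<Longrightarrow> cmod (cauchy_transform charge p) \<le> 1"
  using \<Phi>_le_1 by (auto simp: sphere_compl_wave cauchy_transform_charge) (simp add: cauchy_transform_def)

lemma cmod_charge_wave: "cmod (charge wave) = \<kappa> / (1 + \<delta>) ^ 8"
proof -
  have eq: "cauchy_transform charge (chart_inf w) = kq w" if w: "w \<in> inv_dom" for w
  proof (cases "w = 0")
    case True
    then show ?thesis by (simp add: chart_inf_def cauchy_transform_def kq_0)
  next
    case False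
    then have "1 / w \<notin> wave" using w by (simp add: inv_dom_iff)
    then show ?thesis using False by (simp add: chart_inf_def cauchy_transform_charge \<Phi>_def)
  qed
  have hol: "(\<lambda>w. cauchy_transform charge (chart_inf w)) holomorphic_on inv_dom"
    by (rule holomorphic_transform[OF kq_holo]) (simp add: eq)
  have "- charge wave = deriv (\<lambda>w. cauchy_transform charge (chart_inf w)) 0"
    using deriv_inf_eq(2)[OF hol] deriv_inf_cauchy_transform[OF charge_measure charge_supported] by simp
  also have "\<dots> = deriv kq 0"
    by (rule complex_derivative_transform_within_open[OF hol kq_holo open_inv_dom zero_in_inv_dom eq])
  finally have "cmod (charge wave) = cmod (of_real (\<kappa> / (1 + \<delta>) ^ 8))"
    unfolding deriv_kq_0 by (metis norm_minus_cancel)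
  then show ?thesis using kappa_pos delta_pos by (simp only: norm_of_real) simp
qed

end

context wave_map
begin

text \<open>The values \<open>\<kappa> / (1 + \<delta>)^8\<close> approach the supremum, which is
  not attained: a maximizing measure would, up to a unimodular factor, have the Ahlfors function as
  its Cauchy transform.\<close>

lemma cauchy_capacity_wave: "cauchy_capacity wave = \<kappa>"
proof -
  define S where "S = {cmod (\<mu> wave) | \<mu>. complex_borel_measure \<mu> \<and> supported_on \<mu> wave \<and>
    (\<forall>p\<in>sphere_compl wave. cmod (cauchy_transform \<mu> p) \<le> 1)}"
  have le: "x \<le> \<kappa>" if "x \<in> S" for x using that charge_le_kappa unfolding S_def by blast
  have mem: "\<kappa> / (1 + \<delta>) ^ 8 \<in> S" if \<delta>: "0 < \<delta>" for \<delta>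
  proof -
    obtain L where L: "L holomorphic_on inv_dom" "L 0 = 0"
      "\<And>u. u \<in> inv_dom \<Longrightarrow> exp (L u) = (1 - 0 * u) / (1 - 1 * u)"
      "\<And>u. u \<in> inv_dom \<Longrightarrow> \<bar>Im (L u)\<bar> \<le> 2 * pi"
      by (rule log_quotient_exists[OF zero_in_wave one_in_wave]) (rule that)
    interpret damped_map k h \<kappa> L \<delta> by unfold_locales (fact L \<delta>)+
    show ?thesis
      unfolding S_def
      using charge_measure charge_supported cauchy_transform_charge_le cmod_charge_wave
      by (intro CollectI exI[of _ charge]) auto
  qed
  have ne: "S \<noteq> {}" using mem[of 1] by auto
  have bdd: "bdd_above S" using le by (rule bdd_aboveI)
  have "Sup S \<le> \<kappa>" using ne le by (rule cSup_least)
  moreover have "\<kappa> \<le> Sup S"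
  proof (rule LIMSEQ_le_const2)
    have "(\<lambda>n. \<kappa> / (1 + 1 / real (Suc n)) ^ 8) \<longlonglongrightarrow> \<kappa> / (1 + 0) ^ 8"
      by (intro tendsto_intros lim_1_over_n LIMSEQ_Suc[OF lim_1_over_n]) auto
    then show "(\<lambda>n. \<kappa> / (1 + 1 / real (Suc n)) ^ 8) \<longlonglongrightarrow> \<kappa>" by simp
    show "\<exists>N. \<forall>n\<ge>N. \<kappa> / (1 + 1 / real (Suc n)) ^ 8 \<le> Sup S"
      by (intro exI allI impI cSup_upper[OF mem bdd]) simp
  qed
  ultimately show ?thesis by (simp add: cauchy_capacity_def S_def)
qed

end

theorem theorem1p7:
  shows "\<exists>E :: complex set.
    compact E \<and> connected E \<and> connectedin riemann_sphere (sphere_compl E) \<and>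
    0 < analytic_capacity E \<and>
    analytic_capacity E = cauchy_capacity E \<and>
    (\<exists>f. is_ahlfors_function E f \<and>
         \<not> (\<exists>\<mu>. complex_borel_measure \<mu> \<and> supported_on \<mu> E \<and>
                (\<forall>p\<in>sphere_compl E. f p = cauchy_transform \<mu> p)))"
proof -
  obtain k h \<kappa> where kh: "k holomorphic_on inv_dom" "h holomorphic_on ball 0 1"
    "\<And>z. z \<in> inv_dom \<Longrightarrow> k z \<in> ball 0 1 \<and> h (k z) = z"
    "\<And>z. z \<in> ball 0 1 \<Longrightarrow> h z \<in> inv_dom \<and> k (h z) = z"
    "k 0 = 0" "0 < \<kappa>" "deriv k 0 = of_real \<kappa>"
    by (rule normalized_Riemann_map[OF open_inv_dom simply_connected_inv_dom inv_dom_neq_UNIV zero_in_inv_dom])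
       (rule that)
  interpret wave_map k h \<kappa> by unfold_locales (fact kh)+
  show ?thesis
    using compact_wave connected_wave connectedin_sphere_compl_wave kappa_pos
      is_ahlfors_function_ahl ahl_not_cauchy_transform
    unfolding cauchy_capacity_wave[symmetric]
    by (intro exI[of _ wave] conjI exI[of _ ahl]) (simp_all add: analytic_capacity_wave cauchy_capacity_wave)
qed

end
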